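(* Let $\omega$ be a radial weight, $T\in\{H_\omega,\widetilde{H_\omega}\}$ and $1\le q<p<\infty$. Let $X_q,Y_q\in\{H^q,D^q_{q-1},HL(q),H(\infty,q)\}$ and $X_p,Y_p\in\{H^p,D^p_{p-1},HL(p),H(\infty,p)\}$. If $T:X_q\to Y_q$ is bounded, then $T:X_p\to Y_p$ is bounded.
   Context: $\mathbb{D}$ is the open unit disc of $\mathbb{C}$, $\mathcal{H}(\mathbb{D})$ the space of analytic functions on $\mathbb{D}$, $dA=\frac{dx\,dy}{\pi}$. Radial weights: a radial weight is a nonnegative $\omega\in L^1([0,1))$, extended to $\mathbb{D}$ by $\omega(z)=\omega(|z|)$; standing assumption: $\widehat{\omega}(r)=\int_r^1\omega(s)\,ds>0$ for all $0\le r<1$. Moments: $\omega_x=\int_0^1 r^x\omega(r)\,dr$, $x\ge0$. Operators: $B^\omega_z(\zeta)=\sum_{n\ge0}\frac{(\overline{z}\zeta)^n}{2\omega_{2n+1}}$ is the reproducing kernel of the Bergman space $A^2_\omega=\{f\in\mathcal{H}(\mathbb{D}):\int_{\mathbb{D}}|f|^2\omega\,dA<\infty\}$, and $$H_\omega(f)(z)=\int_0^1 f(t)\left(\frac1z\int_0^zB^\omega_t(\zeta)\,d\zeta\right)\omega(t)\,dt,\qquad \widetilde{H_\omega}(f)(z)=\int_0^1|f(t)|\left(\frac1z\int_0^zB^\omega_t(\zeta)\,d\zeta\right)\omega(t)\,dt.$$ $T:X\to Y$ is bounded if $T(f)$ is well defined and belongs to $Y$ for every $f\in X$, and $\sup_{\|f\|_X\le1}\|T(f)\|_Y<\infty$.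 Spaces, for $1\le p<\infty$ (of $f(z)=\sum_{n\ge 0}\widehat f(n)z^n\in\mathcal{H}(\mathbb{D})$ with finite norm), where $M_p(r,f)=\left(\frac1{2\pi}\int_0^{2\pi}|f(re^{i\theta})|^pd\theta\right)^{1/p}$ and $M_\infty(r,f)=\max_\theta|f(re^{i\theta})|$: $H^p$: $\|f\|_{H^p}=\sup_{0<r<1}M_p(r,f)$; $D^p_{p-1}$: $\|f\|^p=|f(0)|^p+\int_{\mathbb{D}}|f'(z)|^p(1-|z|)^{p-1}dA(z)$; $HL(p)$: $\|f\|^p=\sum_{n\ge0}|\widehat f(n)|^p(n+1)^{p-2}$; $H(\infty,p)$: $\|f\|^p=\int_0^1M_\infty^p(r,f)\,dr$. *)

theory Defs
  imports "HOL-Complex_Analysis.Complex_Analysis"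
begin

section \<open>Radial weights\<close>

text \<open>
  A radial weight is represented by its profile on \<open>[0,1)\<close>; values outside that interval
  are irrelevant.  \<open>absolutely_integrable_on\<close> is Lebesgue integrability.
\<close>

definition weight_tail :: "(real \<Rightarrow> real) \<Rightarrow> real \<Rightarrow> real" where
  "weight_tail \<omega> r = (LINT s:{r..<1}|lebesgue. \<omega> s)"

definition radial_weight :: "(real \<Rightarrow> real) \<Rightarrow> bool" where
  "radial_weight \<omega> \<longleftrightarrow>
     (\<forall>r\<in>{0..<1}. 0 \<le> \<omega> r) \<and> \<omega> absolutely_integrable_on {0..<1} \<and>
     (\<forall>r\<in>{0..<1}. 0 < weight_tail \<omega> r)"

definition moment :: "(real \<Rightarrow> real) \<Rightarrow> real \<Rightarrow> real" where
  "moment \<omega> x = (LINT r:{0..<1}|lebesgue. r powr x * \<omega> r)"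

section \<open>The Hilbert-type operators\<close>

definition bergman_kernel :: "(real \<Rightarrow> real) \<Rightarrow> complex \<Rightarrow> complex \<Rightarrow> complex" where
  "bergman_kernel \<omega> z \<zeta> =
     (\<Sum>n. (cnj z * \<zeta>) ^ n / complex_of_real (2 * moment \<omega> (2 * real n + 1)))"

text \<open>
  \<open>(1/z) \<integral>\<^sub>0\<^sup>z B\<^sub>t(\<zeta>) d\<zeta>\<close>, with its removable singularity at \<open>z = 0\<close> filled in by the limit
  (division by zero would give the value 0 there).
\<close>

definition hilbert_kernel :: "(real \<Rightarrow> real) \<Rightarrow> real \<Rightarrow> complex \<Rightarrow> complex" where
  "hilbert_kernel \<omega> t z =
     (if z = 0 then bergman_kernel \<omega> (of_real t) 0
      else contour_integral (linepath 0 z) (bergman_kernel \<omega> (of_real t)) / z)"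

text \<open>
  The operators are partial maps: they are defined at \<open>f\<close> iff the defining integral converges
  as a Lebesgue integral for every \<open>z\<close> in the unit disc.
\<close>

definition hilbert_op :: "(real \<Rightarrow> real) \<Rightarrow> (complex \<Rightarrow> complex) \<rightharpoonup> (complex \<Rightarrow> complex)" where
  "hilbert_op \<omega> f =
     (if \<forall>z\<in>ball 0 1.
           (\<lambda>t. f (of_real t) * hilbert_kernel \<omega> t z * of_real (\<omega> t))
             absolutely_integrable_on {0..<1}
      then Some (\<lambda>z. LINT t:{0..<1}|lebesgue.
             f (of_real t) * hilbert_kernel \<omega> t z * of_real (\<omega> t))
      else None)"

definition sublinear_hilbert_op ::
  "(real \<Rightarrow> real) \<Rightarrow> (complex \<Rightarrow> complex) \<rightharpoonup> (complex \<Rightarrow> complex)" where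
  "sublinear_hilbert_op \<omega> f =
     (if \<forall>z\<in>ball 0 1.
           (\<lambda>t. of_real (norm (f (of_real t))) * hilbert_kernel \<omega> t z * of_real (\<omega> t))
             absolutely_integrable_on {0..<1}
      then Some (\<lambda>z. LINT t:{0..<1}|lebesgue.
             of_real (norm (f (of_real t))) * hilbert_kernel \<omega> t z * of_real (\<omega> t))
      else None)"

section \<open>Norms and spaces of analytic functions on the disc\<close>

text \<open>
  Norms take values in \<open>[0,\<infinity>]\<close>.  They are meaningful for functions holomorphic on the unit
  disc, and then depend only on the values in the disc.
\<close>

definition ennroot :: "real \<Rightarrow> ennreal \<Rightarrow> ennreal" where
  "ennroot p x = (if x = \<infinity> then \<infinity> else ennreal (enn2real x powr (1 / p)))"

definition integral_mean :: "real \<Rightarrow> real \<Rightarrow> (complex \<Rightarrow> complex) \<Rightarrow> real" where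
  "integral_mean p r f =
     ((LINT \<theta>:{0..2*pi}|lborel. norm (f (of_real r * cis \<theta>)) powr p) / (2 * pi)) powr (1 / p)"

definition max_mean :: "real \<Rightarrow> (complex \<Rightarrow> complex) \<Rightarrow> real" where
  "max_mean r f = (SUP \<theta>\<in>{0..2*pi}. norm (f (of_real r * cis \<theta>)))"

definition taylor_coeff :: "(complex \<Rightarrow> complex) \<Rightarrow> nat \<Rightarrow> complex" where
  "taylor_coeff f n = (deriv ^^ n) f 0 / fact n"

definition hardy_norm :: "real \<Rightarrow> (complex \<Rightarrow> complex) \<Rightarrow> ennreal" where
  "hardy_norm p f = (SUP r\<in>{0<..<1}. ennreal (integral_mean p r f))"

text \<open>The factor \<open>1 / \<pi>\<close> comes from the normalisation \<open>dA = dx dy / \<pi>\<close>.\<close>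

definition dirichlet_norm :: "real \<Rightarrow> (complex \<Rightarrow> complex) \<Rightarrow> ennreal" where
  "dirichlet_norm p f = ennroot p
     (ennreal (norm (f 0) powr p) +
      (\<integral>\<^sup>+z\<in>ball 0 1. ennreal (norm (deriv f z) powr p * (1 - norm z) powr (p - 1) / pi) \<partial>lborel))"

definition hardy_littlewood_norm :: "real \<Rightarrow> (complex \<Rightarrow> complex) \<Rightarrow> ennreal" where
  "hardy_littlewood_norm p f = ennroot p
     (\<Sum>n. ennreal (norm (taylor_coeff f n) powr p * (real n + 1) powr (p - 2)))"

definition mixed_norm_infinity :: "real \<Rightarrow> (complex \<Rightarrow> complex) \<Rightarrow> ennreal" where
  "mixed_norm_infinity p f = ennroot p
     (\<integral>\<^sup>+r\<in>{0..<1}. ennreal (max_mean r f powr p) \<partial>lborel)"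

text \<open>A space of analytic functions is given by its norm.\<close>

definition analytic_space :: "((complex \<Rightarrow> complex) \<Rightarrow> ennreal) \<Rightarrow> (complex \<Rightarrow> complex) set" where
  "analytic_space N = {f. f holomorphic_on ball 0 1 \<and> N f < \<infinity>}"

definition space_norms :: "real \<Rightarrow> ((complex \<Rightarrow> complex) \<Rightarrow> ennreal) set" where
  "space_norms p =
     {hardy_norm p, dirichlet_norm p, hardy_littlewood_norm p, mixed_norm_infinity p}"

definition bounded_operator ::
  "((complex \<Rightarrow> complex) \<rightharpoonup> (complex \<Rightarrow> complex)) \<Rightarrow>
   ((complex \<Rightarrow> complex) \<Rightarrow> ennreal) \<Rightarrow> ((complex \<Rightarrow> complex) \<Rightarrow> ennreal) \<Rightarrow> bool" where
  "bounded_operator T X Y \<longleftrightarrow>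
     (\<forall>f\<in>analytic_space X. \<exists>g\<in>analytic_space Y. T f = Some g) \<and>
     (SUP f\<in>{f \<in> analytic_space X. X f \<le> 1}. Y (the (T f))) < \<infinity>"

end

theory Submission
  imports Defs
begin

text \<open>
  Everything is done on the dyadic scale \<open>I\<^sub>k = [1 - 2\<^sup>-\<^sup>k, 1 - 2\<^sup>-\<^sup>k\<^sup>-\<^sup>1)\<close>, with the moments
  \<open>m\<^sub>k = \<omega>\<^bsub>2^k\<^esub>\<close> in place of \<open>\<omega>\<close>.  Testing the operator on \<open>c / (1 + N (1 - z))\<^sup>2\<close>, whose norm in
  each \<open>X\<^sub>q\<close> is comparable to \<open>c / N powr (1/q)\<close>, and using the growth of functions in \<open>Y\<^sub>q\<close>, one
  gets the doubling property \<open>m\<^sub>k \<le> K m\<^sub>k\<^sub>+\<^sub>1\<close> and the decay \<open>m\<^sub>k \<le> C 2 powr (-(k - j)/q) m\<^sub>j\<close> for \<open>j \<le> k\<close>.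

  Conversely, every \<open>X\<^sub>p\<close> embeds into the functions with \<open>|f| \<le> g\<^sub>k\<close> on \<open>I\<^sub>k\<close> and
  \<open>\<Sum> 2\<^sup>-\<^sup>k g\<^sub>k\<^sup>p < \<infinity>\<close>.  For \<open>F = T f\<close>, doubling yields \<open>|F'(z)| |1 - z| \<le> \<Phi>\<^sub>j\<close> for \<open>|z| \<le> 1 - 2\<^sup>-\<^sup>j\<^sup>-\<^sup>1\<close>, where
  \<open>\<Phi>\<^sub>j\<close> is a constant times \<open>\<Sum>\<^sub>k g\<^sub>k m\<^sub>k / m\<^bsub>min j k\<^esub>\<close>.  The decay with exponent \<open>1/q > 1/p\<close> makes this a
  convolution with geometrically decreasing weights, so that \<open>\<Sum> 2\<^sup>-\<^sup>j \<Phi>\<^sub>j\<^sup>p < \<infinity>\<close>, and for \<open>p > 1\<close> this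
  pointwise bound on \<open>F'\<close> controls all four norms of \<open>F\<close>.
\<close>

section \<open>Discrete Schur test\<close>

text \<open>The obstacle is that \<omega> carries no regularity: the kernel coefficients are
  reciprocals of moments, known to be monotone and little more. For necessity, the test functions
  are positive on the radius and so are all Taylor coefficients of their images, hence any finite
  block of the series bounds the image from below; r = 1 - 1/(2M) and a block of length M isolate
  one quotient of moments, with the position of the block and N/M as free parameters. For
  sufficiency, multiplying the differentiated kernel by 1 - w is a summation by parts in which
  monotone coefficients have nonnegative increments; this dominates the modulus at w by a value at
  |w|, which doubling controls, and it is the origin of the weight |1 - z| in the bound on F'.
  Taylor coefficients of F are estimated separately, since recovering them from that bound by
  Cauchy's formula would cost a logarithm. As q = 1 is allowed, necessity relies only on pointwise
  growth, which holds for all exponents from 1 on; the Hardy embedding and the final norm bounds use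
  p > 1.\<close>

lemma powr_above_tangent:
  fixes x c p :: real
  assumes "1 \<le> p" "0 \<le> x" "0 \<le> c"
  shows "c powr p + p * c powr (p - 1) * (x - c) \<le> x powr p"
\<comment> \<open>Convexity is applied on the open half-line, so the two boundary points are checked
  by hand.\<close>
proof (cases "c = 0 \<or> x = 0")
  case True
  show ?thesis
  proof (cases "c = 0")
    case False
    then have "x = 0" using True by simp
    have "c powr p = c powr (p - 1) * c"
      using False assms by (simp add: powr_diff)
    moreover have "c powr p * 1 \<le> c powr p * p"
      using assms by (intro mult_left_mono) auto
    ultimately show ?thesis using \<open>x = 0\<close> assms by (simp add: algebra_simps)
  qed simp
next
  case False
  have "p * c powr (p - 1) * (x - c) \<le> x powr p - c powr p"
    using assms False
    by (intro convex_on_imp_above_tangent[where A = "{0<..}" and f = "\<lambda>x. x powr p"] powr_convex)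
       (auto intro!: derivative_eq_intros simp: interior_open)
  then show ?thesis by simp
qed

text \<open>The tangent inequality at the mean c = I / W, integrated against w, is Jensen's
  inequality. The total mass W is kept as a factor, so the result applies directly to counting
  measure, to arcs and to the Poisson kernel.\<close>

lemma jensen_powr_integral:
  fixes w \<phi> :: "'a \<Rightarrow> real"
  assumes p: "1 \<le> p" and w: "\<And>x. 0 \<le> w x" and \<phi>: "\<And>x. 0 \<le> \<phi> x"
    and iw: "integrable M w" and i1: "integrable M (\<lambda>x. w x * \<phi> x)"
    and ip: "integrable M (\<lambda>x. w x * \<phi> x powr p)"
  shows "(\<integral>x. w x * \<phi> x \<partial>M) powr p \<le> (\<integral>x. w x \<partial>M) powr (p - 1) * (\<integral>x. w x * \<phi> x powr p \<partial>M)"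
proof -
  define W where "W = (\<integral>x. w x \<partial>M)"
  define I where "I = (\<integral>x. w x * \<phi> x \<partial>M)"
  define c where "c = I / W"
  have W0: "0 \<le> W" and I0: "0 \<le> I" using w \<phi> by (auto simp: W_def I_def)
  show ?thesis
  proof (cases "W = 0")
    case True
    then have "AE x in M. w x = 0"
      using integral_nonneg_eq_0_iff_AE[OF iw] w by (auto simp: W_def)
    then have "AE x in M. w x * \<phi> x = 0" by eventually_elim auto
    then have "I = 0" unfolding I_def using integral_cong_AE[of _ M "\<lambda>_. 0"] i1 by fastforce
    then show ?thesis using w by (auto simp: I_def)
  next
    case False
    have "W * (c powr p - p * c powr (p - 1) * c) + p * c powr (p - 1) * I =
      (\<integral>x. w x * (c powr p - p * c powr (p - 1) * c) + p * c powr (p - 1) * (w x * \<phi> x) \<partial>M)"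
      using iw i1 by (simp add: W_def I_def)
    also have "\<dots> \<le> (\<integral>x. w x * \<phi> x powr p \<partial>M)"
    proof (rule integral_mono[OF _ ip])
      fix x
      have "w x * (c powr p + p * c powr (p - 1) * (\<phi> x - c)) \<le> w x * \<phi> x powr p"
        using powr_above_tangent[OF p \<phi>, of c] W0 I0 w by (intro mult_left_mono) (auto simp: c_def)
      then show "w x * (c powr p - p * c powr (p - 1) * c) + p * c powr (p - 1) * (w x * \<phi> x)
          \<le> w x * \<phi> x powr p"
        by (simp add: algebra_simps)
    qed (use iw i1 in auto)
    finally have "W * c powr p \<le> (\<integral>x. w x * \<phi> x powr p \<partial>M)"
      using False by (simp add: c_def algebra_simps)
    then have "W powr (p - 1) * (W * c powr p) \<le> W powr (p - 1) * (\<integral>x. w x * \<phi> x powr p \<partial>M)"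
      by (intro mult_left_mono) auto
    moreover have "W powr (p - 1) * (W * c powr p) = I powr p"
      using False W0 I0 by (simp add: c_def powr_divide powr_diff)
    ultimately show ?thesis by (simp add: W_def I_def)
  qed
qed

lemma jensen_powr_sum:
  fixes w x :: "'a \<Rightarrow> real"
  assumes "1 \<le> p" "finite S" and w: "\<And>i. i \<in> S \<Longrightarrow> 0 \<le> w i" and x: "\<And>i. i \<in> S \<Longrightarrow> 0 \<le> x i"
  shows "(\<Sum>i\<in>S. w i * x i) powr p \<le> (\<Sum>i\<in>S. w i) powr (p - 1) * (\<Sum>i\<in>S. w i * x i powr p)"
proof -
  \<comment> \<open>The integral version asks for nonnegativity everywhere, not just on S; absolute
    values provide it.\<close>
  have "(\<Sum>i\<in>S. \<bar>w i\<bar> * \<bar>x i\<bar>) powr p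
      \<le> (\<Sum>i\<in>S. \<bar>w i\<bar>) powr (p - 1) * (\<Sum>i\<in>S. \<bar>w i\<bar> * \<bar>x i\<bar> powr p)"
    using jensen_powr_integral[of p "\<lambda>i. \<bar>w i\<bar>" "\<lambda>i. \<bar>x i\<bar>" "count_space S"] assms(1,2)
    by (simp add: lebesgue_integral_count_space_finite integrable_count_space)
  then show ?thesis using w x by simp
qed

text \<open>With truncated subtraction, \<open>k - i + (i - k)\<close> is the distance of the natural numbers \<open>k\<close> and \<open>i\<close>.\<close>

lemma sum_power_dist_le:
  fixes \<eta> :: real
  assumes "0 \<le> \<eta>" "\<eta> < 1"
  shows "(\<Sum>i<m. \<eta> ^ (k - i + (i - k))) \<le> 2 / (1 - \<eta>)"
proof -
  have geo: "(\<Sum>i\<in>A. \<eta> ^ i) \<le> 1 / (1 - \<eta>)" if "finite A" for A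
    using sum_le_suminf[OF summable_geometric[of \<eta>] that] suminf_geometric[of \<eta>] assms by simp
  have "(\<Sum>i<m. \<eta> ^ (k - i + (i - k))) \<le> (\<Sum>i\<in>{..<k} \<union> {k..<k + m}. \<eta> ^ (k - i + (i - k)))"
    using assms by (intro sum_mono2) auto
  also have "\<dots> = (\<Sum>i<k. \<eta> ^ (k - i)) + (\<Sum>i = k..<k + m. \<eta> ^ (i - k))"
    by (subst sum.union_disjoint) (auto intro!: sum.cong arg_cong2[where f = "(+)"])
  also have "(\<Sum>i<k. \<eta> ^ (k - i)) = (\<Sum>i\<in>(\<lambda>i. k - i) ` {..<k}. \<eta> ^ i)"
    by (subst sum.reindex) (auto simp: inj_on_def)
  also have "(\<Sum>i = k..<k + m. \<eta> ^ (i - k)) = (\<Sum>i\<in>(\<lambda>i. i - k) ` {k..<k + m}. \<eta> ^ i)"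
    by (subst sum.reindex) (auto simp: inj_on_def)
  finally show ?thesis using geo[of "(\<lambda>i. k - i) ` {..<k}"] geo[of "(\<lambda>i. i - k) ` {k..<k + m}"] by simp
qed

text \<open>Schur's test with constant weights: Jensen against row k brings in the row sum to the
  power p - 1, and after interchanging the sums the column sum supplies the remaining factor, the
  distance being symmetric.\<close>

lemma schur_dyadic_finite:
  fixes \<eta> p :: real and x :: "nat \<Rightarrow> real"
  assumes \<eta>: "0 \<le> \<eta>" "\<eta> < 1" and p: "1 \<le> p" and x: "\<And>i. 0 \<le> x i"
  shows "(\<Sum>k<n. (\<Sum>i<m. \<eta> ^ (k - i + (i - k)) * x i) powr p)
    \<le> (2 / (1 - \<eta>)) powr p * (\<Sum>i<m. x i powr p)"
proof -
  let ?A = "2 / (1 - \<eta>)"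
  have "(\<Sum>k<n. (\<Sum>i<m. \<eta> ^ (k - i + (i - k)) * x i) powr p)
      \<le> (\<Sum>k<n. ?A powr (p - 1) * (\<Sum>i<m. \<eta> ^ (k - i + (i - k)) * x i powr p))"
  proof (rule sum_mono)
    fix k
    have "(\<Sum>i<m. \<eta> ^ (k - i + (i - k)) * x i) powr p
      \<le> (\<Sum>i<m. \<eta> ^ (k - i + (i - k))) powr (p - 1) * (\<Sum>i<m. \<eta> ^ (k - i + (i - k)) * x i powr p)"
      using assms by (intro jensen_powr_sum) auto
    also have "\<dots> \<le> ?A powr (p - 1) * (\<Sum>i<m. \<eta> ^ (k - i + (i - k)) * x i powr p)"
      using assms by (intro mult_right_mono powr_mono2 sum_power_dist_le sum_nonneg) auto
    finally show "(\<Sum>i<m. \<eta> ^ (k - i + (i - k)) * x i) powr p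
      \<le> ?A powr (p - 1) * (\<Sum>i<m. \<eta> ^ (k - i + (i - k)) * x i powr p)" .
  qed
  also have "\<dots> = ?A powr (p - 1) * (\<Sum>i<m. (\<Sum>k<n. \<eta> ^ (i - k + (k - i))) * x i powr p)"
    unfolding sum_distrib_left[symmetric] sum_distrib_right
    by (subst sum.swap) (simp add: add.commute)
  also have "\<dots> \<le> ?A powr (p - 1) * (\<Sum>i<m. ?A * x i powr p)"
    using assms by (intro mult_left_mono sum_mono mult_right_mono sum_power_dist_le) auto
  also have "\<dots> = ?A powr p * (\<Sum>i<m. x i powr p)"
    unfolding sum_distrib_left[symmetric] using \<eta> by (simp add: powr_diff)
  finally show ?thesis .
qed

text \<open>Hypothesis and conclusion speak of partial sums, the form in which they are produced and
  consumed below. Letting m tend to infinity in the finite version requires convergence of the inner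
  series, which follows because L bounds every single \<open>x i\<close>.\<close>

lemma schur_dyadic:
  fixes \<eta> p :: real and x :: "nat \<Rightarrow> real"
  assumes \<eta>: "0 \<le> \<eta>" "\<eta> < 1" and p: "1 \<le> p" and x: "\<And>i. 0 \<le> x i"
    and L: "\<And>m. (\<Sum>i<m. x i powr p) \<le> L"
  shows "summable (\<lambda>i. \<eta> ^ (k - i + (i - k)) * x i)"
    and "(\<Sum>k<n. (\<Sum>i. \<eta> ^ (k - i + (i - k)) * x i) powr p) \<le> (2 / (1 - \<eta>)) powr p * L"
proof -
  have xb: "x i \<le> L powr (1 / p)" for i
  proof -
    have "x i powr p \<le> L" using L[of "Suc i"] sum_nonneg[of "{..<i}" "\<lambda>i. x i powr p"] by simp
    then have "(x i powr p) powr (1 / p) \<le> L powr (1 / p)" using p by (intro powr_mono2) auto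
    then show ?thesis using p x[of i] by (simp add: powr_powr)
  qed
  have sumd: "summable (\<lambda>i. \<eta> ^ (k - i + (i - k)) * x i)" for k
  proof (rule summableI_nonneg_bounded[where x = "2 / (1 - \<eta>) * L powr (1 / p)"])
    fix n
    have "(\<Sum>i<n. \<eta> ^ (k - i + (i - k)) * x i) \<le> (\<Sum>i<n. \<eta> ^ (k - i + (i - k)) * L powr (1 / p))"
      using \<eta> xb by (intro sum_mono mult_left_mono) auto
    also have "\<dots> \<le> 2 / (1 - \<eta>) * L powr (1 / p)"
      unfolding sum_distrib_right[symmetric] using \<eta> by (intro mult_right_mono sum_power_dist_le) auto
    finally show "(\<Sum>i<n. \<eta> ^ (k - i + (i - k)) * x i) \<le> 2 / (1 - \<eta>) * L powr (1 / p)" .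
  qed (use \<eta> x in auto)
  then show "summable (\<lambda>i. \<eta> ^ (k - i + (i - k)) * x i)" .
  show "(\<Sum>k<n. (\<Sum>i. \<eta> ^ (k - i + (i - k)) * x i) powr p) \<le> (2 / (1 - \<eta>)) powr p * L"
  proof (rule tendsto_upperbound)
    show "(\<lambda>m. \<Sum>k<n. (\<Sum>i<m. \<eta> ^ (k - i + (i - k)) * x i) powr p)
        \<longlonglongrightarrow> (\<Sum>k<n. (\<Sum>i. \<eta> ^ (k - i + (i - k)) * x i) powr p)"
      using p \<eta> x by (intro tendsto_sum tendsto_powr' summable_LIMSEQ sumd tendsto_const)
        (auto intro!: always_eventually sum_nonneg)
    show "\<forall>\<^sub>F m in sequentially. (\<Sum>k<n. (\<Sum>i<m. \<eta> ^ (k - i + (i - k)) * x i) powr p)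
        \<le> (2 / (1 - \<eta>)) powr p * L"
      using schur_dyadic_finite[OF \<eta> p x] L
      by (intro always_eventually allI order_trans[OF schur_dyadic_finite[OF \<eta> p x]] mult_left_mono) auto
  qed simp
qed

section \<open>Dyadic arcs and the Poisson integral\<close>

lemma set_nn_integral_UN_disjoint:
  fixes A :: "nat \<Rightarrow> 'a set"
  assumes "\<And>i. A i \<in> sets M" "disjoint_family A"
    and m: "\<And>i. (\<lambda>x. f x * indicator (A i) x) \<in> borel_measurable M"
  shows "(\<integral>\<^sup>+x\<in>(\<Union>i. A i). f x \<partial>M) = (\<Sum>i. \<integral>\<^sup>+x\<in>A i. f x \<partial>M)"
proof -
  have "(\<integral>\<^sup>+x\<in>(\<Union>i. A i). f x \<partial>M) = (\<integral>\<^sup>+x. (\<Sum>i. f x * indicator (A i) x) \<partial>M)"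
    using suminf_indicator[OF assms(2)] by (intro nn_integral_cong) simp
  also have "\<dots> = (\<Sum>i. \<integral>\<^sup>+x\<in>A i. f x \<partial>M)"
    using m by (rule nn_integral_suminf)
  finally show ?thesis .
qed

text \<open>Monotonicity of \<open>nn_integral\<close> alone compares f with a step function. This
  lets the lemma be used for maximum means on circles, whose measurability is never
  established.\<close>

lemma set_nn_integral_UN_le:
  fixes A :: "nat \<Rightarrow> 'a set" and B :: "nat \<Rightarrow> ennreal"
  assumes A: "\<And>i. A i \<in> sets M" and le: "\<And>i x. x \<in> A i \<Longrightarrow> f x \<le> B i"
  shows "(\<integral>\<^sup>+x\<in>(\<Union>i. A i). f x \<partial>M) \<le> (\<Sum>i. B i * emeasure M (A i))"
proof -
  have "(\<integral>\<^sup>+x\<in>(\<Union>i. A i). f x \<partial>M) \<le> (\<integral>\<^sup>+x. (\<Sum>i. B i * indicator (A i) x) \<partial>M)"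
  proof (rule nn_integral_mono)
    fix x
    show "f x * indicator (\<Union>i. A i) x \<le> (\<Sum>i. B i * indicator (A i) x)"
    proof (cases "\<exists>i. x \<in> A i")
      case True
      then obtain i where i: "x \<in> A i" ..
      then have "f x * indicator (\<Union>i. A i) x \<le> (\<Sum>j\<in>{i}. B j * indicator (A j) x)"
        using le[of x i] by (auto simp: indicator_def)
      also have "\<dots> \<le> (\<Sum>j. B j * indicator (A j) x)"
        by (intro sum_le_suminf) auto
      finally show ?thesis .
    qed auto
  qed
  also have "\<dots> = (\<Sum>i. \<integral>\<^sup>+x. B i * indicator (A i) x \<partial>M)"
    using A by (intro nn_integral_suminf) auto
  also have "\<dots> = (\<Sum>i. B i * emeasure M (A i))"
    using A by (simp add: nn_integral_cmult_indicator)
  finally show ?thesis .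
qed

lemma suminf_ennreal_le:
  assumes "\<And>i. 0 \<le> b i" "\<And>n. (\<Sum>i<n. b i) \<le> L"
  shows "(\<Sum>i. ennreal (b i)) \<le> ennreal L"
  using assms by (intro suminf_le_const) (auto simp: ennreal_leI)

section \<open>Dyadic decomposition of the circle around the point 1\<close>

definition circle_dist :: "real \<Rightarrow> real" where
  "circle_dist \<theta> = min \<theta> (2 * pi - \<theta>)"

text \<open>Each set consists of two arcs placed symmetrically about the point 1 of the circle. That
  point itself, \<theta> = 0 or 2 pi, lies in none of them, which costs only a null set.\<close>

definition dyadic_arc :: "nat \<Rightarrow> real set" where
  "dyadic_arc i = {\<theta>\<in>{0<..<2*pi}. pi / 2 ^ Suc i < circle_dist \<theta> \<and> circle_dist \<theta> \<le> pi / 2 ^ i}"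

lemma borel_measurable_circle_dist [measurable]: "circle_dist \<in> borel_measurable borel"
  unfolding circle_dist_def by measurable

lemma sets_dyadic_arc [measurable]: "dyadic_arc i \<in> sets borel"
  unfolding dyadic_arc_def by measurable

lemma dyadic_index_exists:
  fixes x c :: real
  assumes "0 < x" "x \<le> c"
  obtains i where "c / 2 ^ Suc i < x" "x \<le> c / 2 ^ i"
proof -
  have "\<exists>i. c / 2 ^ i < x"
  proof -
    obtain n where "c / x < 2 ^ n" using real_arch_pow[of 2 "c / x"] by auto
    then show ?thesis using assms by (intro exI[of _ n]) (simp add: field_simps)
  qed
  \<comment> \<open>The wanted index is the predecessor of the least n with c / 2 ^ n < x; the
    assumption x \<le> c excludes n = 0.\<close>
  then obtain n where n: "c / 2 ^ n < x" "\<And>i. i < n \<Longrightarrow> \<not> c / 2 ^ i < x"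
    using exists_least_iff[of "\<lambda>i. c / 2 ^ i < x"] by auto
  with assms have "n \<noteq> 0" by (cases n) auto
  then obtain i where "n = Suc i" by (cases n) auto
  with n that[of i] show ?thesis by fastforce
qed

lemma dyadic_interval_unique:
  fixes x c :: real
  assumes "0 < c" "c / 2 ^ Suc i < x" "x \<le> c / 2 ^ i" "c / 2 ^ Suc j < x" "x \<le> c / 2 ^ j"
  shows "i = j"
proof -
  have "\<not> i < j" if "c / 2 ^ Suc i < x" "x \<le> c / 2 ^ j" for i j :: nat
  proof
    assume "i < j"
    then have "c / 2 ^ j \<le> c / 2 ^ Suc i"
      using assms(1) by (intro divide_left_mono power_increasing) auto
    with that show False by simp
  qed
  then show ?thesis using assms by (meson linorder_neqE_nat)
qed

lemma disjoint_family_dyadic_arc: "disjoint_family dyadic_arc"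
  unfolding disjoint_family_on_def dyadic_arc_def
  using dyadic_interval_unique[OF pi_gt_zero] by blast

lemma UN_dyadic_arc: "(\<Union>i. dyadic_arc i) = {0<..<2*pi}"
proof
  show "{0<..<2*pi} \<subseteq> (\<Union>i. dyadic_arc i)"
  proof
    fix \<theta> :: real assume t: "\<theta> \<in> {0<..<2*pi}"
    then have "0 < circle_dist \<theta>" "circle_dist \<theta> \<le> pi" by (auto simp: circle_dist_def)
    then obtain i where "pi / 2 ^ Suc i < circle_dist \<theta>" "circle_dist \<theta> \<le> pi / 2 ^ i"
      using dyadic_index_exists by metis
    then show "\<theta> \<in> (\<Union>i. dyadic_arc i)" using t by (auto simp: dyadic_arc_def)
  qed
qed (auto simp: dyadic_arc_def)

lemma emeasure_dyadic_arc_le: "emeasure lborel (dyadic_arc i) \<le> ennreal (2 * pi / 2 ^ i)"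
proof -
  have "dyadic_arc i \<subseteq> {0..pi / 2 ^ i} \<union> {2*pi - pi / 2 ^ i..2*pi}"
    by (auto simp: dyadic_arc_def circle_dist_def min_def split: if_splits)
  then have "emeasure lborel (dyadic_arc i)
      \<le> emeasure lborel ({0..pi / 2 ^ i} \<union> {2*pi - pi / 2 ^ i..2*pi})"
    by (intro emeasure_mono) auto
  also have "\<dots> \<le> emeasure lborel {0..pi / 2 ^ i} + emeasure lborel {2*pi - pi / 2 ^ i..2*pi}"
    by (rule emeasure_subadditive) auto
  also have "\<dots> = ennreal (2 * pi / 2 ^ i)"
    by (simp add: ennreal_plus[symmetric] del: ennreal_plus)
  finally show ?thesis .
qed

lemma AE_circle_interior: "AE \<theta> in lborel. (\<theta> \<in> {0..2*pi}) = (\<theta> \<in> {0<..<2*pi})"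
proof -
  have "AE \<theta> in lborel. \<theta> \<noteq> (0::real)" "AE \<theta> in lborel. \<theta> \<noteq> 2 * pi"
    by (rule AE_lborel_singleton)+
  then show ?thesis by eventually_elim auto
qed

lemma nn_integral_circle_interior:
  "(\<integral>\<^sup>+\<theta>\<in>{0..2*pi}. f \<theta> \<partial>lborel) = (\<integral>\<^sup>+\<theta>\<in>{0<..<2*pi}. f \<theta> \<partial>lborel)"
  using AE_circle_interior
  by (intro nn_integral_cong_AE) (auto elim!: eventually_mono simp: indicator_def)

lemma nn_integral_circle_arcs:
  assumes "(\<lambda>\<theta>. f \<theta> * indicator {0..2*pi} \<theta>) \<in> borel_measurable borel"
  shows "(\<integral>\<^sup>+\<theta>\<in>{0..2*pi}. f \<theta> \<partial>lborel) = (\<Sum>i. \<integral>\<^sup>+\<theta>\<in>dyadic_arc i. f \<theta> \<partial>lborel)"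
proof -
  have "(\<lambda>\<theta>. f \<theta> * indicator (dyadic_arc i) \<theta>) \<in> borel_measurable borel" for i
  proof -
    have "(\<lambda>\<theta>. f \<theta> * indicator (dyadic_arc i) \<theta>)
      = (\<lambda>\<theta>. (f \<theta> * indicator {0..2*pi} \<theta>) * indicator (dyadic_arc i) \<theta>)"
      by (auto simp: indicator_def dyadic_arc_def fun_eq_iff)
    then show ?thesis using assms by simp
  qed
  then show ?thesis
    unfolding nn_integral_circle_interior UN_dyadic_arc[symmetric]
    using disjoint_family_dyadic_arc by (intro set_nn_integral_UN_disjoint) auto
qed

lemma nn_integral_circle_le:
  assumes B: "\<And>i. 0 \<le> B i" and le: "\<And>i \<theta>. \<theta> \<in> dyadic_arc i \<Longrightarrow> f \<theta> \<le> ennreal (B i)"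
    and L: "\<And>n. (\<Sum>i<n. B i / 2 ^ i) \<le> L"
  shows "(\<integral>\<^sup>+\<theta>\<in>{0..2*pi}. f \<theta> \<partial>lborel) \<le> ennreal (2 * pi * L)"
proof -
  have "(\<integral>\<^sup>+\<theta>\<in>{0..2*pi}. f \<theta> \<partial>lborel) \<le> (\<Sum>i. ennreal (B i) * emeasure lborel (dyadic_arc i))"
    unfolding nn_integral_circle_interior UN_dyadic_arc[symmetric]
    using le by (intro set_nn_integral_UN_le) auto
  also have "\<dots> \<le> (\<Sum>i. ennreal (2 * pi * (B i / 2 ^ i)))"
  proof (intro suminf_le)
    fix i
    have "ennreal (B i) * emeasure lborel (dyadic_arc i) \<le> ennreal (B i) * ennreal (2 * pi / 2 ^ i)"
      by (intro mult_left_mono emeasure_dyadic_arc_le) auto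
    also have "\<dots> = ennreal (2 * pi * (B i / 2 ^ i))"
      using B by (simp add: ennreal_mult[symmetric] mult_ac)
    finally show "ennreal (B i) * emeasure lborel (dyadic_arc i) \<le> ennreal (2 * pi * (B i / 2 ^ i))" .
  qed auto
  also have "\<dots> \<le> ennreal (2 * pi * L)"
  proof (rule suminf_ennreal_le)
    show "(\<Sum>i<n. 2 * pi * (B i / 2 ^ i)) \<le> 2 * pi * L" for n
      unfolding sum_distrib_left[symmetric] using L by (intro mult_left_mono) auto
  qed (use B in auto)
  finally show ?thesis .
qed

lemma sin_ge_half:
  fixes x :: real
  assumes "0 \<le> x" "x \<le> pi / 2"
  shows "x / 2 \<le> sin x"
proof -
  have "\<bar>sin x - (\<Sum>m<3. sin_coeff m * x ^ m)\<bar> \<le> inverse (fact 3) * \<bar>x\<bar> ^ 3"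
    by (rule Maclaurin_sin_bound)
  moreover have "(\<Sum>m<3. sin_coeff m * x ^ m) = x"
    by (simp add: sin_coeff_def eval_nat_numeral)
  ultimately have "\<bar>sin x - x\<bar> \<le> x ^ 3 / 6" using assms by (simp add: eval_nat_numeral)
  then have *: "x - x ^ 3 / 6 \<le> sin x" by linarith
  \<comment> \<open>Since pi / 2 \<le> 1.6, the square of x is at most 3, and the cubic error x^3 /
    6 is at most x / 2.\<close>
  have "x * x \<le> (1.6 * 1.6)"
    using assms pi_approx by (intro mult_mono) auto
  then have "x * (x * x) \<le> x * 3" using assms by (intro mult_left_mono) auto
  then show ?thesis using * by (simp add: power3_eq_cube)
qed

text \<open>The bound is uniform in r. Where the cosine is nonpositive the real part is at least 1,
  which exceeds pi / 4; elsewhere a rotation by \<open>cis (-\<theta>)\<close> makes the imaginary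
  part equal to the sine up to sign.\<close>

lemma norm_one_minus_cis_ge:
  assumes "0 \<le> \<theta>" "\<theta> \<le> 2 * pi" "0 \<le> r"
  shows "circle_dist \<theta> / 4 \<le> norm (1 - of_real r * cis \<theta>)"
proof (cases "cos \<theta> \<le> 0")
  case True
  have "1 \<le> Re (1 - of_real r * cis \<theta>)"
    using mult_nonneg_nonpos[OF assms(3) True] by simp
  also have "\<dots> \<le> norm (1 - of_real r * cis \<theta>)" by (rule complex_Re_le_cmod)
  finally show ?thesis using assms pi_less_4 by (auto simp: circle_dist_def min_def)
next
  case False
  have eq: "norm (1 - of_real r * cis \<theta>) = norm (cis (-\<theta>) - of_real r)"
  proof -
    have "norm (1 - of_real r * cis \<theta>) = norm (cis (-\<theta>) * (1 - of_real r * cis \<theta>))"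
      by (simp add: norm_mult)
    also have "cis (-\<theta>) * (1 - of_real r * cis \<theta>) = cis (-\<theta>) - of_real r * (cis (-\<theta>) * cis \<theta>)"
      by (simp add: algebra_simps)
    also have "\<dots> = cis (-\<theta>) - of_real r" by (simp add: cis_mult)
    finally show ?thesis .
  qed
  have "\<bar>sin \<theta>\<bar> \<le> norm (1 - of_real r * cis \<theta>)"
    unfolding eq using abs_Im_le_cmod[of "cis (-\<theta>) - of_real r"] by simp
  moreover have "circle_dist \<theta> / 2 \<le> \<bar>sin \<theta>\<bar>"
  proof -
    have "\<not> (pi / 2 \<le> \<theta> \<and> \<theta> \<le> 3 * pi / 2)"
    proof
      assume "pi / 2 \<le> \<theta> \<and> \<theta> \<le> 3 * pi / 2"
      then have "0 \<le> cos (\<theta> - pi)" by (intro cos_ge_zero) auto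
      then show False using False by (simp add: cos_diff)
    qed
    then consider "\<theta> \<le> pi / 2" | "3 * pi / 2 \<le> \<theta>" by linarith
    then show ?thesis
    proof cases
      case 1
      then show ?thesis using sin_ge_half[of \<theta>] assms by (auto simp: circle_dist_def)
    next
      case 2
      have "(2 * pi - \<theta>) / 2 \<le> sin (2 * pi - \<theta>)" using 2 assms by (intro sin_ge_half) auto
      also have "sin (2 * pi - \<theta>) \<le> \<bar>sin \<theta>\<bar>" by (simp add: sin_diff)
      finally show ?thesis by (auto simp: circle_dist_def)
    qed
  qed
  moreover have "circle_dist \<theta> \<ge> 0" using assms by (auto simp: circle_dist_def)
  ultimately show ?thesis by linarith
qed

lemma norm_one_minus_cis_ge_arc:
  assumes "\<theta> \<in> dyadic_arc i" "0 \<le> r"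
  shows "1 / (4 * 2 ^ i) \<le> norm (1 - of_real r * cis \<theta>)"
proof -
  have "1 / (4 * 2 ^ i) \<le> (pi / 2 ^ Suc i) / 4"
    using pi_ge_two by (simp add: field_simps)
  also have "\<dots> \<le> circle_dist \<theta> / 4" using assms by (auto simp: dyadic_arc_def)
  also have "\<dots> \<le> norm (1 - of_real r * cis \<theta>)"
    using assms by (intro norm_one_minus_cis_ge) (auto simp: dyadic_arc_def)
  finally show ?thesis .
qed

section \<open>The Poisson kernel for points on the radius\<close>

definition poisson_kernel :: "real \<Rightarrow> real \<Rightarrow> real" where
  "poisson_kernel s \<theta> = (1 - s\<^sup>2) / (norm (1 - of_real s * cis \<theta>))\<^sup>2"

lemma poisson_kernel_nonneg: "0 \<le> s \<Longrightarrow> s < 1 \<Longrightarrow> 0 \<le> poisson_kernel s \<theta>"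
  by (simp add: poisson_kernel_def power_le_one_iff abs_square_le_1)

lemma one_minus_cis_nonzero: "0 \<le> s \<Longrightarrow> s < 1 \<Longrightarrow> 1 - of_real s * cis \<theta> \<noteq> 0"
proof
  assume s: "0 \<le> s" "s < 1" and "1 - of_real s * cis \<theta> = 0"
  then have "norm (of_real s * cis \<theta>) = norm (1::complex)" by simp
  then show False using s by (simp add: norm_mult)
qed

lemma continuous_on_poisson_kernel:
  "0 \<le> s \<Longrightarrow> s < 1 \<Longrightarrow> continuous_on A (poisson_kernel s)"
  unfolding poisson_kernel_def [abs_def] using one_minus_cis_nonzero
  by (auto intro!: continuous_intros)

lemma norm_one_minus_ge: "1 - norm z \<le> norm (1 - z :: complex)"
  using norm_triangle_ineq2[of 1 z] by simp

lemma poisson_kernel_le: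
  assumes "0 \<le> s" "s < 1"
  shows "poisson_kernel s \<theta> \<le> 2 / (1 - s)"
proof -
  have "1 - s \<le> norm (1 - of_real s * cis \<theta>)"
    using norm_one_minus_ge[of "of_real s * cis \<theta>"] assms by (simp add: norm_mult)
  then have "(1 - s)\<^sup>2 \<le> (norm (1 - of_real s * cis \<theta>))\<^sup>2"
    using assms by (intro power_mono) auto
  then have "poisson_kernel s \<theta> \<le> (1 - s\<^sup>2) / (1 - s)\<^sup>2"
    unfolding poisson_kernel_def using assms
    by (intro divide_left_mono) (auto simp: power_le_one_iff abs_square_le_1 one_minus_cis_nonzero intro!: mult_pos_pos)
  also have "\<dots> = (1 + s) / (1 - s)"
    using assms by (simp add: power2_eq_square divide_simps) (simp add: algebra_simps)
  also have "\<dots> \<le> 2 / (1 - s)" using assms by (intro divide_right_mono) auto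
  finally show ?thesis .
qed

text \<open>Cauchy's formula at s for G(w) / (1 - s w). On the unit circle (1 - s w)(w - s) equals w
  |1 - s w|^2, so after multiplication by 1 - s^2 the Cauchy kernel becomes the Poisson
  kernel.\<close>

lemma poisson_integral:
  fixes G :: "complex \<Rightarrow> complex"
  assumes S: "open S" "cball 0 1 \<subseteq> S" and G: "G holomorphic_on S" and s: "0 \<le> s" "s < 1"
  shows "((\<lambda>\<theta>. G (cis \<theta>) * of_real (poisson_kernel s \<theta>)) has_integral (complex_of_real (2 * pi) * G (of_real s))) {0..2*pi}"
proof -
  let ?h = "\<lambda>w. G w / (1 - of_real s * w)"
  have nz: "1 - of_real s * w \<noteq> 0" if "norm w \<le> 1" for w :: complex
  proof
    assume "1 - of_real s * w = 0"
    then have "norm (of_real s * w) = norm (1::complex)" by simp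
    moreover have "s * norm w < 1" using s that mult_left_le[of "norm w" s] by simp
    ultimately show False using s by (simp add: norm_mult)
  qed
  have "?h holomorphic_on cball 0 1"
    using nz by (intro holomorphic_intros holomorphic_on_subset[OF G S(2)]) auto
  then have "((\<lambda>u. ?h u / (u - of_real s)) has_contour_integral (2 * of_real pi * \<i> * ?h (of_real s)))
      (circlepath 0 1)"
    using s by (intro Cauchy_integral_circlepath_simple) auto
  then have "((\<lambda>t. ?h (cis t) / (cis t - of_real s) * \<i> * cis t) has_integral
      (2 * of_real pi * \<i> * ?h (of_real s))) {0..2*pi}"
    unfolding circlepath_def by (subst (asm) has_contour_integral_part_circlepath_iff) auto
  from has_integral_mult_right[OF this, of "(1 - (of_real s)\<^sup>2) / \<i>"]
  have "((\<lambda>t. (1 - (of_real s)\<^sup>2) / \<i> * (?h (cis t) / (cis t - of_real s) * \<i> * cis t)) has_integral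
      ((1 - (of_real s)\<^sup>2) / \<i> * (2 * of_real pi * \<i> * ?h (of_real s)))) {0..2*pi}" .
  also have "(1 - (of_real s)\<^sup>2) / \<i> * (2 * of_real pi * \<i> * ?h (of_real s)) = complex_of_real (2 * pi) * G (of_real s)"
    using nz[of "of_real s"] s by (simp add: power2_eq_square)
  also have "(\<lambda>t. (1 - (of_real s)\<^sup>2) / \<i> * (?h (cis t) / (cis t - of_real s) * \<i> * cis t))
      = (\<lambda>\<theta>. G (cis \<theta>) * of_real (poisson_kernel s \<theta>))"
  proof
    fix t
    have "cis t * cnj (1 - of_real s * cis t) = cis t - of_real s * (cis t * cis (-t))"
      by (simp add: algebra_simps cis_cnj)
    then have "cis t - of_real s = cis t * cnj (1 - of_real s * cis t)" by (simp add: cis_mult)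
    moreover have "(1 - of_real s * cis t) * cnj (1 - of_real s * cis t)
        = of_real ((norm (1 - of_real s * cis t))\<^sup>2)"
      by (simp only: complex_norm_square)
    ultimately have "(1 - of_real s * cis t) * (cis t - of_real s)
        = cis t * of_real ((norm (1 - of_real s * cis t))\<^sup>2)"
      by (simp add: mult_ac)
    then have A: "cis t / ((1 - of_real s * cis t) * (cis t - of_real s))
        = 1 / of_real ((norm (1 - of_real s * cis t))\<^sup>2)"
      by simp
    have B: "a / \<i> * (g / b / d * \<i> * w) = g * (a * (w / (b * d)))" for a b d g w :: complex
    proof -
      have "a / \<i> * (g / b / d * \<i> * w) = (\<i> / \<i>) * (g * (a * (w / (b * d))))"
        by (simp only: divide_inverse mult_ac inverse_mult_distrib)
      then show ?thesis by simp
    qed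
    show "(1 - (of_real s)\<^sup>2) / \<i> * (?h (cis t) / (cis t - of_real s) * \<i> * cis t)
        = G (cis t) * of_real (poisson_kernel s t)"
      unfolding B A by (simp add: poisson_kernel_def)
  qed
  finally show ?thesis .
qed

lemma integral_poisson_kernel:
  assumes "0 \<le> s" "s < 1"
  shows "(poisson_kernel s has_integral 2 * pi) {0..2*pi}"
proof -
  have "((\<lambda>\<theta>. 1 * complex_of_real (poisson_kernel s \<theta>)) has_integral (complex_of_real (2 * pi) * 1)) {0..2*pi}"
    by (rule poisson_integral[of UNIV]) (use assms in auto)
  from has_integral_Re[OF this] show ?thesis by simp
qed

lemma poisson_integral_norm_le:
  assumes S: "open S" "cball 0 1 \<subseteq> S" and G: "G holomorphic_on S" and s: "0 \<le> s" "s < 1"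
  shows "2 * pi * norm (G (of_real s)) \<le> (LINT \<theta>:{0..2*pi}|lborel. poisson_kernel s \<theta> * norm (G (cis \<theta>)))"
proof -
  have cG: "continuous_on {0..2*pi} (\<lambda>\<theta>. G (cis \<theta>))"
    using S(2) by (intro continuous_on_compose2[OF holomorphic_on_imp_continuous_on[OF G]] continuous_intros) auto
  note cont = cG continuous_on_poisson_kernel[OF s]
  have int: "(\<lambda>\<theta>. poisson_kernel s \<theta> * norm (G (cis \<theta>))) integrable_on {0..2*pi}"
    by (intro integrable_continuous_real continuous_intros cont)
  have "norm (complex_of_real (2 * pi) * G (of_real s)) \<le> integral {0..2*pi} (\<lambda>\<theta>. poisson_kernel s \<theta> * norm (G (cis \<theta>)))"
    unfolding integral_unique[OF poisson_integral[OF assms], symmetric]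
    using poisson_kernel_nonneg[OF s] has_integral_integrable[OF poisson_integral[OF assms]]
    by (intro integral_norm_bound_integral int) (auto simp: norm_mult)
  also have "\<dots> = (LINT \<theta>:{0..2*pi}|lborel. poisson_kernel s \<theta> * norm (G (cis \<theta>)))"
    by (intro set_borel_integral_eq_integral(2)[symmetric] borel_integrable_atLeastAtMost'
        continuous_intros cont)
  finally show ?thesis by (simp add: norm_mult)
qed

text \<open>Subharmonicity of |G|^p, obtained from Jensen's inequality against the Poisson kernel,
  whose total mass is 2 pi.\<close>

lemma poisson_integral_powr_le:
  assumes S: "open S" "cball 0 1 \<subseteq> S" and G: "G holomorphic_on S" and s: "0 \<le> s" "s < 1"
    and p: "1 \<le> p"
  shows "2 * pi * norm (G (of_real s)) powr p
    \<le> (LINT \<theta>:{0..2*pi}|lborel. poisson_kernel s \<theta> * norm (G (cis \<theta>)) powr p)"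
proof -
  have cG: "continuous_on {0..2*pi} (\<lambda>\<theta>. G (cis \<theta>))"
    using S(2) by (intro continuous_on_compose2[OF holomorphic_on_imp_continuous_on[OF G]] continuous_intros) auto
  note cont = cG continuous_on_poisson_kernel[OF s]
  have P: "(LINT \<theta>:{0..2*pi}|lborel. poisson_kernel s \<theta>) = 2 * pi"
    using integral_unique[OF integral_poisson_kernel[OF s]] continuous_on_poisson_kernel[OF s]
    by (subst set_borel_integral_eq_integral(2)) (auto intro!: borel_integrable_atLeastAtMost')
  let ?w = "\<lambda>\<theta>. indicator {0..2*pi} \<theta> * poisson_kernel s \<theta>"
  have ii: "set_integrable lborel {0..2*pi} (\<lambda>\<theta>. poisson_kernel s \<theta>)"
    "set_integrable lborel {0..2*pi} (\<lambda>\<theta>. poisson_kernel s \<theta> * norm (G (cis \<theta>)))"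
    "set_integrable lborel {0..2*pi} (\<lambda>\<theta>. poisson_kernel s \<theta> * norm (G (cis \<theta>)) powr p)"
proof -
    have "continuous_on {0..2*pi} (\<lambda>\<theta>. norm (G (cis \<theta>)) powr p)"
      using p by (intro continuous_on_powr' continuous_intros cont) auto
    then show "set_integrable lborel {0..2*pi} (\<lambda>\<theta>. poisson_kernel s \<theta> * norm (G (cis \<theta>)) powr p)"
      by (intro borel_integrable_atLeastAtMost' continuous_on_mult cont)
  qed (intro borel_integrable_atLeastAtMost' continuous_intros cont)+
  have "(2 * pi * norm (G (of_real s))) powr p
      \<le> (LINT \<theta>:{0..2*pi}|lborel. poisson_kernel s \<theta> * norm (G (cis \<theta>))) powr p"
    using p by (intro powr_mono2 poisson_integral_norm_le[OF S G s]) auto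
  also have "\<dots> \<le> (2 * pi) powr (p - 1) * (LINT \<theta>:{0..2*pi}|lborel. poisson_kernel s \<theta> * norm (G (cis \<theta>)) powr p)"
    using jensen_powr_integral[OF p, of ?w "\<lambda>\<theta>. norm (G (cis \<theta>))" lborel] poisson_kernel_nonneg[OF s] ii P
    by (simp add: set_integrable_def set_lebesgue_integral_def mult.assoc)
  finally have *: "(2 * pi) powr (p - 1) * (2 * pi * norm (G (of_real s)) powr p)
      \<le> (2 * pi) powr (p - 1) * (LINT \<theta>:{0..2*pi}|lborel. poisson_kernel s \<theta> * norm (G (cis \<theta>)) powr p)"
    by (simp add: powr_mult powr_diff)
  show ?thesis by (rule mult_left_le_imp_le[OF *]) simp
qed

lemma circle_mean_powr_ge:
  assumes S: "open S" "cball 0 1 \<subseteq> S" and G: "G holomorphic_on S" and p: "1 \<le> p"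
  shows "2 * pi * norm (G 0) powr p \<le> (LINT \<theta>:{0..2*pi}|lborel. norm (G (cis \<theta>)) powr p)"
  using poisson_integral_powr_le[OF S G order_refl zero_less_one p] by (simp add: poisson_kernel_def)

section \<open>Rotation invariance and area means\<close>

lemma borel_measurable_Complex [measurable (raw)]:
  assumes "f \<in> borel_measurable M" "g \<in> borel_measurable M"
  shows "(\<lambda>x. Complex (f x) (g x)) \<in> borel_measurable M"
  unfolding Complex_eq using assms by measurable

lemma lborel_complex_eq: "(lborel :: complex measure) = distr (lborel \<Otimes>\<^sub>M lborel) borel (\<lambda>(x, y). Complex x y)"
proof (rule lborel_eqI)
  fix l u :: complex
  assume le: "\<And>b. b \<in> Basis \<Longrightarrow> l \<bullet> b \<le> u \<bullet> b"
  then have le': "Re l \<le> Re u" "Im l \<le> Im u" using le[of 1] le[of \<i>] by (auto simp: Basis_complex_def inner_complex_def)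
  have "(\<lambda>(x, y). Complex x y) -` box l u \<inter> space (lborel \<Otimes>\<^sub>M lborel)
      = {Re l<..<Re u} \<times> {Im l<..<Im u}"
    by (auto simp: in_box_complex_iff space_pair_measure)
  then show "emeasure (distr (lborel \<Otimes>\<^sub>M lborel) borel (\<lambda>(x, y). Complex x y)) (box l u)
      = (\<Prod>b\<in>Basis. (u - l) \<bullet> b)"
    using le' by (subst emeasure_distr) (auto simp: lborel.emeasure_pair_measure_Times Basis_complex_def
      inner_complex_def ennreal_mult[symmetric])
qed simp

lemma nn_integral_complex:
  assumes [measurable]: "H \<in> borel_measurable (borel :: complex measure)"
  shows "(\<integral>\<^sup>+z. H z \<partial>lborel) = (\<integral>\<^sup>+y. \<integral>\<^sup>+x. H (Complex x y) \<partial>lborel \<partial>lborel)"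
    and "(\<integral>\<^sup>+z. H z \<partial>lborel) = (\<integral>\<^sup>+x. \<integral>\<^sup>+y. H (Complex x y) \<partial>lborel \<partial>lborel)"
proof -
  have "(\<integral>\<^sup>+z. H z \<partial>lborel) = (\<integral>\<^sup>+(x, y). H (Complex x y) \<partial>(lborel \<Otimes>\<^sub>M lborel))"
    by (subst lborel_complex_eq, subst nn_integral_distr) (auto simp: case_prod_beta')
  also have "\<dots> = (\<integral>\<^sup>+x. \<integral>\<^sup>+y. H (Complex x y) \<partial>lborel \<partial>lborel)"
    by (subst lborel.nn_integral_fst[symmetric]) auto
  finally show 1: "(\<integral>\<^sup>+z. H z \<partial>lborel) = (\<integral>\<^sup>+x. \<integral>\<^sup>+y. H (Complex x y) \<partial>lborel \<partial>lborel)" .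
  show "(\<integral>\<^sup>+z. H z \<partial>lborel) = (\<integral>\<^sup>+y. \<integral>\<^sup>+x. H (Complex x y) \<partial>lborel \<partial>lborel)"
    unfolding 1 by (rule lborel_pair.Fubini') simp
qed

text \<open>The rotation is factored into one-dimensional substitutions: for a \<noteq> 0 first in
  x, then after Fubini in y, with Jacobians 1 / |a| and |a| that cancel. For a = 0 the coordinates
  are merely exchanged up to sign.\<close>

lemma nn_integral_rotate:
  fixes c :: complex
  assumes [measurable]: "H \<in> borel_measurable borel" and c: "norm c = 1"
  shows "(\<integral>\<^sup>+z. H (c * z) \<partial>lborel) = (\<integral>\<^sup>+z. H z \<partial>lborel)"
proof -
  define a b where "a = Re c" and "b = Im c"
  have ab: "a\<^sup>2 + b\<^sup>2 = 1" using c by (simp add: a_def b_def cmod_def)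
  have cm: "c * Complex x y = Complex (a * x - b * y) (b * x + a * y)" for x y
    by (simp add: a_def b_def complex_eq_iff)
  have affine: "(\<integral>\<^sup>+x. f (t + k * x) \<partial>lborel) = ennreal (1 / \<bar>k\<bar>) * (\<integral>\<^sup>+x. f x \<partial>lborel)"
    if "f \<in> borel_measurable borel" "k \<noteq> 0" for f and k t :: real
  proof -
    have "(\<integral>\<^sup>+x. f x \<partial>lborel) = ennreal \<bar>k\<bar> * (\<integral>\<^sup>+x. f (t + k * x) \<partial>lborel)"
      by (rule nn_integral_real_affine[OF that])
    then show ?thesis using that by (simp add: mult.assoc[symmetric] ennreal_mult[symmetric])
  qed
  show ?thesis
  proof (cases "a = 0")
    case False
    have "(\<integral>\<^sup>+z. H (c * z) \<partial>lborel)
        = (\<integral>\<^sup>+y. \<integral>\<^sup>+x. H (Complex (a * x - b * y) (b * x + a * y)) \<partial>lborel \<partial>lborel)"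
      by (subst nn_integral_complex(1)) (simp_all add: cm)
    also have "\<dots> = (\<integral>\<^sup>+y. ennreal (1 / \<bar>a\<bar>) * (\<integral>\<^sup>+x. H (Complex x (b / a * x + 1 / a * y)) \<partial>lborel) \<partial>lborel)"
    proof (rule nn_integral_cong)
      fix y :: real
      \<comment> \<open>The second coordinate is rewritten through the first one, a x - b y; this
        uses a^2 + b^2 = 1.\<close>
      have eq: "b * x + a * y = b / a * (- (b * y) + a * x) + 1 / a * y" for x
      proof -
        have "b / a * (- (b * y) + a * x) + 1 / a * y = b * x + y * (1 - b\<^sup>2) / a"
          using False by (simp add: field_simps power2_eq_square)
        also have "1 - b\<^sup>2 = a * a" using ab by (simp add: power2_eq_square)
        finally show ?thesis using False by simp
      qed
      show "(\<integral>\<^sup>+x. H (Complex (a * x - b * y) (b * x + a * y)) \<partial>lborel)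
        = ennreal (1 / \<bar>a\<bar>) * (\<integral>\<^sup>+x. H (Complex x (b / a * x + 1 / a * y)) \<partial>lborel)"
        unfolding eq using False
        by (subst affine[of "\<lambda>x. H (Complex x (b / a * x + 1 / a * y))" a "- (b * y)", symmetric]) simp_all
    qed
    also have "\<dots> = ennreal (1 / \<bar>a\<bar>) * (\<integral>\<^sup>+x. \<integral>\<^sup>+y. H (Complex x (b / a * x + 1 / a * y)) \<partial>lborel \<partial>lborel)"
      by (subst nn_integral_cmult, simp, subst lborel_pair.Fubini') simp_all
    also have "\<dots> = ennreal (1 / \<bar>a\<bar>) * (\<integral>\<^sup>+x. ennreal \<bar>a\<bar> * (\<integral>\<^sup>+y. H (Complex x y) \<partial>lborel) \<partial>lborel)"
      using False by (subst affine) simp_all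
    also have "\<dots> = (\<integral>\<^sup>+z. H z \<partial>lborel)"
      using False by (subst nn_integral_cmult)
        (simp_all add: nn_integral_complex(2)[of H] mult.assoc[symmetric] ennreal_mult[symmetric])
    finally show ?thesis .
  next
    case True
    then have b: "b \<noteq> 0" "\<bar>b\<bar> = 1" using ab by (auto simp: abs_square_eq_1)
    have "(\<integral>\<^sup>+z. H (c * z) \<partial>lborel)
        = (\<integral>\<^sup>+y. \<integral>\<^sup>+x. H (Complex (- b * y) (0 + b * x)) \<partial>lborel \<partial>lborel)"
      by (subst nn_integral_complex(1)) (simp_all add: cm True)
    also have "\<dots> = (\<integral>\<^sup>+y. \<integral>\<^sup>+x. H (Complex (0 + (- b) * y) x) \<partial>lborel \<partial>lborel)"
      using b by (subst affine) simp_all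
    also have "\<dots> = (\<integral>\<^sup>+y. \<integral>\<^sup>+x. H (Complex y x) \<partial>lborel \<partial>lborel)"
      using b by (subst affine[of "\<lambda>y. \<integral>\<^sup>+x. H (Complex y x) \<partial>lborel"]) simp_all
    finally show ?thesis by (simp add: nn_integral_complex(2)[of H])
  qed
qed

text \<open>Averaging over rotations takes the place of polar coordinates.\<close>

lemma nn_integral_rotation_average:
  assumes [measurable]: "H \<in> borel_measurable (borel :: complex measure)"
  shows "ennreal (2 * pi) * (\<integral>\<^sup>+z. H z \<partial>lborel)
    = (\<integral>\<^sup>+z. (\<integral>\<^sup>+\<theta>\<in>{0..2*pi}. H (cis \<theta> * z) \<partial>lborel) \<partial>lborel)"
proof -
  have [measurable]: "cis \<in> borel_measurable borel"
    by (intro borel_measurable_continuous_onI continuous_intros)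
  have "(\<integral>\<^sup>+z. (\<integral>\<^sup>+\<theta>\<in>{0..2*pi}. H (cis \<theta> * z) \<partial>lborel) \<partial>lborel)
      = (\<integral>\<^sup>+\<theta>. (\<integral>\<^sup>+z. H (cis \<theta> * z) * indicator {0..2*pi} \<theta> \<partial>lborel) \<partial>lborel)"
    by (rule lborel_pair.Fubini') simp
  also have "\<dots> = (\<integral>\<^sup>+\<theta>. (\<integral>\<^sup>+z. H z \<partial>lborel) * indicator {0..2*pi} \<theta> \<partial>lborel)"
    by (intro nn_integral_cong) (simp add: nn_integral_multc nn_integral_rotate)
  also have "\<dots> = ennreal (2 * pi) * (\<integral>\<^sup>+z. H z \<partial>lborel)"
    by (subst nn_integral_cmult_indicator) (simp_all add: mult.commute)
  finally show ?thesis by simp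
qed

text \<open>With z = |z| cis \<alpha>, the integral runs over [\<alpha>, \<alpha> + 2 pi); the part
  beyond 2 pi is moved back by one period. Half-open intervals make the cutting exact.\<close>

lemma nn_integral_circle_shift:
  fixes H :: "complex \<Rightarrow> ennreal"
  assumes [measurable]: "H \<in> borel_measurable borel"
  shows "(\<integral>\<^sup>+\<theta>\<in>{0..2*pi}. H (cis \<theta> * z) \<partial>lborel) = (\<integral>\<^sup>+\<theta>\<in>{0..2*pi}. H (of_real (norm z) * cis \<theta>) \<partial>lborel)"
proof -
  have [measurable]: "cis \<in> borel_measurable borel"
    by (intro borel_measurable_continuous_onI continuous_intros)
  define \<alpha> where "\<alpha> = Arg2pi z"
  have \<alpha>: "0 \<le> \<alpha>" "\<alpha> < 2 * pi" "z = of_real (norm z) * cis \<alpha>"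
    using Arg2pi[of z] by (auto simp: \<alpha>_def cis_conv_exp is_Arg_def)
  define u where "u = (\<lambda>\<theta>. H (of_real (norm z) * cis \<theta>))"
  have [measurable]: "u \<in> borel_measurable borel" unfolding u_def by measurable
  have per: "u (\<theta> + 2 * pi) = u \<theta>" for \<theta> by (simp add: u_def cis_mult[symmetric])
  have split: "(\<integral>\<^sup>+\<theta>\<in>{x..<y}. u \<theta> \<partial>lborel) = (\<integral>\<^sup>+\<theta>\<in>{x..<m}. u \<theta> \<partial>lborel) + (\<integral>\<^sup>+\<theta>\<in>{m..<y}. u \<theta> \<partial>lborel)"
    if "x \<le> m" "m \<le> y" for x m y
  proof -
    have "{x..<y} = {x..<m} \<union> {m..<y}" using that by auto
    then show ?thesis using that by (simp only:) (subst nn_integral_disjoint_pair[symmetric]; auto)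
  qed
  have shift: "(\<integral>\<^sup>+\<theta>\<in>{x..<y}. u (t + \<theta>) \<partial>lborel) = (\<integral>\<^sup>+\<theta>\<in>{t+x..<t+y}. u \<theta> \<partial>lborel)" for t x y
    by (subst nn_integral_real_affine[where c = 1 and t = t])
       (auto intro!: nn_integral_cong simp: indicator_def)
  have ae: "(\<integral>\<^sup>+\<theta>\<in>{0..2*pi}. v \<theta> \<partial>lborel) = (\<integral>\<^sup>+\<theta>\<in>{0..<2*pi}. v \<theta> \<partial>lborel)" for v
    using AE_lborel_singleton[of "2*pi"]
    by (intro nn_integral_cong_AE) (auto elim!: eventually_mono simp: indicator_def)
  have "(\<integral>\<^sup>+\<theta>\<in>{0..2*pi}. H (cis \<theta> * z) \<partial>lborel) = (\<integral>\<^sup>+\<theta>\<in>{0..<2*pi}. u (\<alpha> + \<theta>) \<partial>lborel)"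
    unfolding ae
  proof (intro nn_integral_cong)
    fix \<theta>
    have "cis \<theta> * z = of_real (norm z) * cis (\<alpha> + \<theta>)"
      by (subst \<alpha>(3)) (simp add: cis_mult[symmetric] mult_ac)
    then show "H (cis \<theta> * z) * indicator {0..<2*pi} \<theta> = u (\<alpha> + \<theta>) * indicator {0..<2*pi} \<theta>"
      by (simp add: u_def)
  qed
  also have "\<dots> = (\<integral>\<^sup>+\<theta>\<in>{\<alpha>..<2*pi}. u \<theta> \<partial>lborel) + (\<integral>\<^sup>+\<theta>\<in>{2*pi+0..<2*pi+\<alpha>}. u \<theta> \<partial>lborel)"
    using shift[of \<alpha> 0 "2*pi"] split[of \<alpha> "2*pi" "2*pi+\<alpha>"] \<alpha> by (simp add: add.commute)
  also have "\<dots> = (\<integral>\<^sup>+\<theta>\<in>{\<alpha>..<2*pi}. u \<theta> \<partial>lborel) + (\<integral>\<^sup>+\<theta>\<in>{0..<\<alpha>}. u \<theta> \<partial>lborel)"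
    unfolding shift[of "2*pi" 0 \<alpha>, symmetric] by (simp add: per add.commute[of "2*pi"])
  also have "\<dots> = (\<integral>\<^sup>+\<theta>\<in>{0..<2*pi}. u \<theta> \<partial>lborel)"
    using split[of 0 \<alpha> "2*pi"] \<alpha> by (simp add: add.commute)
  finally show ?thesis unfolding ae u_def .
qed

text \<open>Upper bounds by circle integrals: V collects a bound on each circle, and the remaining
  integral of a radial function can be estimated on annuli.\<close>

lemma nn_integral_disc_le_radial:
  fixes H :: "complex \<Rightarrow> ennreal"
  assumes [measurable]: "H \<in> borel_measurable borel"
    and V: "\<And>r. 0 \<le> r \<Longrightarrow> (\<integral>\<^sup>+\<theta>\<in>{0..2*pi}. H (of_real r * cis \<theta>) \<partial>lborel) \<le> V r"
  shows "ennreal (2 * pi) * (\<integral>\<^sup>+z. H z \<partial>lborel) \<le> (\<integral>\<^sup>+z. V (norm (z :: complex)) \<partial>lborel)"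
  unfolding nn_integral_rotation_average[OF assms(1)] nn_integral_circle_shift[OF assms(1)]
  by (intro nn_integral_mono V norm_ge_zero)

lemma emeasure_complex_ball: "0 \<le> r \<Longrightarrow> emeasure lborel (ball (c :: complex) r) = ennreal (pi * r\<^sup>2)"
  by (simp add: emeasure_ball unit_ball_vol_2)

text \<open>The mean value inequality over a disc arises by averaging the inequality over circles:
  for each z in the disc, the mean of |h|^p on the circle about w through w + z is at least |h
  w|^p.\<close>

lemma disc_mean_powr_le:
  fixes h :: "complex \<Rightarrow> complex"
  assumes S: "open S" "cball w \<rho> \<subseteq> S" and h: "h holomorphic_on S" and p: "1 \<le> p" and \<rho>: "0 \<le> \<rho>"
  shows "ennreal (pi * \<rho>\<^sup>2 * norm (h w) powr p) \<le> (\<integral>\<^sup>+z\<in>ball w \<rho>. ennreal (norm (h z) powr p) \<partial>lborel)"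
proof -
  define H where "H = (\<lambda>z. ennreal (norm (h (w + z)) powr p) * indicator (ball 0 \<rho>) z)"
  have hc: "continuous_on (ball 0 \<rho>) (\<lambda>z. h (w + z))"
    using S(2) by (intro continuous_on_compose2[OF holomorphic_on_imp_continuous_on[OF h]] continuous_intros)
      (auto simp: dist_norm subset_iff)
  \<comment> \<open>Nothing is known about h outside S. The cut-off function is Borel measurable on
    the whole plane and agrees with the integrand on the disc.\<close>
  define hh where "hh = (\<lambda>z. indicator (ball 0 \<rho>) z *\<^sub>R h (w + z))"
  have [measurable]: "hh \<in> borel_measurable borel" "ball (0 :: complex) \<rho> \<in> sets borel"
    unfolding hh_def by (rule borel_measurable_continuous_on_indicator[OF _ hc]) simp_all
  have "(\<lambda>z. ennreal (norm (hh z) powr p) * indicator (ball 0 \<rho>) z) \<in> borel_measurable borel"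
    by measurable
  also have "(\<lambda>z. ennreal (norm (hh z) powr p) * indicator (ball 0 \<rho>) z) = H"
    by (auto simp: hh_def H_def indicator_def fun_eq_iff)
  finally have [measurable]: "H \<in> borel_measurable borel" .
  have "ennreal (2 * pi) * (ennreal (norm (h w) powr p) * emeasure lborel (ball (0::complex) \<rho>))
      = (\<integral>\<^sup>+z\<in>ball (0::complex) \<rho>. ennreal (2 * pi * norm (h w) powr p) \<partial>lborel)"
    by (subst nn_integral_cmult_indicator) (simp_all add: ennreal_mult mult.assoc)
  also have "\<dots> \<le> (\<integral>\<^sup>+z. (\<integral>\<^sup>+\<theta>\<in>{0..2*pi}. H (cis \<theta> * z) \<partial>lborel) \<partial>lborel)"
  proof (rule nn_integral_mono)
    fix z :: complex
    show "ennreal (2 * pi * norm (h w) powr p) * indicator (ball 0 \<rho>) z \<le> (\<integral>\<^sup>+\<theta>\<in>{0..2*pi}. H (cis \<theta> * z) \<partial>lborel)"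
    proof (cases "z \<in> ball 0 \<rho>")
      case True
      \<comment> \<open>For fixed z the circle is rescaled to the unit circle, with ?G 0 = h
        w.\<close>
      let ?G = "\<lambda>u. h (w + u * z)"
      let ?S = "(\<lambda>u. w + u * z) -` S"
      have oS: "open ?S" using S(1) by (intro continuous_open_vimage continuous_intros) auto
      have sub: "cball 0 1 \<subseteq> ?S"
      proof
        fix u :: complex assume "u \<in> cball 0 1"
        then have "norm (u * z) \<le> 1 * \<rho>" unfolding norm_mult using True by (intro mult_mono) auto
        then show "u \<in> ?S" using S(2) by (auto simp: dist_norm subset_iff)
      qed
      have hol: "?G holomorphic_on ?S"
        by (rule holomorphic_on_compose_gen[OF _ h, unfolded o_def]) (auto intro!: holomorphic_intros)
      have "ennreal (2 * pi * norm (h w) powr p) \<le> ennreal (LINT \<theta>:{0..2*pi}|lborel. norm (?G (cis \<theta>)) powr p)"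
        using circle_mean_powr_ge[OF oS sub hol p] by (intro ennreal_leI) simp
      also have "\<dots> = (\<integral>\<^sup>+\<theta>. ennreal (indicator {0..2*pi} \<theta> * norm (?G (cis \<theta>)) powr p) \<partial>lborel)"
      proof -
        have "continuous_on {0..2*pi} (\<lambda>\<theta>. ?G (cis \<theta>))"
          using sub by (intro continuous_on_compose2[OF holomorphic_on_imp_continuous_on[OF hol]] continuous_intros) auto
        then have "continuous_on {0..2*pi} (\<lambda>\<theta>. norm (?G (cis \<theta>)) powr p)"
          using p by (intro continuous_on_powr' continuous_intros) auto
        then have "set_integrable lborel {0..2*pi} (\<lambda>\<theta>. norm (?G (cis \<theta>)) powr p)"
          by (intro borel_integrable_atLeastAtMost')
        then show ?thesis unfolding set_integrable_def set_lebesgue_integral_def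
          by (subst nn_integral_eq_integral) auto
      qed
      also have "\<dots> = (\<integral>\<^sup>+\<theta>\<in>{0..2*pi}. H (cis \<theta> * z) \<partial>lborel)"
        using True by (intro nn_integral_cong) (auto simp: H_def indicator_def norm_mult)
      finally show ?thesis using True by simp
    qed auto
  qed
  also have "\<dots> = ennreal (2 * pi) * (\<integral>\<^sup>+z. H z \<partial>lborel)"
    by (rule nn_integral_rotation_average[symmetric]) simp
  finally have "ennreal (norm (h w) powr p) * emeasure lborel (ball (0::complex) \<rho>) \<le> (\<integral>\<^sup>+z. H z \<partial>lborel)"
    by (subst (asm) ennreal_mult_le_mult_iff) auto
  also have "(\<integral>\<^sup>+z. H z \<partial>lborel) = (\<integral>\<^sup>+z\<in>ball w \<rho>. ennreal (norm (h z) powr p) \<partial>lborel)"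
  proof -
    define K where "K = (\<lambda>z. H (z - w))"
    have [measurable]: "K \<in> borel_measurable borel" unfolding K_def by measurable
    have "(\<integral>\<^sup>+z. K z \<partial>lborel) = (\<integral>\<^sup>+z. K z \<partial>distr lborel borel ((+) w))"
      by (simp add: lborel_distr_plus)
    also have "\<dots> = (\<integral>\<^sup>+z. H z \<partial>lborel)"
      by (subst nn_integral_distr) (auto simp: K_def)
    also have "(\<integral>\<^sup>+z. K z \<partial>lborel) = (\<integral>\<^sup>+z\<in>ball w \<rho>. ennreal (norm (h z) powr p) \<partial>lborel)"
      by (intro nn_integral_cong) (auto simp: K_def H_def indicator_def dist_norm norm_minus_commute)
    finally show ?thesis by simp
  qed
  finally show ?thesis
    using \<rho> by (simp add: emeasure_complex_ball ennreal_mult[symmetric] mult_ac)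
qed

section \<open>Radial weights and kernels\<close>

lemma set_integrable_continuous_mult:
  fixes u \<phi> :: "real \<Rightarrow> 'a :: {euclidean_space, real_normed_algebra}"
  assumes \<phi>: "set_integrable lebesgue S \<phi>" and u: "continuous_on S u"
    and B: "\<And>t. t \<in> S \<Longrightarrow> norm (u t) \<le> B" and S: "S \<in> sets lebesgue"
  shows "set_integrable lebesgue S (\<lambda>t. u t * \<phi> t)"
  using B by (intro absolutely_integrable_bounded_measurable_product[OF bilinear_times _ S _ \<phi>]
    continuous_imp_measurable_on_sets_lebesgue[OF u S]) (auto simp: bounded_iff)

lemma power_series_on_disc:
  fixes F :: "complex \<Rightarrow> complex"
  assumes sums: "\<And>z. norm z < 1 \<Longrightarrow> (\<lambda>n. a n * z ^ n) sums F z"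
  shows "F holomorphic_on ball 0 1" "taylor_coeff F n = a n"
    and "norm z < 1 \<Longrightarrow> (\<lambda>n. of_nat (Suc n) * a (Suc n) * z ^ n) sums deriv F z"
proof -
  show hol: "F holomorphic_on ball 0 1"
    by (rule power_series_holomorphic[where a = a and z = 0]) (use sums in auto)
  show "(\<lambda>n. of_nat (Suc n) * a (Suc n) * z ^ n) sums deriv F z" if "norm z < 1"
  proof -
    have "(F has_field_derivative deriv F z) (at z)"
      using hol that by (intro holomorphic_derivI[where S = "ball 0 1"]) auto
    then have "(\<lambda>n. diffs a n * z ^ n) sums deriv F z"
      by (rule termdiffs_sums_strong[where K = 1 and f = F, rotated]) (use sums that in auto)
    then show ?thesis by (simp add: diffs_def)
  qed
  have "F has_fps_expansion Abs_fps a"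
    unfolding has_fps_expansion_def
  proof
    have "1 \<le> fps_conv_radius (Abs_fps a)"
      unfolding fps_conv_radius_def
    proof (rule conv_radius_geI_ex')
      fix r :: real assume "0 < r" "ereal r < 1"
      then show "summable (\<lambda>n. fps_nth (Abs_fps a) n * of_real r ^ n)"
        using sums_summable[OF sums[of "of_real r"]] by simp
    qed
    then show "0 < fps_conv_radius (Abs_fps a)" by (rule less_le_trans[rotated]) simp
    have "\<forall>\<^sub>F z in nhds (0::complex). z \<in> ball 0 1" by (intro eventually_nhds_in_open) auto
    then show "\<forall>\<^sub>F z in nhds 0. eval_fps (Abs_fps a) z = F z"
    proof eventually_elim
      case (elim z)
      then show ?case using sums[of z] by (simp add: eval_fps_def sums_iff)
    qed
  qed
  from fps_nth_fps_expansion[OF this, of n] show "taylor_coeff F n = a n"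
    by (simp add: taylor_coeff_def)
qed

section \<open>Dyadic decomposition of the radius\<close>

definition dyadic_interval :: "nat \<Rightarrow> real set" where
  "dyadic_interval k = {1 - (1/2) ^ k..<1 - (1/2) ^ Suc k}"

lemma dyadic_interval_subset: "dyadic_interval k \<subseteq> {0..<1}"
proof
  fix t :: real assume "t \<in> dyadic_interval k"
  moreover have "(1/2::real) ^ k \<le> 1" "(0::real) < (1/2) ^ Suc k" by (simp_all add: power_le_one)
  ultimately show "t \<in> {0..<1}" unfolding dyadic_interval_def by (simp only: atLeastLessThan_iff) linarith
qed

lemma UN_dyadic_interval: "(\<Union>k. dyadic_interval k) = {0..<1}"
proof
  show "{0..<1} \<subseteq> (\<Union>k. dyadic_interval k)"
  proof
    fix t :: real assume "t \<in> {0..<1}"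
    then obtain k where "1 / 2 ^ Suc k < 1 - t" "1 - t \<le> 1 / 2 ^ k"
      using dyadic_index_exists[of "1 - t" 1] by auto
    then have "t \<in> dyadic_interval k" by (simp add: dyadic_interval_def power_one_over)
    then show "t \<in> (\<Union>k. dyadic_interval k)" by blast
  qed
qed (use dyadic_interval_subset in blast)

lemma disjoint_family_dyadic_interval: "disjoint_family dyadic_interval"
  unfolding disjoint_family_on_def
proof (intro ballI impI)
  fix i j :: nat assume "i \<noteq> j"
  show "dyadic_interval i \<inter> dyadic_interval j = {}"
  proof (rule Int_emptyI)
    fix t assume "t \<in> dyadic_interval i" "t \<in> dyadic_interval j"
    then have "i = j"
      by (intro dyadic_interval_unique[of 1 i "1 - t" j]) (auto simp: dyadic_interval_def power_one_over)
    with \<open>i \<noteq> j\<close> show False by simp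
  qed
qed

lemma sets_dyadic_interval [measurable]: "dyadic_interval k \<in> sets borel"
  by (simp add: dyadic_interval_def)

section \<open>Moments of a radial weight and coefficients of the kernel\<close>

locale radial =
  fixes \<omega> :: "real \<Rightarrow> real"
  assumes radial: "radial_weight \<omega>"
begin

lemma w_int: "set_integrable lebesgue {0..<1} \<omega>" and w_nonneg: "t \<in> {0..<1} \<Longrightarrow> 0 \<le> \<omega> t"
  and w_tail: "t \<in> {0..<1} \<Longrightarrow> 0 < weight_tail \<omega> t"
  using radial by (auto simp: radial_weight_def)

definition mom :: "nat \<Rightarrow> real" where "mom n = moment \<omega> (real n)"

lemma mom_integrable: "set_integrable lebesgue {0..<1} (\<lambda>t. t ^ n * \<omega> t)"
  by (rule set_integrable_continuous_mult[OF w_int, where B = 1])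
     (auto intro!: continuous_intros simp: power_le_one)

lemma mom_eq: "1 \<le> n \<Longrightarrow> mom n = (LINT t:{0..<1}|lebesgue. t ^ n * \<omega> t)"
proof -
  assume n: "1 \<le> n"
  \<comment> \<open>At t = 0 both powers vanish because n \<ge> 1; for n = 0 they would be 0 and
    1.\<close>
  have "t powr real n = t ^ n" if "t \<in> {0..<1}" for t :: real
    using that n by (cases "t = 0") (auto simp: powr_realpow)
  then show ?thesis unfolding mom_def moment_def
    by (intro set_lebesgue_integral_cong) auto
qed

text \<open>As all tails are positive, the moments decay no faster than r^n for any r < 1. Both the
  positivity of the moments and the convergence of the kernel series on the whole disc come from
  this.\<close>

lemma mom_ge_tail:
  assumes "0 \<le> r" "r < 1" "1 \<le> n"
  shows "r ^ n * weight_tail \<omega> r \<le> mom n"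
proof -
  have "set_integrable lebesgue {r..<1} \<omega>"
    by (rule set_integrable_subset[OF w_int]) (use assms in auto)
  then have "r ^ n * weight_tail \<omega> r = (LINT t:{r..<1}|lebesgue. r ^ n * \<omega> t)"
    by (simp add: weight_tail_def)
  also have "\<dots> \<le> (LINT t:{0..<1}|lebesgue. t ^ n * \<omega> t)"
    unfolding set_lebesgue_integral_def
  proof (rule integral_mono)
    show "integrable lebesgue (\<lambda>x. indicat_real {r..<1} x *\<^sub>R (r ^ n * \<omega> x))"
      using \<open>set_integrable lebesgue {r..<1} \<omega>\<close> unfolding set_integrable_def[symmetric] by simp
    show "integrable lebesgue (\<lambda>x. indicat_real {0..<1} x *\<^sub>R (x ^ n * \<omega> x))"
      using mom_integrable unfolding set_integrable_def .
    fix t :: real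
    show "indicat_real {r..<1} t *\<^sub>R (r ^ n * \<omega> t) \<le> indicat_real {0..<1} t *\<^sub>R (t ^ n * \<omega> t)"
      using assms w_nonneg[of t] by (auto simp: indicator_def intro!: mult_right_mono power_mono mult_nonneg_nonneg)
  qed
  finally show ?thesis using assms by (simp add: mom_eq)
qed

lemma mom_pos: "1 \<le> n \<Longrightarrow> 0 < mom n"
  using mom_ge_tail[of "1/2" n] w_tail[of "1/2"]
  by (smt (verit) atLeastLessThan_iff divide_pos_pos field_sum_of_halves mult_pos_pos zero_less_power)

lemma mom_antimono: "1 \<le> n \<Longrightarrow> n \<le> k \<Longrightarrow> mom k \<le> mom n"
proof -
  assume *: "1 \<le> n" "n \<le> k"
  then show ?thesis
    unfolding mom_eq[OF *(1)] mom_eq[OF order_trans[OF *]]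
    by (intro set_integral_mono mom_integrable mult_right_mono power_decreasing w_nonneg) auto
qed

lemma summable_inverse_mom:
  assumes "0 \<le> \<rho>" "\<rho> < 1"
  shows "summable (\<lambda>n. \<rho> ^ n / mom (2 * n + 1))"
proof -
  \<comment> \<open>The square of r is the midpoint of \<rho> and 1. Since the index is 2 n + 1, the
    comparison series is geometric with ratio \<rho> / r^2 < 1.\<close>
  define r where "r = sqrt ((1 + \<rho>) / 2)"
  have r2: "r\<^sup>2 = (1 + \<rho>) / 2" using assms by (simp add: r_def)
  have r: "0 < r" "r < 1" using assms by (auto simp: r_def)
  define c where "c = 1 / (r * weight_tail \<omega> r)"
  have tail: "0 < weight_tail \<omega> r" using r w_tail by auto
  show ?thesis
  proof (rule summable_comparison_test')
    have "\<rho> / r\<^sup>2 < 1" unfolding r2 using assms by simp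
    then show "summable (\<lambda>n. c * (\<rho> / r\<^sup>2) ^ n)"
      using assms by (intro summable_mult summable_geometric) simp
    fix n
    have "\<rho> ^ n / mom (2 * n + 1) \<le> \<rho> ^ n / (r ^ (2 * n + 1) * weight_tail \<omega> r)"
      using assms r tail mom_pos mom_ge_tail[of r "2 * n + 1"]
      by (intro divide_left_mono) auto
    also have "\<dots> = c * (\<rho> / r\<^sup>2) ^ n"
      by (simp add: c_def power_divide power_mult[symmetric])
    finally show "norm (\<rho> ^ n / mom (2 * n + 1)) \<le> c * (\<rho> / r\<^sup>2) ^ n"
      using assms mom_pos[of "2 * n + 1"] by (simp add: abs_mult)
  qed
qed

text \<open>Coefficients of the power series in \<open>t z\<close> of the kernel and of its derivative; the latter increase.\<close>

definition kc :: "nat \<Rightarrow> real" where "kc n = 1 / (2 * (real n + 1) * mom (2 * n + 1))"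

definition kb :: "nat \<Rightarrow> real" where "kb n = (real n + 1) * kc (Suc n)"

lemma kc_pos: "0 < kc n"
  using mom_pos[of "2 * n + 1"] by (simp add: kc_def)

lemma kb_pos: "0 < kb n"
  using kc_pos[of "Suc n"] by (simp add: kb_def)

lemma kb_eq: "kb n = (real n + 1) / (real n + 2) / (2 * mom (2 * n + 3))"
  by (simp add: kb_def kc_def numeral_3_eq_3 add_ac)

lemma kb_le_inverse_mom: "kb n \<le> 1 / mom (2 * n + 3)"
proof -
  have m: "0 < mom (2 * n + 3)" by (rule mom_pos) simp
  have "(real n + 1) / (real n + 2) / (2 * mom (2 * n + 3)) \<le> 1 / (2 * mom (2 * n + 3))"
    using m by (intro divide_right_mono) auto
  also have "\<dots> \<le> 1 / mom (2 * n + 3)" using m by (intro divide_left_mono) auto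
  finally show ?thesis unfolding kb_eq .
qed

lemma summable_kc: "0 \<le> \<rho> \<Longrightarrow> \<rho> < 1 \<Longrightarrow> summable (\<lambda>n. kc n * \<rho> ^ n)"
proof (rule summable_comparison_test'[OF summable_inverse_mom[of \<rho>]])
  fix n assume \<rho>: "0 \<le> \<rho>" "\<rho> < 1"
  have "kc n \<le> 1 / mom (2 * n + 1)"
    using mom_pos[of "2 * n + 1"] mult_right_mono[of 1 "2 * (real n + 1)" "mom (2 * n + 1)"]
    unfolding kc_def by (intro divide_left_mono mult_pos_pos) auto
  then show "norm (kc n * \<rho> ^ n) \<le> \<rho> ^ n / mom (2 * n + 1)"
    using \<rho> kc_pos[of n] mult_right_mono[of "kc n" "1 / mom (2 * n + 1)" "\<rho> ^ n"] by (simp add: abs_mult)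
qed

lemma summable_kb: "0 \<le> \<rho> \<Longrightarrow> \<rho> < 1 \<Longrightarrow> summable (\<lambda>n. kb n * \<rho> ^ n)"
proof -
  assume \<rho>: "0 \<le> \<rho>" "\<rho> < 1"
  have "summable (\<lambda>n. diffs kc n * \<rho> ^ n)"
  proof (rule termdiff_converges[where K = 1])
    fix x :: real assume "norm x < 1"
    then have "summable (\<lambda>n. norm (kc n * x ^ n))"
      using summable_kc[of "\<bar>x\<bar>"] kc_pos by (simp add: abs_mult power_abs less_imp_le)
    then show "summable (\<lambda>n. kc n * x ^ n)" by (rule summable_norm_cancel)
  qed (use \<rho> in auto)
  then show ?thesis by (simp add: diffs_def kb_def add.commute)
qed

text \<open>Both factors in \<open>kb_eq\<close> increase: (n + 1) / (n + 2), and the reciprocal of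
  a decreasing moment. This monotonicity is what the summation by parts in
  \<open>norm_power_series_increasing\<close> rests on.\<close>

lemma kb_mono: "kb n \<le> kb (Suc n)"
proof -
  have "(real n + 1) / (real n + 2) \<le> (real (Suc n) + 1) / (real (Suc n) + 2)"
    by (simp add: field_simps)
  moreover have "1 / (2 * mom (2 * n + 3)) \<le> 1 / (2 * mom (2 * Suc n + 3))"
    using mom_antimono[of "2 * n + 3" "2 * Suc n + 3"] mom_pos[of "2 * n + 3"] mom_pos[of "2 * Suc n + 3"]
    by (intro divide_left_mono) auto
  ultimately have "(real n + 1) / (real n + 2) * (1 / (2 * mom (2 * n + 3)))
      \<le> (real (Suc n) + 1) / (real (Suc n) + 2) * (1 / (2 * mom (2 * Suc n + 3)))"
    using mom_pos[of "2 * n + 3"] by (intro mult_mono) auto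
  then show ?thesis unfolding kb_eq by simp
qed

text \<open>Termwise integration through the primitive P of the Bergman kernel: the additional
  factor 1 / (n + 1) produces \<open>kc n\<close>, and division by z undoes the index shift. At z =
  0 the filled-in value is the constant term \<open>kc 0\<close>.\<close>

lemma hilbert_kernel_series:
  assumes t: "0 \<le> t" "t < 1" and z: "norm z < 1"
  shows "hilbert_kernel \<omega> t z = (\<Sum>n. of_real (kc n) * (of_real t * z) ^ n)"
proof -
  have berg: "bergman_kernel \<omega> (of_real t) \<zeta> = (\<Sum>n. of_real (t ^ n / (2 * mom (2 * n + 1))) * \<zeta> ^ n)" for \<zeta>
  proof -
    have r: "real (2 * n + 1) = 2 * real n + 1" for n by simp
    show ?thesis unfolding bergman_kernel_def mom_def r by (simp add: power_mult_distrib)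
  qed
  show ?thesis
  proof (cases "z = 0")
    case True
    have "(\<Sum>n. complex_of_real (t ^ n / (2 * mom (2 * n + 1))) * 0 ^ n) = of_real (kc 0)"
      by (subst powser_zero) (simp add: kc_def)
    moreover have "(\<Sum>n. complex_of_real (kc n) * (of_real t * z) ^ n) = of_real (kc 0)"
      unfolding True mult_zero_right by (rule powser_zero)
    ultimately show ?thesis unfolding hilbert_kernel_def berg using True by simp
  next
    case False
    define e where "e = (\<lambda>n. case n of 0 \<Rightarrow> 0 | Suc k \<Rightarrow> complex_of_real (kc k * t ^ k))"
    have es: "summable (\<lambda>n. e n * x ^ n)" if "norm x < 1" for x
    proof -
      have "summable (\<lambda>n. norm (complex_of_real (kc n * t ^ n) * x ^ n))"
      proof (rule summable_comparison_test'[OF summable_kc[of "norm x"]])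
        fix n
        have "t ^ n * norm x ^ n \<le> 1 * norm x ^ n"
          using t by (intro mult_right_mono power_le_one) auto
        then show "norm (norm (complex_of_real (kc n * t ^ n) * x ^ n)) \<le> kc n * norm x ^ n"
          using kc_pos[of n] t by (simp add: norm_mult norm_power abs_mult mult.assoc)
      qed (use that in auto)
      then have "summable (\<lambda>n. x * (complex_of_real (kc n * t ^ n) * x ^ n))"
        by (rule summable_mult[OF summable_norm_cancel])
      then have "summable (\<lambda>n. e (Suc n) * x ^ Suc n)"
        by (simp add: e_def mult.left_commute)
      then show ?thesis by (rule iffD1[OF summable_Suc_iff[of "\<lambda>n. e n * x ^ n"]])
    qed
    define P where "P = (\<lambda>\<zeta>. \<Sum>n. e n * \<zeta> ^ n)"
    have dP: "(P has_field_derivative bergman_kernel \<omega> (of_real t) \<zeta>) (at \<zeta>)" if "norm \<zeta> < 1" for \<zeta>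
    proof -
      have "diffs e = (\<lambda>n. complex_of_real (t ^ n / (2 * mom (2 * n + 1))))"
      proof
        fix n
        have "real (Suc n) * (kc n * t ^ n) = t ^ n / (2 * mom (2 * n + 1))"
        proof -
          have "a * (1 / (2 * a * m) * x) = x / (2 * m)" if "a \<noteq> 0" for a m x :: real
            using that by simp
          from this[of "real n + 1"] show ?thesis by (simp add: kc_def add.commute)
        qed
        moreover have "diffs e n = complex_of_real (real (Suc n) * (kc n * t ^ n))"
          by (simp add: diffs_def e_def)
        ultimately show "diffs e n = complex_of_real (t ^ n / (2 * mom (2 * n + 1)))" by simp
      qed
      then show ?thesis
        using termdiffs_strong'[OF es that] by (simp add: berg P_def)
    qed
    have seg: "closed_segment 0 z \<subseteq> ball 0 1"
      using z by (intro closed_segment_subset) auto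
    have "(bergman_kernel \<omega> (of_real t) has_contour_integral (P z - P 0)) (linepath 0 z)"
      using contour_integral_primitive[of "ball 0 1" P "bergman_kernel \<omega> (of_real t)" "linepath 0 z",
          OF has_field_derivative_at_within[OF dP]] seg
      by simp
    then have "contour_integral (linepath 0 z) (bergman_kernel \<omega> (of_real t)) = P z - P 0"
      by (rule contour_integral_unique)
    moreover have "P 0 = 0" by (simp add: P_def e_def)
    moreover have "P z = z * (\<Sum>n. of_real (kc n) * (of_real t * z) ^ n)"
    proof -
      have "P z = (\<Sum>n. e (Suc n) * z ^ Suc n)"
        unfolding P_def using suminf_split_head[OF es[OF z]] by (simp add: e_def)
      also have "\<dots> = (\<Sum>n. e (Suc n) * z ^ n * z)" by (simp add: mult_ac)
      also have "\<dots> = (\<Sum>n. e (Suc n) * z ^ n) * z"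
      proof (rule suminf_mult2[symmetric])
        have "summable (\<lambda>n. e (Suc n) * z ^ Suc n)" using es[OF z] by (rule iffD2[OF summable_Suc_iff[of "\<lambda>n. e n * z ^ n"]])
        then have "summable (\<lambda>n. (e (Suc n) * z ^ Suc n) / z)" by (rule summable_divide)
        then show "summable (\<lambda>n. e (Suc n) * z ^ n)" using False by simp
      qed
      also have "(\<Sum>n. e (Suc n) * z ^ n) = (\<Sum>n. of_real (kc n) * (of_real t * z) ^ n)"
        by (simp add: e_def power_mult_distrib mult.assoc)
      finally show ?thesis by (simp add: mult.commute)
    qed
    ultimately show ?thesis using False by (simp add: hilbert_kernel_def)
  qed
qed

end

text \<open>For t in [0,1) the term of index n is dominated by |\<phi> t| |a n| |z|^n, which is
  summable in n and integrable in t. The lemma serves twice, with \<open>kc\<close> for the image of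
  the operator and with \<open>kb\<close> for its derivative.\<close>

lemma integral_power_series_swap:
  fixes \<phi> :: "real \<Rightarrow> complex" and a :: "nat \<Rightarrow> complex"
  assumes \<phi>: "set_integrable lebesgue {0..<1} \<phi>" and a: "summable (\<lambda>n. norm (a n) * norm z ^ n)"
  shows "set_integrable lebesgue {0..<1} (\<lambda>t. \<phi> t * (\<Sum>n. a n * (of_real t * z) ^ n))"
    and "(\<lambda>n. a n * (LINT t:{0..<1}|lebesgue. \<phi> t * of_real t ^ n) * z ^ n)
      sums (LINT t:{0..<1}|lebesgue. \<phi> t * (\<Sum>n. a n * (of_real t * z) ^ n))"
proof -
  let ?f = "\<lambda>n t. indicator {0..<1} t *\<^sub>R (\<phi> t * of_real t ^ n) * (a n * z ^ n)"
  have pi: "set_integrable lebesgue {0..<1} (\<lambda>t. \<phi> t * of_real t ^ n)" for n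
  proof -
    have "set_integrable lebesgue {0..<1} (\<lambda>t. of_real t ^ n * \<phi> t)"
      by (rule set_integrable_continuous_mult[OF \<phi>, where B = 1])
         (auto intro!: continuous_intros simp: norm_power power_le_one)
    then show ?thesis by (simp add: mult.commute)
  qed
  have int: "integrable lebesgue (?f n)" for n
    using pi[of n] unfolding set_integrable_def by (rule integrable_mult_left)
  have bnd: "norm (?f n t) \<le> norm (indicator {0..<1} t *\<^sub>R \<phi> t) * (norm (a n) * norm z ^ n)" for n t
  proof (cases "t \<in> {0..<1}")
    case True
    then have "norm (\<phi> t) * t ^ n \<le> norm (\<phi> t)" by (intro mult_left_le power_le_one) auto
    then show ?thesis
      using True by (auto simp: norm_mult norm_power intro!: mult_right_mono)
  qed auto
  have sm: "summable (\<lambda>n. norm (?f n t))" for t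
    by (rule summable_comparison_test'[OF summable_mult[OF a, of "norm (indicator {0..<1} t *\<^sub>R \<phi> t)"]])
       (use bnd in auto)
  have smi: "summable (\<lambda>n. \<integral>t. norm (?f n t) \<partial>lebesgue)"
  proof (rule summable_comparison_test'[OF summable_mult[OF a, of "\<integral>t. norm (indicator {0..<1} t *\<^sub>R \<phi> t) \<partial>lebesgue"]])
    fix n
    have "(\<integral>t. norm (?f n t) \<partial>lebesgue)
      \<le> (\<integral>t. norm (indicator {0..<1} t *\<^sub>R \<phi> t) * (norm (a n) * norm z ^ n) \<partial>lebesgue)"
      using \<phi>[unfolded set_integrable_def]
      by (intro integral_mono integrable_norm int integrable_mult_left bnd)
    also have "\<dots> = (\<integral>t. norm (indicator {0..<1} t *\<^sub>R \<phi> t) \<partial>lebesgue) * (norm (a n) * norm z ^ n)"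
      by (rule integral_mult_left_zero)
    finally show "norm (\<integral>t. norm (?f n t) \<partial>lebesgue)
        \<le> (\<integral>t. norm (indicator {0..<1} t *\<^sub>R \<phi> t) \<partial>lebesgue) * (norm (a n) * norm z ^ n)"
      by simp
  qed
  have eq: "(\<Sum>n. ?f n t) = indicator {0..<1} t *\<^sub>R (\<phi> t * (\<Sum>n. a n * (of_real t * z) ^ n))" for t
  proof (cases "t \<in> {0..<1}")
    case True
    have "norm t ^ n * norm z ^ n \<le> 1 * norm z ^ n" for n
      using True by (intro mult_right_mono power_le_one) auto
    then have "summable (\<lambda>n. a n * (of_real t * z) ^ n)"
      by (intro summable_comparison_test'[OF a, where N = 0])
         (simp add: norm_mult norm_power power_mult_distrib mult_left_mono)
    then have "\<phi> t * (\<Sum>n. a n * (of_real t * z) ^ n) = (\<Sum>n. \<phi> t * (a n * (of_real t * z) ^ n))"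
      by (rule suminf_mult[symmetric])
    then show ?thesis using True by (simp add: power_mult_distrib mult_ac)
  qed auto
  show "set_integrable lebesgue {0..<1} (\<lambda>t. \<phi> t * (\<Sum>n. a n * (of_real t * z) ^ n))"
    unfolding set_integrable_def eq[symmetric] by (rule integrable_suminf[OF int _ smi]) (use sm in auto)
  have "(\<lambda>n. \<integral>t. ?f n t \<partial>lebesgue) sums (\<integral>t. (\<Sum>n. ?f n t) \<partial>lebesgue)"
    by (rule sums_integral[OF int _ smi]) (use sm in auto)
  moreover have "(\<integral>t. ?f n t \<partial>lebesgue) = a n * (LINT t:{0..<1}|lebesgue. \<phi> t * of_real t ^ n) * z ^ n" for n
    unfolding set_lebesgue_integral_def integral_mult_left_zero by simp
  ultimately show "(\<lambda>n. a n * (LINT t:{0..<1}|lebesgue. \<phi> t * of_real t ^ n) * z ^ n)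
      sums (LINT t:{0..<1}|lebesgue. \<phi> t * (\<Sum>n. a n * (of_real t * z) ^ n))"
    unfolding eq set_lebesgue_integral_def by simp
qed

section \<open>Embedding into dyadic majorants\<close>

lemma ennroot_leD:
  assumes "ennroot p x \<le> ennreal K" "0 < p" "0 \<le> K"
  shows "x \<le> ennreal (K powr p)"
proof -
  have x: "x \<noteq> \<infinity>" using assms by (auto simp: ennroot_def top_unique)
  then have "enn2real x powr (1 / p) \<le> K"
    using assms by (simp add: ennroot_def)
  then have "(enn2real x powr (1 / p)) powr p \<le> K powr p"
    using assms by (intro powr_mono2) auto
  then have "enn2real x \<le> K powr p" using assms by (simp add: powr_powr)
  then have "ennreal (enn2real x) \<le> ennreal (K powr p)" by (rule ennreal_leI)
  then show ?thesis using x by (metis ennreal_enn2real less_top infinity_ennreal_def)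
qed

lemma ennroot_leI:
  assumes "x \<le> ennreal (K powr p)" "0 < p" "0 \<le> K"
  shows "ennroot p x \<le> ennreal K"
proof -
  have x: "x < \<infinity>" using assms(1) by (simp add: le_less_trans)
  have "enn2real x \<le> K powr p"
    using enn2real_mono[OF assms(1)] by simp
  then have "enn2real x powr (1 / p) \<le> (K powr p) powr (1 / p)"
    using assms by (intro powr_mono2) auto
  also have "\<dots> = K" using assms by (simp add: powr_powr)
  finally show ?thesis using x by (auto simp: ennroot_def ennreal_leI)
qed

text \<open>Restrictions to the radius of functions in \<open>H(\<infinity>, p)\<close>, with the norm discretised.\<close>

definition dyadic_bounded :: "real \<Rightarrow> real \<Rightarrow> (complex \<Rightarrow> complex) \<Rightarrow> bool" where
  "dyadic_bounded p L f \<longleftrightarrow> (\<exists>g :: nat \<Rightarrow> real. (\<forall>k. 0 \<le> g k) \<and>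
     (\<forall>k. \<forall>t\<in>dyadic_interval k. norm (f (of_real t)) \<le> g k) \<and>
     (\<forall>n. (\<Sum>k<n. g k powr p / 2 ^ k) \<le> L))"

lemma root2_powr: "0 < p \<Longrightarrow> ((2 powr (1 / p)) ^ k) powr p = (2::real) ^ k"
  by (simp add: powr_powr powr_realpow[symmetric] del: powr_realpow)

lemma root2_bounds: "1 \<le> p \<Longrightarrow> 1 < 2 powr (1 / p)" "1 \<le> p \<Longrightarrow> 2 powr (1 / p) \<le> (2::real)"
proof -
  assume p: "1 \<le> p"
  have "2 powr 0 < 2 powr (1 / p)" using p by (intro powr_less_mono) auto
  then show "1 < 2 powr (1 / p)" by simp
  have "2 powr (1 / p) \<le> 2 powr 1" using p by (intro powr_mono) auto
  then show "2 powr (1 / p) \<le> (2::real)" by simp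
qed

text \<open>The factor s^k with s = 2 powr (1 / p) is the normalisation: if g k = s^k y k, then the
  sum of g k powr p / 2^k is the sum of y k powr p, to which the Schur test applies. The embeddings
  of HL(p), of the Dirichlet-type space and of dilated Hardy functions all end here.\<close>

lemma dyadic_boundedI_schur:
  assumes \<eta>: "0 \<le> \<eta>" "\<eta> < 1" and p: "1 \<le> p" and x: "\<And>i. 0 \<le> x i" and C: "0 \<le> C"
    and L: "\<And>m. (\<Sum>i<m. x i powr p) \<le> L"
    and f: "\<And>k t. t \<in> dyadic_interval k \<Longrightarrow>
      norm (f (of_real t)) \<le> (2 powr (1 / p)) ^ k * (C * (\<Sum>i. \<eta> ^ (k - i + (i - k)) * x i))"
  shows "dyadic_bounded p (C powr p * ((2 / (1 - \<eta>)) powr p * L)) f"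
  unfolding dyadic_bounded_def
proof (intro exI conjI allI ballI)
  let ?S = "\<lambda>k. \<Sum>i. \<eta> ^ (k - i + (i - k)) * x i"
  let ?g = "\<lambda>k. (2 powr (1 / p)) ^ k * (C * ?S k)"
  note schur = schur_dyadic[OF \<eta> p x L]
  have S0: "0 \<le> ?S k" for k using \<eta> x by (intro suminf_nonneg schur(1)) auto
  show "0 \<le> ?g k" for k using C S0[of k] by simp
  show "norm (f (of_real t)) \<le> ?g k" if "t \<in> dyadic_interval k" for k t using f that by blast
  fix n
  have "?g k powr p / 2 ^ k = C powr p * ?S k powr p" for k
    using p C S0[of k] by (simp add: powr_mult root2_powr)
  then have "(\<Sum>k<n. ?g k powr p / 2 ^ k) = C powr p * (\<Sum>k<n. ?S k powr p)"
    by (simp add: sum_distrib_left)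
  also have "\<dots> \<le> C powr p * ((2 / (1 - \<eta>)) powr p * L)"
    by (intro mult_left_mono schur(2)) auto
  finally show "(\<Sum>k<n. ?g k powr p / 2 ^ k) \<le> C powr p * ((2 / (1 - \<eta>)) powr p * L)" .
qed

lemma powr_add_le:
  assumes "0 \<le> a" "0 \<le> b" "0 \<le> p"
  shows "(a + b) powr p \<le> 2 powr p * (a powr p + b powr p :: real)"
proof -
  have "(a + b) powr p \<le> (2 * max a b) powr p" using assms by (intro powr_mono2) auto
  also have "\<dots> = 2 powr p * max a b powr p" using assms by (simp add: powr_mult)
  also have "\<dots> \<le> 2 powr p * (a powr p + b powr p)" by (intro mult_left_mono) (auto simp: max_def)
  finally show ?thesis .
qed

section \<open>Embedding of H(\<infinity>, p)\<close>

lemma max_mean_ge: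
  assumes f: "f holomorphic_on ball 0 1" and r: "0 \<le> r" "r < 1" and z: "norm z \<le> r"
  shows "norm (f z) \<le> max_mean r f"
proof -
  have cont: "continuous_on {0..2*pi} (\<lambda>\<theta>. norm (f (of_real r * cis \<theta>)))"
    using r by (intro continuous_intros continuous_on_compose2[OF holomorphic_on_imp_continuous_on[OF f]])
      (auto simp: norm_mult)
  have bdd: "bdd_above ((\<lambda>\<theta>. norm (f (of_real r * cis \<theta>))) ` {0..2*pi})"
    by (intro bounded_imp_bdd_above compact_imp_bounded compact_continuous_image[OF cont]) simp
  have sphere: "norm (f w) \<le> max_mean r f" if "norm w = r" for w
  proof -
    have "w = of_real r * cis (Arg2pi w)" "0 \<le> Arg2pi w" "Arg2pi w \<le> 2 * pi"
      using Arg2pi[of w] that by (auto simp: cis_conv_exp is_Arg_def)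
    then show ?thesis unfolding max_mean_def
      by (intro cSUP_upper2[OF bdd, of "Arg2pi w"]) auto
  qed
  show ?thesis
  proof (cases "r = 0")
    case True
    then show ?thesis using sphere[of z] z by simp
  next
    case False
    show ?thesis
    proof (rule maximum_modulus_frontier[of f "cball 0 r"])
      have sub: "cball 0 r \<subseteq> ball (0::complex) 1" using r by auto
      show "f holomorphic_on interior (cball 0 r)"
        using f by (rule holomorphic_on_subset) (use sub interior_subset in blast)
      show "continuous_on (closure (cball 0 r)) f"
        using sub by (auto intro: continuous_on_subset[OF holomorphic_on_imp_continuous_on[OF f]])
    qed (use z r False sphere in auto)
  qed
qed

lemma max_mean_le: "(\<And>\<theta>. norm (f (of_real r * cis \<theta>)) \<le> B) \<Longrightarrow> max_mean r f \<le> B"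
  unfolding max_mean_def by (rule cSUP_least) auto

lemma dyadic_interval_one_minus:
  assumes "t \<in> dyadic_interval k"
  shows "1 / 2 ^ Suc k < 1 - t" "1 - t \<le> 1 / 2 ^ k"
  using assms by (auto simp: dyadic_interval_def power_one_over)

text \<open>The majorant on interval k is the maximum mean at its right endpoint. By the maximum
  principle it is at most the maximum mean throughout interval k + 1, whose length is 1 / 2^(k + 2);
  hence the factor 4.\<close>

lemma mixed_norm_dyadic_bounded:
  assumes f: "f holomorphic_on ball 0 1" and p: "1 \<le> p" and K: "0 \<le> K"
    and le: "mixed_norm_infinity p f \<le> ennreal K"
  shows "dyadic_bounded p (4 * K powr p) f"
  unfolding dyadic_bounded_def
proof (intro exI conjI allI ballI)
  let ?r = "\<lambda>k. 1 - 1 / 2 ^ Suc k :: real"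
  let ?g = "\<lambda>k. max_mean (?r k) f"
  have r: "0 \<le> ?r k" "?r k < 1" for k
  proof -
    have "1 / 2 ^ Suc k \<le> (1 :: real)" using one_le_power[of "2::real" "Suc k"] by (simp del: power_Suc)
    then show "0 \<le> ?r k" by simp
  qed simp
  show "0 \<le> ?g k" for k
  proof -
    have "norm (f 0) \<le> ?g k" using r(1)[of k] by (intro max_mean_ge[OF f r]) simp
    then show ?thesis by (rule order_trans[OF norm_ge_zero])
  qed
  show "norm (f (of_real t)) \<le> ?g k" if "t \<in> dyadic_interval k" for k t
    using dyadic_interval_one_minus[OF that] subsetD[OF dyadic_interval_subset that]
    by (intro max_mean_ge[OF f r]) auto
  fix n
  have le': "(\<integral>\<^sup>+r\<in>{0..<1}. ennreal (max_mean r f powr p) \<partial>lborel) \<le> ennreal (K powr p)"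
    using le p K unfolding mixed_norm_infinity_def by (intro ennroot_leD) auto
  have "ennreal (\<Sum>k<n. ?g k powr p / 2 ^ (k + 2)) = (\<Sum>k<n. ennreal (?g k powr p) * emeasure lborel (dyadic_interval (Suc k)))"
    by (simp add: dyadic_interval_def power_one_over field_simps sum_ennreal[symmetric] ennreal_mult[symmetric] del: sum_ennreal)
  also have "\<dots> = (\<integral>\<^sup>+r. (\<Sum>k<n. ennreal (?g k powr p) * indicator (dyadic_interval (Suc k)) r) \<partial>lborel)"
    by (subst nn_integral_sum) (simp_all add: nn_integral_cmult_indicator)
  also have "\<dots> \<le> (\<integral>\<^sup>+r\<in>{0..<1}. ennreal (max_mean r f powr p) \<partial>lborel)"
  proof (rule nn_integral_mono)
    fix r :: real
    show "(\<Sum>k<n. ennreal (?g k powr p) * indicator (dyadic_interval (Suc k)) r)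
        \<le> ennreal (max_mean r f powr p) * indicator {0..<1} r"
    proof (cases "\<exists>k<n. r \<in> dyadic_interval (Suc k)")
      case False
      then show ?thesis by (subst sum.neutral) auto
    next
      case True
      then obtain k where k: "k < n" "r \<in> dyadic_interval (Suc k)" by blast
      then have other: "r \<notin> dyadic_interval (Suc j)" if "j \<noteq> k" for j
        using disjoint_family_dyadic_interval that unfolding disjoint_family_on_def by blast
      have r01: "0 \<le> r" "r < 1" using k(2) dyadic_interval_subset[of "Suc k"] by auto
      have "(\<Sum>k<n. ennreal (?g k powr p) * indicator (dyadic_interval (Suc k)) r)
          = (\<Sum>j\<in>{k}. ennreal (?g j powr p) * indicator (dyadic_interval (Suc j)) r)"
        using k other by (intro sum.mono_neutral_right) auto
      also have "\<dots> = ennreal (?g k powr p)" using k by simp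
      also have "\<dots> \<le> ennreal (max_mean r f powr p)"
      proof (intro ennreal_leI powr_mono2 max_mean_le max_mean_ge[OF f r01])
        show "norm (of_real (?r k) * cis \<theta>) \<le> r" for \<theta>
          unfolding norm_mult norm_of_real norm_cis
          using r[of k] dyadic_interval_one_minus(2)[OF k(2)] by simp
        show "0 \<le> ?g k" by fact
      qed (use p in auto)
      finally show ?thesis using r01 by simp
    qed
  qed
  also note le'
  finally have "(\<Sum>k<n. ?g k powr p / 2 ^ (k + 2)) \<le> K powr p" by simp
  moreover have "(\<Sum>k<n. ?g k powr p / 2 ^ (k + 2)) = (\<Sum>k<n. ?g k powr p / 2 ^ k) / 4"
    unfolding sum_divide_distrib by (intro sum.cong) (auto simp: power_add)
  ultimately show "(\<Sum>k<n. ?g k powr p / 2 ^ k) \<le> 4 * K powr p" by linarith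
qed

text \<open>Bernoulli's inequality for 1 / s with s the square root of t bounds s^n by 2 / (1 + n (1
  - t)); squaring gives decay of order 2. It is used for series with dyadically grouped terms and,
  read backwards, to bound the test functions from below by a power of t.\<close>

lemma power_le_inverse_square:
  assumes "0 \<le> t" "t < 1"
  shows "t ^ n \<le> 4 / (1 + real n * (1 - t))\<^sup>2"
proof (cases "t = 0")
  case True
  then show ?thesis by (cases "n = 0") (auto simp: zero_power)
next
  case False
  define s where "s = sqrt t"
  have s: "0 < s" "s < 1" "s * s = t" using assms False by (auto simp: s_def)
  have D0: "0 < 1 + real n * (1 - t)" using assms by (simp add: add_pos_nonneg)
  have "(1 + real n * (1 - t)) / 2 \<le> 1 + real n * (1 - s)"
  proof -
    have "1 - t = (1 - s) * (1 + s)" using s by (simp add: algebra_simps)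
    also have "\<dots> \<le> (1 - s) * 2" using s by (intro mult_left_mono) auto
    finally have "real n * (1 - t) \<le> real n * (2 * (1 - s))" by (intro mult_left_mono) auto
    then have "real n * (1 - t) \<le> 2 * (real n * (1 - s))" by (simp only: mult.left_commute)
    moreover have "(1 + A) / 2 \<le> 1 + B" if "A \<le> 2 * B" for A B :: real using that by simp
    ultimately show ?thesis by blast
  qed
  also have "1 + real n * (1 - s) \<le> 1 + real n * (1 / s - 1)"
  proof -
    have "(1 - s) * s \<le> (1 - s) * 1" using s by (intro mult_left_mono) auto
    then have "1 - s \<le> 1 / s - 1" using s by (simp add: field_simps)
    then show ?thesis by (simp add: mult_left_mono)
  qed
  also have "\<dots> \<le> (1 + (1 / s - 1)) ^ n" using s by (intro Bernoulli_inequality) auto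
  finally have "(1 + real n * (1 - t)) / 2 \<le> 1 / s ^ n" by (simp add: power_one_over)
  then have "s ^ n \<le> 2 / (1 + real n * (1 - t))"
  proof -
    have "S \<le> 2 / D" if "D / 2 \<le> 1 / S" "0 < D" "0 < S" for D S :: real
      using that by (simp add: field_simps)
    then show ?thesis using D0 \<open>(1 + real n * (1 - t)) / 2 \<le> 1 / s ^ n\<close> s by simp
  qed
  then have "s ^ n * s ^ n \<le> 2 / (1 + real n * (1 - t)) * (2 / (1 + real n * (1 - t)))"
    using s D0 by (intro mult_mono) (simp_all add: less_imp_le)
  then show ?thesis using s(3) by (simp add: power_mult_distrib[symmetric] power2_eq_square)
qed

section \<open>Embedding of HL(p)\<close>

lemma sum_dyadic_blocks:
  fixes c :: "nat \<Rightarrow> real"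
  shows "(\<Sum>n<2 ^ m - 1. c n) = (\<Sum>i<m. \<Sum>n = 2 ^ i - 1..<2 ^ Suc i - 1. c n)"
proof (induction m)
  case (Suc m)
  have "(\<Sum>n<2 ^ Suc m - 1. c n) = (\<Sum>n<2 ^ m - 1. c n) + (\<Sum>n = 2 ^ m - 1..<2 ^ Suc m - 1. c n)"
    unfolding lessThan_atLeast0 by (rule sum.atLeastLessThan_concat[symmetric]) auto
  then show ?case using Suc by simp
qed simp

text \<open>The blocks start at 2^i - 1 so that n + 1, the quantity in the weight, runs from 2^i.
  Jensen on 2^i terms gives 2^(i(p-1)), removing the weight gives about 2^(i(2-p)), and the product
  is 2^i, that is, (s^i) powr p.\<close>

lemma hardy_littlewood_block_le:
  fixes a :: "nat \<Rightarrow> real"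
  assumes p: "1 \<le> p" and a: "\<And>n. 0 \<le> a n"
  shows "(\<Sum>n = 2 ^ i - 1..<2 ^ Suc i - 1. a n)
    \<le> 2 * (2 powr (1 / p)) ^ i * (\<Sum>n = 2 ^ i - 1..<2 ^ Suc i - 1. a n powr p * (real n + 1) powr (p - 2)) powr (1 / p)"
proof -
  let ?B = "{2 ^ i - 1..<2 ^ Suc i - 1 :: nat}"
  let ?X = "\<Sum>n\<in>?B. a n powr p * (real n + 1) powr (p - 2)"
  have card: "card ?B = 2 ^ i" by simp
  have X0: "0 \<le> ?X" by (intro sum_nonneg) auto
  \<comment> \<open>The sign of 2 - p decides which end of the block dominates; the constant 2
    covers the case p \<le> 2, where 2 - p \<le> 1.\<close>
  have w: "(real n + 1) powr (2 - p) \<le> 2 * (2 ^ i) powr (2 - p)" if "n \<in> ?B" for n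
  proof -
    have "2 ^ i \<le> n + 1" "n + 1 \<le> 2 * 2 ^ i" using that by auto
    then have n: "2 ^ i \<le> real n + 1" "real n + 1 \<le> 2 * 2 ^ i"
      by (simp_all flip: of_nat_le_iff[where 'a = real])
    show ?thesis
    proof (cases "p \<le> 2")
      case True
      have "(real n + 1) powr (2 - p) \<le> (2 * 2 ^ i) powr (2 - p)" using n True by (intro powr_mono2) auto
      also have "\<dots> = 2 powr (2 - p) * (2 ^ i) powr (2 - p)" by (simp add: powr_mult)
      also have "2 powr (2 - p) \<le> (2 powr 1 :: real)" using p by (intro powr_mono) auto
      finally show ?thesis by (simp add: mult_right_mono)
    next
      case False
      have "(real n + 1) powr (2 - p) \<le> (2 ^ i) powr (2 - p)" using n False by (intro powr_mono2') auto
      also have "\<dots> \<le> 2 * (2 ^ i) powr (2 - p)" by simp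
      finally show ?thesis .
    qed
  qed
  have "(\<Sum>n\<in>?B. 1 * a n) powr p \<le> (\<Sum>n\<in>?B. 1) powr (p - 1) * (\<Sum>n\<in>?B. 1 * a n powr p)"
    using a by (intro jensen_powr_sum p) auto
  then have "(\<Sum>n\<in>?B. a n) powr p \<le> (2 ^ i) powr (p - 1) * (\<Sum>n\<in>?B. a n powr p)"
    using card by simp
  also have "(\<Sum>n\<in>?B. a n powr p) \<le> (\<Sum>n\<in>?B. (a n powr p * (real n + 1) powr (p - 2)) * (2 * (2 ^ i) powr (2 - p)))"
  proof (rule sum_mono)
    fix n assume n: "n \<in> ?B"
    have "a n powr p = a n powr p * (real n + 1) powr (p - 2) * (real n + 1) powr (2 - p)"
      by (simp add: mult.assoc powr_add[symmetric])
    also have "\<dots> \<le> a n powr p * (real n + 1) powr (p - 2) * (2 * (2 ^ i) powr (2 - p))"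
      using w[OF n] by (intro mult_left_mono) auto
    finally show "a n powr p \<le> a n powr p * (real n + 1) powr (p - 2) * (2 * (2 ^ i) powr (2 - p))" .
  qed
  also have "(2 ^ i) powr (p - 1) * \<dots> = 2 * ((2 ^ i) powr (p - 1) * (2 ^ i) powr (2 - p)) * ?X"
    by (simp add: sum_distrib_right[symmetric])
  also have "(2 ^ i) powr (p - 1) * (2 ^ i) powr (2 - p) = (2::real) ^ i"
    by (simp add: powr_add[symmetric])
  finally have "((\<Sum>n\<in>?B. a n) powr p) powr (1 / p) \<le> (2 * 2 ^ i * ?X) powr (1 / p)"
    using p by (intro powr_mono2) (auto simp: mult_left_mono)
  also have "\<dots> = 2 powr (1 / p) * (2 ^ i) powr (1 / p) * ?X powr (1 / p)"
    using X0 by (simp add: powr_mult)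
  also have "(2 ^ i) powr (1 / p) = (2 powr (1 / p)) ^ i"
    by (simp add: powr_powr powr_realpow[symmetric] mult.commute del: powr_realpow)
  also have "2 powr (1 / p) * (2 powr (1 / p)) ^ i * ?X powr (1 / p) \<le> 2 * (2 powr (1 / p)) ^ i * ?X powr (1 / p)"
    using root2_bounds[OF p] by (intro mult_right_mono) auto
  finally show ?thesis using p a by (simp add: powr_powr sum_nonneg)
qed

lemma taylor_series:
  assumes "f holomorphic_on ball 0 1" "norm z < 1"
  shows "(\<lambda>n. taylor_coeff f n * z ^ n) sums f z"
  using holomorphic_power_series[of f 0 1 z] assms by (simp add: taylor_coeff_def)

text \<open>For t in interval k, the blocks i \<le> k are estimated by t^n \<le> 1 and the blocks i
  = k + j by t^n \<le> 64 / 4^j. The constant 128 is 64 times the 2 from the block estimate.\<close>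

lemma hardy_littlewood_dyadic_bounded:
  assumes f: "f holomorphic_on ball 0 1" and p: "1 \<le> p" and K: "0 \<le> K"
    and le: "hardy_littlewood_norm p f \<le> ennreal K"
  shows "dyadic_bounded p (128 powr p * ((2 / (1 - 1 / 2 powr (1 / p))) powr p * K powr p)) f"
proof -
  let ?s = "2 powr (1 / p) :: real"
  let ?\<eta> = "1 / ?s"
  note s = root2_bounds[OF p]
  define a where "a n = norm (taylor_coeff f n)" for n
  define B where "B i = {2 ^ i - 1..<2 ^ Suc i - 1 :: nat}" for i
  define X where "X i = (\<Sum>n\<in>B i. a n powr p * (real n + 1) powr (p - 2))" for i
  define x where "x i = X i powr (1 / p)" for i
  have a0: "0 \<le> a n" for n by (simp add: a_def)
  have X0: "0 \<le> X i" for i by (auto simp: X_def intro!: sum_nonneg)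
  have x0: "0 \<le> x i" for i by (simp add: x_def)
  have \<eta>: "0 \<le> ?\<eta>" "?\<eta> < 1" using s by auto
  have XL: "(\<Sum>i<m. x i powr p) \<le> K powr p" for m
  proof -
    have "(\<Sum>n. ennreal (a n powr p * (real n + 1) powr (p - 2))) \<le> ennreal (K powr p)"
      using le p K unfolding hardy_littlewood_norm_def a_def by (intro ennroot_leD) auto
    then have "(\<Sum>n<2 ^ m - 1. ennreal (a n powr p * (real n + 1) powr (p - 2))) \<le> ennreal (K powr p)"
      by (rule order_trans[rotated]) (intro sum_le_suminf; auto)
    then have "(\<Sum>n<2 ^ m - 1. a n powr p * (real n + 1) powr (p - 2)) \<le> K powr p" by simp
    then show ?thesis
      unfolding sum_dyadic_blocks using p X0 by (simp add: x_def X_def B_def powr_powr)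
  qed
  show ?thesis
  proof (rule dyadic_boundedI_schur[OF \<eta> p x0 _ XL])
    fix k t assume t: "t \<in> dyadic_interval k"
    then have t01: "0 \<le> t" "t < 1" using dyadic_interval_subset[of k] by auto
    let ?S = "\<Sum>i. ?\<eta> ^ (k - i + (i - k)) * x i"
    have sm: "summable (\<lambda>i. ?\<eta> ^ (k - i + (i - k)) * x i)" by (rule schur_dyadic(1)[OF \<eta> p x0 XL])
    have block: "(\<Sum>n\<in>B i. a n * t ^ n) \<le> ?s ^ k * (128 * (?\<eta> ^ (k - i + (i - k)) * x i))" for i
    proof -
      have "(\<Sum>n\<in>B i. a n * t ^ n) \<le> (\<Sum>n\<in>B i. a n * (64 * (?s ^ k * ?\<eta> ^ i * ?\<eta> ^ (k - i + (i - k)))))"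
      proof (intro sum_mono mult_left_mono a0)
        fix n assume n: "n \<in> B i"
        show "t ^ n \<le> 64 * (?s ^ k * ?\<eta> ^ i * ?\<eta> ^ (k - i + (i - k)))"
        proof (cases "i \<le> k")
          case True
          have "?s ^ k * ?\<eta> ^ i * ?\<eta> ^ (k - i + (i - k)) = 1"
            using True s by (simp add: power_one_over power_diff field_simps)
          moreover have "t ^ n \<le> 1" using t01 by (intro power_le_one) auto
          ultimately show ?thesis by simp
        next
          case False
          then obtain j where j: "i = k + j" "1 \<le> j" by (metis le_add_diff_inverse less_imp_le_nat not_less_eq_eq not_le One_nat_def Suc_leI zero_less_diff)
          have "2 ^ i \<le> n + 1" using n by (auto simp: B_def)
          then have "2 ^ i \<le> real n + 1" by (simp flip: of_nat_le_iff[where 'a = real])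
          \<comment> \<open>Only n \<ge> 2^i - 1 is available; the resulting loss 1 / 2 ^ Suc k is
            absorbed by the summand 1 in 1 + n (1 - t).\<close>
          then have "(2 ^ i - 1) * (1 / 2 ^ Suc k) \<le> real n * (1 - t)"
            using dyadic_interval_one_minus[OF t] by (intro mult_mono) auto
          moreover have "(2 ^ i - 1) * (1 / 2 ^ Suc k) = (2 :: real) ^ j / 2 - 1 / 2 ^ Suc k"
            unfolding j by (simp add: field_simps power_add)
          moreover have "1 / 2 ^ Suc k \<le> (1::real)" using one_le_power[of "2::real" "Suc k"] by (simp del: power_Suc)
          moreover have "b / 4 \<le> 1 + A" if "c \<le> A" "c = b / 2 - \<epsilon>" "\<epsilon> \<le> 1" "0 < b" for b c A \<epsilon> :: real
            using that by simp
          ultimately have "2 ^ j / 4 \<le> 1 + real n * (1 - t)" by (meson zero_less_numeral zero_less_power)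
          then have "(2 ^ j / 4)\<^sup>2 \<le> (1 + real n * (1 - t))\<^sup>2" by (intro power_mono) auto
          then have "t ^ n \<le> 4 / (2 ^ j / 4)\<^sup>2"
            using t01 by (intro order_trans[OF power_le_inverse_square[OF t01]] divide_left_mono) (auto intro!: mult_pos_pos zero_less_power add_pos_nonneg)
          also have "\<dots> = 64 * (1 / 4) ^ j"
          proof -
            have "(2 ^ j)\<^sup>2 = (4::real) ^ j" by (simp add: power2_eq_square flip: power_mult_distrib)
            then show ?thesis by (simp add: power_divide)
          qed
          \<comment> \<open>s \<le> 2 means \<eta> \<ge> 1/2. Of the two factors \<eta>^j, one
            equals s^k \<eta>^i and the other is the decay in the distance from i to k.\<close>
          also have "(1 / 4) ^ j \<le> (?\<eta> * ?\<eta>) ^ j"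
          proof (intro power_mono)
            have "?s * ?s \<le> 2 * 2" using s by (intro mult_mono) auto
            then show "1 / 4 \<le> ?\<eta> * ?\<eta>" using s by (simp add: field_simps)
          qed auto
          also have "\<dots> = ?s ^ k * ?\<eta> ^ i * ?\<eta> ^ (k - i + (i - k))"
            unfolding j using s by (simp add: power_mult_distrib power_one_over power_add field_simps)
          finally show ?thesis by simp
        qed
      qed
      also have "\<dots> = (\<Sum>n\<in>B i. a n) * (64 * (?s ^ k * ?\<eta> ^ i * ?\<eta> ^ (k - i + (i - k))))"
        by (simp add: sum_distrib_right)
      also have "\<dots> \<le> (2 * ?s ^ i * x i) * (64 * (?s ^ k * ?\<eta> ^ i * ?\<eta> ^ (k - i + (i - k))))"
        unfolding B_def x_def X_def using hardy_littlewood_block_le[OF p a0]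
        by (intro mult_right_mono) auto
      also have "\<dots> = ?s ^ k * (128 * (?\<eta> ^ (k - i + (i - k)) * x i)) * (?s ^ i * ?\<eta> ^ i)"
        by (simp add: mult_ac)
      also have "?s ^ i * ?\<eta> ^ i = 1" using s by (simp add: power_one_over)
      finally show ?thesis by simp
    qed
    have part: "(\<Sum>n<N. a n * t ^ n) \<le> ?s ^ k * (128 * ?S)" for N
    proof -
      have "(\<Sum>n<N. a n * t ^ n) \<le> (\<Sum>n<2 ^ N - 1. a n * t ^ n)"
      proof -
        have "N \<le> 2 ^ N - 1" using less_exp[of N] by linarith
        then show ?thesis using t01 a0 by (intro sum_mono2) auto
      qed
      also have "\<dots> \<le> (\<Sum>i<N. ?s ^ k * (128 * (?\<eta> ^ (k - i + (i - k)) * x i)))"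
        unfolding sum_dyadic_blocks using block unfolding B_def by (intro sum_mono)
      also have "\<dots> = ?s ^ k * (128 * (\<Sum>i<N. ?\<eta> ^ (k - i + (i - k)) * x i))"
        by (simp add: sum_distrib_left)
      also have "\<dots> \<le> ?s ^ k * (128 * ?S)"
        using \<eta> x0 by (intro mult_left_mono sum_le_suminf sm) auto
      finally show ?thesis .
    qed
    have "(\<lambda>N. norm (\<Sum>n<N. taylor_coeff f n * of_real t ^ n)) \<longlonglongrightarrow> norm (f (of_real t))"
      using taylor_series[OF f, of "of_real t"] t01 by (intro tendsto_norm) (auto simp: sums_def)
    then show "norm (f (of_real t)) \<le> ?s ^ k * (128 * ?S)"
    proof (rule tendsto_upperbound)
      have "norm (\<Sum>n<N. taylor_coeff f n * of_real t ^ n) \<le> ?s ^ k * (128 * ?S)" for N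
      proof -
        have "norm (\<Sum>n<N. taylor_coeff f n * of_real t ^ n) \<le> (\<Sum>n<N. a n * t ^ n)"
          using t01 by (intro order_trans[OF norm_sum] sum_mono) (auto simp: a_def norm_mult norm_power)
        also note part
        finally show ?thesis .
      qed
      then show "\<forall>\<^sub>F N in sequentially. norm (\<Sum>n<N. taylor_coeff f n * of_real t ^ n) \<le> ?s ^ k * (128 * ?S)"
        by simp
    qed simp
  qed simp
qed

text \<open>The derivative is integrated along the ray; the i-th dyadic piece has length 1 / 2 ^ Suc
  i, and a point of interval j is reached within the pieces 0 to j.\<close>

lemma ray_growth:
  assumes F: "F holomorphic_on ball 0 1"
    and c: "\<And>i \<rho>. 1 - 1 / 2 ^ i \<le> \<rho> \<Longrightarrow> \<rho> \<le> 1 - 1 / 2 ^ Suc i \<Longrightarrow> norm (deriv F (of_real \<rho> * cis \<theta>)) \<le> c i"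
    and r: "r \<in> dyadic_interval j"
  shows "norm (F (of_real r * cis \<theta>)) \<le> norm (F 0) + (\<Sum>i\<le>j. c i / 2 ^ Suc i)"
proof -
  define b where "b i = (1 - 1 / 2 ^ i :: real)" for i :: nat
  have b: "0 \<le> b i" "b i < 1" "b i \<le> b (Suc i)" for i
    using one_le_power[of "2::real" i] by (auto simp: b_def field_simps)
  have c0: "0 \<le> c i" for i
    by (rule order_trans[OF norm_ge_zero c[of i "b i"]]) (use b(3)[of i] in \<open>auto simp: b_def\<close>)
  have step: "norm (F (of_real t * cis \<theta>)) \<le> norm (F (of_real (b i) * cis \<theta>)) + c i / 2 ^ Suc i" if t: "t \<in> {b i..b (Suc i)}" for i t
  proof -
    let ?S = "(\<lambda>\<rho>. \<rho> *\<^sub>R cis \<theta>) ` {b i..b (Suc i)}"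
    have "norm (F (t *\<^sub>R cis \<theta>) - F (b i *\<^sub>R cis \<theta>)) \<le> c i * norm (t *\<^sub>R cis \<theta> - b i *\<^sub>R cis \<theta>)"
    proof (rule field_differentiable_bound[where S = ?S and f' = "deriv F"])
      show "convex ?S" by (intro convex_linear_image linear_scaleR_left) simp
      show "(F has_field_derivative deriv F z) (at z within ?S)" if z: "z \<in> ?S" for z
      proof -
        obtain u where u: "z = u *\<^sub>R cis \<theta>" "u \<in> {b i..b (Suc i)}" using z by blast
        have "\<bar>u\<bar> < 1" using u(2) b(1)[of i] b(2)[of "Suc i"] by auto
        then have "u *\<^sub>R cis \<theta> \<in> ball 0 1" by simp
        then show ?thesis unfolding u(1)
          by (intro has_field_derivative_at_within[OF holomorphic_derivI[OF F open_ball]])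
      qed
      show "norm (deriv F z) \<le> c i" if "z \<in> ?S" for z
        using that c[of i] by (auto simp: b_def scaleR_conv_of_real)
    qed (use t in auto)
    also have "norm (t *\<^sub>R cis \<theta> - b i *\<^sub>R cis \<theta>) = t - b i"
      using t by (simp flip: scaleR_diff_left)
    also have "c i * (t - b i) \<le> c i * (1 / 2 ^ Suc i)"
      using t c0 by (intro mult_left_mono) (auto simp: b_def)
    finally show ?thesis
      using norm_triangle_sub[of "F (t *\<^sub>R cis \<theta>)" "F (b i *\<^sub>R cis \<theta>)"] by (simp add: scaleR_conv_of_real)
  qed
  have end_bound: "norm (F (of_real (b k) * cis \<theta>)) \<le> norm (F 0) + (\<Sum>i<k. c i / 2 ^ Suc i)" for k
  proof (induction k)
    case (Suc k)
    then show ?case using step[of "b (Suc k)" k] b[of k] by simp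
  qed (simp add: b_def)
  have "r \<in> {b j..b (Suc j)}" using r by (auto simp: dyadic_interval_def b_def power_one_over)
  then show ?thesis using step[of r j] end_bound[of j] by (simp flip: lessThan_Suc_atMost)
qed

section \<open>Embedding of the Dirichlet-type space\<close>

lemma borel_measurable_dirichlet_density:
  assumes "f holomorphic_on ball 0 1"
  shows "(\<lambda>z. ennreal (norm (deriv f z) powr p * (1 - norm z) powr (p - 1) / pi) * indicator (ball 0 1) z)
    \<in> borel_measurable borel"
proof -
  define h where "h = (\<lambda>z. indicator (ball 0 1) z *\<^sub>R deriv f z)"
  have "deriv f holomorphic_on ball 0 1" using assms by (intro holomorphic_deriv) auto
  then have "continuous_on (ball 0 1) (deriv f)" by (rule holomorphic_on_imp_continuous_on)
  then have [measurable]: "h \<in> borel_measurable borel" "ball (0 :: complex) 1 \<in> sets borel"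
    unfolding h_def by (auto intro: borel_measurable_continuous_on_indicator)
  have "(\<lambda>z. ennreal (norm (h z) powr p * (1 - norm z) powr (p - 1) / pi) * indicator (ball 0 1) z) \<in> borel_measurable borel"
    by measurable
  also have "(\<lambda>z. ennreal (norm (h z) powr p * (1 - norm z) powr (p - 1) / pi) * indicator (ball 0 1) z)
      = (\<lambda>z. ennreal (norm (deriv f z) powr p * (1 - norm z) powr (p - 1) / pi) * indicator (ball 0 1) z)"
    by (auto simp: h_def indicator_def fun_eq_iff)
  finally show ?thesis .
qed

text \<open>With \<rho> = 1 / 2^(i+2), points of ball i satisfy \<rho> < 1 - |z| < 5 \<rho>. Three
  steps in i shrink \<rho> by 8 > 5, so a point lies in the balls of at most three consecutive
  indices.\<close>

lemma sum_indicator_dyadic_balls_le: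
  fixes \<sigma> :: "nat \<Rightarrow> real"
  assumes \<sigma>: "\<And>i. 1 - 1 / 2 ^ i \<le> \<sigma> i \<and> \<sigma> i \<le> 1 - 1 / 2 ^ Suc i"
  shows "(\<Sum>i<n. indicator (ball (complex_of_real (\<sigma> i)) (1 / 2 ^ (i + 2))) z) \<le> (3 :: ennreal)"
proof -
  let ?A = "{i\<in>{..<n}. z \<in> ball (complex_of_real (\<sigma> i)) (1 / 2 ^ (i + 2))}"
  have bnd: "1 / 2 ^ (i + 2) < 1 - norm z" "1 - norm z < 5 / 2 ^ (i + 2)" if "i \<in> ?A" for i
  proof -
    have "norm (complex_of_real (\<sigma> i) - z) < 1 / 2 ^ (i + 2)" using that by (simp add: dist_norm)
    moreover have "\<bar>norm (complex_of_real (\<sigma> i)) - norm z\<bar> \<le> norm (complex_of_real (\<sigma> i) - z)"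
      by (rule norm_triangle_ineq3)
    moreover have "0 \<le> \<sigma> i" 
    proof -
      have "1 / 2 ^ i \<le> (1 :: real)" using one_le_power[of "2::real" i] by simp
      then show ?thesis using \<sigma>[of i] by linarith
    qed
    ultimately have *: "\<bar>\<sigma> i - norm z\<bar> < 1 / 2 ^ (i + 2)" by simp
    have e: "1 / 2 ^ Suc i = 2 * (1 / 2 ^ (i + 2) :: real)" "1 / 2 ^ i = 4 * (1 / 2 ^ (i + 2) :: real)"
      by (simp_all add: power_add)
    show "1 / 2 ^ (i + 2) < 1 - norm z" "1 - norm z < 5 / 2 ^ (i + 2)"
      using * \<sigma>[of i] unfolding e by linarith+
  qed
  have "card ?A \<le> 3"
  proof (cases "?A = {}")
    case False
    define i where "i = Min ?A"
    have i: "i \<in> ?A" unfolding i_def using False by (intro Min_in) auto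
    have "?A \<subseteq> {i..<i + 3}"
    proof
      fix j assume j: "j \<in> ?A"
      have "i \<le> j" unfolding i_def using j by (intro Min_le) auto
      moreover have "\<not> i + 3 \<le> j"
      proof
        assume "i + 3 \<le> j"
        then have "5 / 2 ^ (j + 2) \<le> (5 / 2 ^ (i + 3 + 2) :: real)"
          by (intro divide_left_mono power_increasing) auto
        also have "\<dots> = 5 / 8 * (1 / 2 ^ (i + 2))" by (simp add: power_add)
        also have "\<dots> \<le> 1 * (1 / 2 ^ (i + 2))" by (intro mult_right_mono) auto
        finally show False using bnd(1)[OF i] bnd(2)[OF j] by simp
      qed
      ultimately show "j \<in> {i..<i + 3}" by auto
    qed
    then have "card ?A \<le> card {i..<i + 3}" by (intro card_mono) auto
    then show ?thesis by simp
  qed (simp only: card.empty)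
  moreover have "(\<Sum>i<n. indicator (ball (complex_of_real (\<sigma> i)) (1 / 2 ^ (i + 2))) z) = (of_nat (card ?A) :: ennreal)"
    by (simp add: indicator_def sum.If_cases Int_def)
  moreover have "(of_nat m :: ennreal) \<le> 3" if "m \<le> 3" for m
    using that of_nat_mono[of m 3, where 'a = ennreal] by simp
  ultimately show ?thesis by (simp only:)
qed

text \<open>At the point \<sigma> i where |f'| is largest on the closed i-th interval, the mean
  value inequality over a disc of radius \<rho> i compares the maximum with the area integral; the
  discs overlap boundedly and keep 1 - |z| \<ge> \<rho> i. Integrating f' along the radius then
  bounds f. The factor \<open>1 powr p\<close> is the constant C = 1 of
  \<open>dyadic_boundedI_schur\<close>.\<close>

lemma dirichlet_dyadic_bounded:
  assumes f: "f holomorphic_on ball 0 1" and p: "1 \<le> p" and K: "0 \<le> K"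
    and le: "dirichlet_norm p f \<le> ennreal K"
  shows "dyadic_bounded p (1 powr p * ((2 / (1 - 1 / 2 powr (1 / p))) powr p *
    (2 powr p * (4 powr (p + 1) * (3 * K powr p) + K powr p)))) f"
proof -
  let ?s = "2 powr (1 / p) :: real"
  let ?\<eta> = "1 / ?s"
  note s = root2_bounds[OF p]
  have \<eta>: "0 \<le> ?\<eta>" "?\<eta> < 1" using s by auto
  have df: "deriv f holomorphic_on ball 0 1" using f by (intro holomorphic_deriv) auto
  define b where "b i = (1 - 1 / 2 ^ i :: real)" for i :: nat
  have b: "0 \<le> b i" "b i < 1" "b i \<le> b (Suc i)" for i
    using one_le_power[of "2::real" i] by (auto simp: b_def field_simps)
  have sub: "complex_of_real t \<in> ball 0 1" if "t \<in> {b i..b (Suc i)}" for i t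
    using that b(1)[of i] b(2)[of "Suc i"] by auto
  have "\<exists>\<sigma>\<in>{b i..b (Suc i)}. \<forall>t\<in>{b i..b (Suc i)}. norm (deriv f (of_real t)) \<le> norm (deriv f (of_real \<sigma>))" for i
    using b[of i] b(2)[of "Suc i"] by (intro continuous_attains_sup continuous_intros
      continuous_on_compose2[OF holomorphic_on_imp_continuous_on[OF df]]) auto
  then obtain \<sigma> where \<sigma>: "\<And>i. \<sigma> i \<in> {b i..b (Suc i)}"
    and \<sigma>max: "\<And>i t. t \<in> {b i..b (Suc i)} \<Longrightarrow> norm (deriv f (of_real t)) \<le> norm (deriv f (of_real (\<sigma> i)))"
    by metis
  define m where "m i = norm (deriv f (of_real (\<sigma> i)))" for i
  define \<rho> where "\<rho> i = (1 / 2 ^ (i + 2) :: real)" for i :: nat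
  have m0: "0 \<le> m i" and \<rho>0: "0 < \<rho> i" for i by (simp_all add: m_def \<rho>_def)
  have total: "ennreal (norm (f 0) powr p) +
      (\<integral>\<^sup>+z\<in>ball 0 1. ennreal (norm (deriv f z) powr p * (1 - norm z) powr (p - 1) / pi) \<partial>lborel) \<le> ennreal (K powr p)"
    using le p K unfolding dirichlet_norm_def by (intro ennroot_leD) auto
  have f0: "norm (f 0) powr p \<le> K powr p"
  proof -
    have "ennreal (norm (f 0) powr p) \<le> ennreal (K powr p)"
      using total by (rule order_trans[rotated]) (simp add: add_increasing2)
    then show ?thesis by simp
  qed
  define H where "H z = ennreal (norm (deriv f z) powr p * (1 - norm z) powr (p - 1) / pi) * indicator (ball 0 1) z" for z
  have Hint: "(\<integral>\<^sup>+z. H z \<partial>lborel) \<le> ennreal (K powr p)"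
    using total unfolding H_def by (rule order_trans[rotated]) (simp add: add_increasing)
  define hh where "hh = (\<lambda>z. indicator (ball 0 1) z *\<^sub>R deriv f z)"
  have [measurable]: "hh \<in> borel_measurable borel" "ball (0 :: complex) 1 \<in> sets borel"
    unfolding hh_def by (rule borel_measurable_continuous_on_indicator[OF _ holomorphic_on_imp_continuous_on[OF df]]) simp_all
  have [measurable]: "H \<in> borel_measurable borel"
    unfolding H_def by (rule borel_measurable_dirichlet_density[OF f])
  have ballsub: "z \<in> ball 0 1" "\<rho> i \<le> 1 - norm z" if "z \<in> cball (complex_of_real (\<sigma> i)) (\<rho> i)" for i z
  proof -
    have "norm z \<le> norm (complex_of_real (\<sigma> i)) + norm (complex_of_real (\<sigma> i) - z)"
      using norm_triangle_ineq4[of "complex_of_real (\<sigma> i)" "complex_of_real (\<sigma> i) - z"] by simp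
    moreover have "norm (complex_of_real (\<sigma> i) - z) \<le> \<rho> i" using that by (simp add: dist_norm)
    moreover have "norm (complex_of_real (\<sigma> i)) \<le> 1 - 2 * \<rho> i"
    proof -
      have "0 \<le> \<sigma> i" using \<sigma>[of i] b(1)[of i] by simp
      then show ?thesis using \<sigma>[of i] by (simp add: b_def \<rho>_def)
    qed
    ultimately show "\<rho> i \<le> 1 - norm z" by linarith
    then show "z \<in> ball 0 1" using \<rho>0[of i] by simp
  qed
  have local: "ennreal (\<rho> i powr (p + 1) * m i powr p)
      \<le> (\<integral>\<^sup>+z. H z * indicator (ball (complex_of_real (\<sigma> i)) (\<rho> i)) z \<partial>lborel)" for i
  proof -
    let ?U = "ball (complex_of_real (\<sigma> i)) (\<rho> i)"
    have "\<rho> i powr (p + 1) = \<rho> i powr (p - 1) * \<rho> i ^ 2"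
      using \<rho>0[of i] by (simp add: powr_add[symmetric] add.commute flip: powr_numeral)
    then have "ennreal (\<rho> i powr (p + 1) * m i powr p) = ennreal (\<rho> i powr (p - 1) / pi) * ennreal (pi * (\<rho> i)\<^sup>2 * m i powr p)"
      by (simp add: ennreal_mult[symmetric])
    also have "\<dots> \<le> ennreal (\<rho> i powr (p - 1) / pi) * (\<integral>\<^sup>+z\<in>?U. ennreal (norm (deriv f z) powr p) \<partial>lborel)"
      unfolding m_def using ballsub \<rho>0[of i]
      by (intro mult_left_mono disc_mean_powr_le[OF open_ball _ df p]) auto
    also have "\<dots> = (\<integral>\<^sup>+z. ennreal (\<rho> i powr (p - 1) / pi) * (ennreal (norm (deriv f z) powr p) * indicator ?U z) \<partial>lborel)"
    proof (rule nn_integral_cmult[symmetric])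
      have "?U \<in> sets borel" by simp
      then have "(\<lambda>z. ennreal (norm (hh z) powr p) * indicator ?U z) \<in> borel_measurable borel" by measurable
      moreover have "(\<lambda>z. ennreal (norm (hh z) powr p) * indicator ?U z) = (\<lambda>z. ennreal (norm (deriv f z) powr p) * indicator ?U z)"
        using ballsub(1)[of _ i] by (auto simp: hh_def indicator_def fun_eq_iff)
      ultimately show "(\<lambda>z. ennreal (norm (deriv f z) powr p) * indicator ?U z) \<in> borel_measurable lborel" by simp
    qed
    also have "\<dots> \<le> (\<integral>\<^sup>+z. H z * indicator ?U z \<partial>lborel)"
    proof (rule nn_integral_mono)
      fix z
      show "ennreal (\<rho> i powr (p - 1) / pi) * (ennreal (norm (deriv f z) powr p) * indicator ?U z) \<le> H z * indicator ?U z"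
      proof (cases "z \<in> ?U")
        case True
        have "\<rho> i powr (p - 1) / pi * norm (deriv f z) powr p \<le> norm (deriv f z) powr p * (1 - norm z) powr (p - 1) / pi"
        proof -
          have "\<rho> i powr (p - 1) \<le> (1 - norm z) powr (p - 1)"
            using ballsub(2)[of z i] True \<rho>0[of i] p by (intro powr_mono2) auto
          then have "norm (deriv f z) powr p * \<rho> i powr (p - 1) \<le> norm (deriv f z) powr p * (1 - norm z) powr (p - 1)"
            by (rule mult_left_mono) simp
          then show ?thesis by (simp add: mult.commute divide_right_mono)
        qed
        then show ?thesis using True ballsub(1)[of z i]
          by (simp add: H_def ennreal_mult[symmetric] ennreal_leI)
      qed simp
    qed
    finally show ?thesis .
  qed
  have msum: "(\<Sum>i<n. \<rho> i powr (p + 1) * m i powr p) \<le> 3 * K powr p" for n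
  proof -
    have "ennreal (\<Sum>i<n. \<rho> i powr (p + 1) * m i powr p) = (\<Sum>i<n. ennreal (\<rho> i powr (p + 1) * m i powr p))"
      by simp
    also have "\<dots> \<le> (\<Sum>i<n. \<integral>\<^sup>+z. H z * indicator (ball (complex_of_real (\<sigma> i)) (\<rho> i)) z \<partial>lborel)"
      by (intro sum_mono local)
    also have "\<dots> = (\<integral>\<^sup>+z. (\<Sum>i<n. H z * indicator (ball (complex_of_real (\<sigma> i)) (\<rho> i)) z) \<partial>lborel)"
    proof (rule nn_integral_sum[symmetric])
      fix i
      have "ball (complex_of_real (\<sigma> i)) (\<rho> i) \<in> sets borel" by simp
      then show "(\<lambda>z. H z * indicator (ball (complex_of_real (\<sigma> i)) (\<rho> i)) z) \<in> borel_measurable lborel"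
        by measurable
    qed
    also have "\<dots> \<le> (\<integral>\<^sup>+z. H z * 3 \<partial>lborel)"
      unfolding sum_distrib_left[symmetric] \<rho>_def using \<sigma> unfolding b_def
      by (intro nn_integral_mono mult_left_mono sum_indicator_dyadic_balls_le) auto
    also have "\<dots> = (\<integral>\<^sup>+z. H z \<partial>lborel) * 3" by (rule nn_integral_multc) simp
    also have "\<dots> \<le> ennreal (K powr p) * 3" by (intro mult_right_mono Hint) auto
    also have "\<dots> = ennreal (3 * K powr p)" by (simp add: ennreal_mult mult.commute)
    finally show ?thesis by simp
  qed
  \<comment> \<open>Chosen so that the p-th power of the first summand is 2^(-i(p+1)) m_i^p, the
    quantity summed in \<open>msum\<close> up to the constant 4^(p+1); |f 0| is stored in the entry
    i = 0.\<close>
  define x where "x i = ?\<eta> ^ i * (1 / 2) ^ i * m i + (if i = 0 then norm (f 0) else 0)" for i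
  have x0: "0 \<le> x i" for i using s m0 by (simp add: x_def)
  have xL: "(\<Sum>i<n. x i powr p) \<le> 2 powr p * (4 powr (p + 1) * (3 * K powr p) + K powr p)" for n
  proof -
    have eq: "(?\<eta> ^ i * (1 / 2) ^ i * m i) powr p = 4 powr (p + 1) * (\<rho> i powr (p + 1) * m i powr p)" for i
    proof -
      have "(?\<eta> ^ i) powr p = 1 / 2 ^ i"
        using root2_powr[of p i] p by (simp add: power_one_over powr_divide)
      moreover have "((1 / 2 :: real) ^ i) powr p * (1 / 2 ^ i) = (1 / 2 ^ i) powr (p + 1)"
        by (simp add: powr_add power_one_over)
      moreover have "(1 / 2 ^ i :: real) = 4 * \<rho> i" by (simp add: \<rho>_def power_add)
      ultimately show ?thesis using m0 \<rho>0[of i] s by (simp add: powr_mult mult_ac)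
    qed
    have "x i powr p \<le> 2 powr p * (4 powr (p + 1) * (\<rho> i powr (p + 1) * m i powr p) + (if i = 0 then norm (f 0) powr p else 0))" for i
      using powr_add_le[of "?\<eta> ^ i * (1 / 2) ^ i * m i" "if i = 0 then norm (f 0) else 0" p] m0 s p
      unfolding eq x_def by (auto split: if_splits)
    then have "(\<Sum>i<n. x i powr p) \<le> (\<Sum>i<n. 2 powr p * (4 powr (p + 1) * (\<rho> i powr (p + 1) * m i powr p) + (if i = 0 then norm (f 0) powr p else 0)))"
      by (intro sum_mono)
    also have "\<dots> = 2 powr p * (4 powr (p + 1) * (\<Sum>i<n. \<rho> i powr (p + 1) * m i powr p) + (\<Sum>i<n. if i = 0 then norm (f 0) powr p else 0))"
      by (simp only: sum_distrib_left[symmetric] sum.distrib)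
    also have "\<dots> \<le> 2 powr p * (4 powr (p + 1) * (3 * K powr p) + K powr p)"
    proof (intro mult_left_mono add_mono msum)
      have "(\<Sum>i<n. if i = 0 then norm (f 0) powr p else 0) \<le> norm (f 0) powr p"
        by (simp add: sum.delta)
      then show "(\<Sum>i<n. if i = 0 then norm (f 0) powr p else 0) \<le> K powr p" using f0 by linarith
    qed auto
    finally show ?thesis .
  qed
  show ?thesis
  proof (rule dyadic_boundedI_schur[OF \<eta> p x0 _ xL])
    fix k t assume t: "t \<in> dyadic_interval k"
    have "norm (deriv f (of_real u * cis 0)) \<le> m i" if "1 - 1 / 2 ^ i \<le> u" "u \<le> 1 - 1 / 2 ^ Suc i" for i u
      using \<sigma>max[of u i] that by (simp add: m_def b_def)
    from ray_growth[OF f this t]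
    have "norm (f (of_real t)) \<le> norm (f 0) + (\<Sum>i<Suc k. m i / 2 ^ Suc i)"
      by (simp add: lessThan_Suc_atMost)
    also have "\<dots> \<le> (\<Sum>i<Suc k. ?s ^ k * (?\<eta> ^ (k - i + (i - k)) * x i))"
    proof -
      have "norm (f 0) + (\<Sum>i<Suc k. m i / 2 ^ Suc i) \<le> norm (f 0) + (\<Sum>i<Suc k. (1 / 2) ^ i * m i)"
        using m0 by (intro add_left_mono sum_mono) (simp add: field_simps)
      also have "\<dots> = (\<Sum>i<Suc k. (1 / 2) ^ i * m i + (if i = 0 then norm (f 0) else 0))"
        by (simp add: sum.distrib sum.delta)
      also have "\<dots> \<le> (\<Sum>i<Suc k. ?s ^ k * (?\<eta> ^ (k - i + (i - k)) * x i))"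
      proof (rule sum_mono)
        fix i assume "i \<in> {..<Suc k}"
        then have "i \<le> k" by simp
        then have e: "?s ^ k * ?\<eta> ^ (k - i + (i - k)) = ?s ^ i"
          using s by (simp add: power_one_over power_diff field_simps)
        have "?s ^ i * x i = (?s ^ i * ?\<eta> ^ i) * (1 / 2) ^ i * m i + (if i = 0 then norm (f 0) else 0)"
          by (simp add: x_def algebra_simps)
        also have "?s ^ i * ?\<eta> ^ i = 1" using s by (simp add: power_one_over)
        finally show "(1 / 2) ^ i * m i + (if i = 0 then norm (f 0) else 0) \<le> ?s ^ k * (?\<eta> ^ (k - i + (i - k)) * x i)"
          by (simp add: e mult.assoc[symmetric] del: mult.assoc)
      qed
      finally show ?thesis .
    qed
    also have "\<dots> = ?s ^ k * (1 * (\<Sum>i<Suc k. ?\<eta> ^ (k - i + (i - k)) * x i))"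
      by (simp only: sum_distrib_left mult_1)
    also have "\<dots> \<le> ?s ^ k * (1 * (\<Sum>i. ?\<eta> ^ (k - i + (i - k)) * x i))"
      using \<eta> x0 by (intro mult_left_mono sum_le_suminf schur_dyadic(1)[OF \<eta> p x0 xL]) auto
    finally show "norm (f (of_real t)) \<le> ?s ^ k * (1 * (\<Sum>i. ?\<eta> ^ (k - i + (i - k)) * x i))" .
  qed simp
qed

section \<open>Embedding of the Hardy space\<close>

lemma hardy_norm_integral_le:
  assumes f: "f holomorphic_on ball 0 1" and p: "1 \<le> p" and K: "0 \<le> K" and le: "hardy_norm p f \<le> ennreal K"
    and R: "0 < R" "R < 1"
  shows "(LINT \<theta>:{0..2*pi}|lborel. norm (f (of_real R * cis \<theta>)) powr p) \<le> 2 * pi * K powr p"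
proof -
  let ?A = "LINT \<theta>:{0..2*pi}|lborel. norm (f (of_real R * cis \<theta>)) powr p"
  have A0: "0 \<le> ?A" unfolding set_lebesgue_integral_def by (intro Bochner_Integration.integral_nonneg) auto
  have "ennreal (integral_mean p R f) \<le> hardy_norm p f"
    unfolding hardy_norm_def using R by (intro SUP_upper) auto
  then have "ennreal (integral_mean p R f) \<le> ennreal K" using le by (rule order_trans)
  then have "integral_mean p R f \<le> K" using K by simp
  then have "((?A / (2 * pi)) powr (1 / p)) powr p \<le> K powr p"
    unfolding integral_mean_def using p by (intro powr_mono2) auto
  then have "?A / (2 * pi) \<le> K powr p" using p A0 by (simp add: powr_powr)
  then show ?thesis by (simp add: field_simps)
qed

text \<open>The Poisson formula was proved for functions holomorphic near the closed disc; the
  dilations of f by R < 1 are such functions.\<close>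

lemma dilation:
  assumes f: "f holomorphic_on ball 0 1" and R: "0 < R" "R < 1"
  shows "open ((\<lambda>w. of_real R * w) -` ball (0::complex) 1)" "cball 0 1 \<subseteq> (\<lambda>w. of_real R * w) -` ball (0::complex) 1"
    "(\<lambda>w. f (of_real R * w)) holomorphic_on (\<lambda>w. of_real R * w) -` ball 0 1"
    "continuous_on {0..2*pi} (\<lambda>\<theta>. f (of_real R * cis \<theta>))"
proof -
  show "open ((\<lambda>w. of_real R * w) -` ball (0::complex) 1)"
    by (intro continuous_open_vimage continuous_intros) auto
  show "cball 0 1 \<subseteq> (\<lambda>w. of_real R * w) -` ball (0::complex) 1"
  proof
    fix w :: complex assume "w \<in> cball 0 1"
    then have "R * norm w \<le> R * 1" using R by (intro mult_left_mono) auto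
    also have "\<dots> < 1" using R by simp
    finally show "w \<in> (\<lambda>w. of_real R * w) -` ball 0 1" using R by (simp add: norm_mult)
  qed
  show "(\<lambda>w. f (of_real R * w)) holomorphic_on (\<lambda>w. of_real R * w) -` ball 0 1"
    by (rule holomorphic_on_compose_gen[OF _ f, unfolded o_def]) (auto intro!: holomorphic_intros)
  show "continuous_on {0..2*pi} (\<lambda>\<theta>. f (of_real R * cis \<theta>))"
    using R by (intro continuous_on_compose2[OF holomorphic_on_imp_continuous_on[OF f]] continuous_intros)
      (auto simp: norm_mult)
qed

text \<open>The numerator is at most 2 / 2^k, and |1 - t cis \<theta>| is bounded below both by the
  distance to the circle and by the distance along it, that is, by 1 / (4 2^(min k i)).\<close>

lemma poisson_kernel_arc_le:
  assumes t: "t \<in> dyadic_interval k" and \<theta>: "\<theta> \<in> dyadic_arc i"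
  shows "poisson_kernel t \<theta> \<le> 32 / 2 ^ k * (2 ^ min k i)\<^sup>2"
proof -
  have t01: "0 \<le> t" "t < 1" using t dyadic_interval_subset[of k] by auto
  note t' = dyadic_interval_one_minus[OF t]
  let ?d = "norm (1 - of_real t * cis \<theta>)"
  have "1 / (4 * 2 ^ i) \<le> ?d" using norm_one_minus_cis_ge_arc[OF \<theta> t01(1)] .
  moreover have "1 / (4 * 2 ^ k) \<le> ?d"
  proof -
    have "1 / (4 * 2 ^ k) \<le> 1 / (2 ^ Suc k :: real)" by (simp add: field_simps)
    also have "\<dots> \<le> 1 - norm (of_real t * cis \<theta>)" using t' t01 by (simp add: norm_mult)
    also have "\<dots> \<le> ?d" by (rule norm_one_minus_ge)
    finally show ?thesis .
  qed
  ultimately have "1 / (4 * 2 ^ min k i) \<le> ?d" by (simp add: min_def)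
  then have d: "(1 / (4 * 2 ^ min k i))\<^sup>2 \<le> ?d\<^sup>2" by (intro power_mono) auto
  have "1 - t\<^sup>2 = (1 - t) * (1 + t)" by (simp add: power2_eq_square algebra_simps)
  also have "\<dots> \<le> (1 / 2 ^ k) * 2" using t' t01 by (intro mult_mono) auto
  finally have n: "1 - t\<^sup>2 \<le> 2 / 2 ^ k" by simp
  have "0 < ?d\<^sup>2" using one_minus_cis_nonzero[OF t01] by simp
  then have "poisson_kernel t \<theta> \<le> (2 / 2 ^ k) / (1 / (4 * 2 ^ min k i))\<^sup>2"
    unfolding poisson_kernel_def using n d t01
    by (intro frac_le) (auto simp: power_le_one_iff abs_square_le_1)
  also have "\<dots> = 32 / 2 ^ k * (2 ^ min k i)\<^sup>2" by (simp add: power_divide power_mult_distrib)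
  finally show ?thesis .
qed

text \<open>The Poisson integral is split into dyadic arcs and the contribution of arc i is bounded
  through the integral \<open>a i\<close> of |f| over it. The off-diagonal rate s / 2 is below 1
  exactly because p > 1. The bound does not depend on R.\<close>

lemma hardy_dilation_dyadic_bounded:
  assumes f: "f holomorphic_on ball 0 1" and p: "1 < p" and K: "0 \<le> K" and le: "hardy_norm p f \<le> ennreal K"
    and R: "0 < R" "R < 1"
  shows "dyadic_bounded p (32 powr p * ((2 / (1 - 2 powr (1 / p) / 2)) powr p * (2 * pi * K) powr p)) (\<lambda>z. f (of_real R * z))"
proof -
  have p1: "1 \<le> p" using p by simp
  let ?s = "2 powr (1 / p) :: real"
  let ?\<eta> = "?s / 2"
  note s = root2_bounds[OF p1]
  have "2 powr (1 / p) < (2 powr 1 :: real)" using p by (intro powr_less_mono) auto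
  then have \<eta>: "0 \<le> ?\<eta>" "?\<eta> < 1" by auto
  define u where "u \<theta> = norm (f (of_real R * cis \<theta>))" for \<theta>
  have u0: "0 \<le> u \<theta>" for \<theta> by (simp add: u_def)
  have ucont: "continuous_on {0..2*pi} u" unfolding u_def by (intro continuous_intros dilation(4)[OF f R])
  have upcont: "continuous_on {0..2*pi} (\<lambda>\<theta>. u \<theta> powr p)"
    using p u0 by (intro continuous_on_powr' ucont continuous_intros) auto
  have arcsub: "dyadic_arc i \<subseteq> {0..2*pi}" for i by (auto simp: dyadic_arc_def)
  have ui: "set_integrable lborel {0..2*pi} u" "set_integrable lborel {0..2*pi} (\<lambda>\<theta>. u \<theta> powr p)"
    by (intro borel_integrable_atLeastAtMost' ucont upcont)+
  have uia: "set_integrable lborel (dyadic_arc i) u" "set_integrable lborel (dyadic_arc i) (\<lambda>\<theta>. u \<theta> powr p)" for i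
    by (rule set_integrable_subset[OF ui(1)] set_integrable_subset[OF ui(2)]; use arcsub in simp)+
  define a where "a i = (LINT \<theta>:dyadic_arc i|lborel. u \<theta>)" for i
  have a0: "0 \<le> a i" for i unfolding a_def set_lebesgue_integral_def using u0 by (intro Bochner_Integration.integral_nonneg) auto
  \<comment> \<open>Jensen on an arc of length about 2^-i loses 2^(-i(p-1)) in the p-th power of
    \<open>a i\<close>; the p-th power of (2 / s)^i restores precisely this.\<close>
  define x where "x i = (2 / ?s) ^ i * a i" for i
  have x0: "0 \<le> x i" for i using a0 s by (simp add: x_def)
  have xp: "x i powr p \<le> (2 * pi) powr (p - 1) * (LINT \<theta>:dyadic_arc i|lborel. u \<theta> powr p)" for i
  proof -
    have fin: "emeasure lborel (dyadic_arc i) < \<infinity>"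
      using emeasure_dyadic_arc_le[of i] by (rule le_less_trans) simp
    have meas: "measure lborel (dyadic_arc i) \<le> 2 * pi / 2 ^ i"
      unfolding measure_def using enn2real_mono[OF emeasure_dyadic_arc_le[of i]] by simp
    have J: "a i powr p \<le> measure lborel (dyadic_arc i) powr (p - 1) * (LINT \<theta>:dyadic_arc i|lborel. u \<theta> powr p)"
      using jensen_powr_integral[OF p1, of "indicator (dyadic_arc i)" u lborel] u0 uia[of i] fin
      by (simp add: a_def set_lebesgue_integral_def set_integrable_def)
    also have "\<dots> \<le> (2 * pi / 2 ^ i) powr (p - 1) * (LINT \<theta>:dyadic_arc i|lborel. u \<theta> powr p)"
      using p meas unfolding set_lebesgue_integral_def
      by (intro mult_right_mono powr_mono2 Bochner_Integration.integral_nonneg) auto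
    finally have "a i powr p \<le> (2 * pi) powr (p - 1) / (2 ^ i) powr (p - 1) * (LINT \<theta>:dyadic_arc i|lborel. u \<theta> powr p)"
      by (simp add: powr_divide)
    then have "(2 ^ i) powr (p - 1) * a i powr p \<le> (2 ^ i) powr (p - 1) * ((2 * pi) powr (p - 1) / (2 ^ i) powr (p - 1) * (LINT \<theta>:dyadic_arc i|lborel. u \<theta> powr p))"
      by (rule mult_left_mono) simp
    moreover have "x i powr p = (2 ^ i) powr (p - 1) * a i powr p"
    proof -
      have "((2 / ?s) ^ i) powr p = (2 ^ i) powr p / (?s ^ i) powr p"
        by (simp add: power_divide powr_divide)
      also have "\<dots> = (2 ^ i) powr (p - 1)" using p root2_powr[of p i] by (simp add: powr_diff)
      finally show ?thesis using a0 s by (simp add: x_def powr_mult)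
    qed
    ultimately show ?thesis by simp
  qed
  have xL: "(\<Sum>i<m. x i powr p) \<le> (2 * pi * K) powr p" for m
  proof -
    have "(\<Sum>i<m. x i powr p) \<le> (2 * pi) powr (p - 1) * (\<Sum>i<m. LINT \<theta>:dyadic_arc i|lborel. u \<theta> powr p)"
      unfolding sum_distrib_left by (intro sum_mono xp)
    also have "(\<Sum>i<m. LINT \<theta>:dyadic_arc i|lborel. u \<theta> powr p) = (LINT \<theta>|lborel. (\<Sum>i<m. indicat_real (dyadic_arc i) \<theta> *\<^sub>R u \<theta> powr p))"
      unfolding set_lebesgue_integral_def using uia unfolding set_integrable_def
      by (intro Bochner_Integration.integral_sum[symmetric]) auto
    also have "\<dots> \<le> (LINT \<theta>:{0..2*pi}|lborel. u \<theta> powr p)"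
      unfolding set_lebesgue_integral_def
    proof (rule integral_mono)
      show "integrable lborel (\<lambda>\<theta>. \<Sum>i<m. indicat_real (dyadic_arc i) \<theta> *\<^sub>R u \<theta> powr p)"
        using uia(2) unfolding set_integrable_def by (intro Bochner_Integration.integrable_sum)
      show "integrable lborel (\<lambda>\<theta>. indicat_real {0..2*pi} \<theta> *\<^sub>R u \<theta> powr p)"
        using ui(2) unfolding set_integrable_def .
      fix \<theta> :: real
      have "(\<Sum>i<m. indicat_real (dyadic_arc i) \<theta>) = indicat_real (\<Union>i<m. dyadic_arc i) \<theta>"
        using disjoint_family_dyadic_arc
        by (intro indicator_UN_disjoint[symmetric]) (auto simp: disjoint_family_on_def)
      also have "\<dots> \<le> indicat_real {0..2*pi} \<theta>" by (auto simp: indicator_def dest!: subsetD[OF arcsub])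
      finally have "(\<Sum>i<m. indicat_real (dyadic_arc i) \<theta>) * u \<theta> powr p \<le> indicat_real {0..2*pi} \<theta> * u \<theta> powr p"
        by (rule mult_right_mono) simp
      then show "(\<Sum>i<m. indicat_real (dyadic_arc i) \<theta> *\<^sub>R u \<theta> powr p) \<le> indicat_real {0..2*pi} \<theta> *\<^sub>R u \<theta> powr p"
        by (simp only: sum_distrib_right real_scaleR_def)
    qed
    also have "\<dots> \<le> 2 * pi * K powr p"
      unfolding u_def by (rule hardy_norm_integral_le[OF f p1 K le R])
    finally have "(\<Sum>i<m. x i powr p) \<le> (2 * pi) powr (p - 1) * (2 * pi * K powr p)"
      by (simp add: mult_left_mono)
    also have "\<dots> = (2 * pi * K) powr p" using K by (simp add: powr_mult powr_diff)
    finally show ?thesis .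
  qed
  show ?thesis
  proof (rule dyadic_boundedI_schur[OF \<eta> p1 x0 _ xL])
    fix k t assume t: "t \<in> dyadic_interval k"
    then have t01: "0 \<le> t" "t < 1" using dyadic_interval_subset[of k] by auto
    let ?S = "\<Sum>i. ?\<eta> ^ (k - i + (i - k)) * x i"
    have Pcont: "continuous_on {0..2*pi} (\<lambda>\<theta>. poisson_kernel t \<theta> * u \<theta>)"
      by (intro continuous_intros continuous_on_poisson_kernel[OF t01] ucont)
    have Pi: "set_integrable lborel {0..2*pi} (\<lambda>\<theta>. poisson_kernel t \<theta> * u \<theta>)"
      by (rule borel_integrable_atLeastAtMost'[OF Pcont])
    have arc: "(\<integral>\<^sup>+\<theta>\<in>dyadic_arc i. ennreal (poisson_kernel t \<theta> * u \<theta>) \<partial>lborel) \<le> ennreal (?s ^ k * (32 * (?\<eta> ^ (k - i + (i - k)) * x i)))" for i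
    proof -
      define M :: real where "M = 32 / 2 ^ k * (2 ^ min k i)\<^sup>2"
      have M: "poisson_kernel t \<theta> \<le> M" if "\<theta> \<in> dyadic_arc i" for \<theta>
        unfolding M_def by (rule poisson_kernel_arc_le[OF t that])
      have M0: "0 \<le> M" by (simp add: M_def)
      have "(\<integral>\<^sup>+\<theta>\<in>dyadic_arc i. ennreal (poisson_kernel t \<theta> * u \<theta>) \<partial>lborel)
        \<le> (\<integral>\<^sup>+\<theta>. ennreal (M * (indicator (dyadic_arc i) \<theta> *\<^sub>R u \<theta>)) \<partial>lborel)"
        using M u0
        by (intro nn_integral_mono) (auto simp: indicator_def intro!: ennreal_leI mult_right_mono)
      also have "\<dots> = ennreal (M * a i)"
        using uia(1)[of i] u0 M0 unfolding a_def set_lebesgue_integral_def set_integrable_def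
        by (subst nn_integral_eq_integral) auto
      also have "M * a i \<le> ?s ^ k * (32 * (?\<eta> ^ (k - i + (i - k)) * x i))"
      proof -
        have ai: "a i = ?\<eta> ^ i * x i" using s by (simp add: x_def power_divide)
        \<comment> \<open>For k \<le> i this is an equality with decay rate s / 2; for i < k the
          true rate is 1 / (2 s), which is even smaller.\<close>
        have "1 / 2 ^ k * (2 ^ min k i)\<^sup>2 * ?\<eta> ^ i \<le> ?s ^ k * ?\<eta> ^ (k - i + (i - k))"
        proof (cases "k \<le> i")
          case True
          then obtain j where j: "i = k + j" by (metis le_add_diff_inverse)
          have "1 / 2 ^ k * (2 ^ min k i)\<^sup>2 * ?\<eta> ^ i = ?s ^ k * ?\<eta> ^ (k - i + (i - k))"
            unfolding j using s by (simp add: power_add power_divide power2_eq_square)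
          then show ?thesis by simp
        next
          case False
          then obtain j where j: "k = i + j" by (metis le_add_diff_inverse nat_le_linear)
          have "(1 / ?s) ^ j * (1 / 2) ^ j \<le> (1 * ?s) ^ j * (1 / 2) ^ j"
          proof (intro mult_right_mono power_mono)
            have "1 / ?s \<le> 1" using s by simp
            then show "1 / ?s \<le> 1 * ?s" using s by linarith
          qed auto
          then have "?s ^ k * ((1 / ?s) ^ j * (1 / 2) ^ j) \<le> ?s ^ k * ((1 * ?s) ^ j * (1 / 2) ^ j)"
            by (rule mult_left_mono) simp
          moreover have "?s ^ k * ((1 / ?s) ^ j * (1 / 2) ^ j) = 1 / 2 ^ k * (2 ^ min k i)\<^sup>2 * ?\<eta> ^ i"
            unfolding j using s by (simp add: power_add power_divide power2_eq_square)
          moreover have "?s ^ k * ((1 * ?s) ^ j * (1 / 2) ^ j) = ?s ^ k * ?\<eta> ^ (k - i + (i - k))"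
            unfolding j by (simp add: power_divide)
          ultimately show ?thesis by simp
        qed
        then have "32 * x i * (1 / 2 ^ k * (2 ^ min k i)\<^sup>2 * ?\<eta> ^ i) \<le> 32 * x i * (?s ^ k * ?\<eta> ^ (k - i + (i - k)))"
          using x0 by (intro mult_left_mono) auto
        then show ?thesis unfolding ai M_def by (simp only: mult_ac times_divide_eq_right mult_1_left mult_1_right times_divide_eq_left)
      qed
      finally show ?thesis by (simp add: ennreal_leI)
    qed
    have "ennreal (2 * pi * norm (f (of_real R * of_real t))) \<le> ennreal (LINT \<theta>:{0..2*pi}|lborel. poisson_kernel t \<theta> * u \<theta>)"
      using poisson_integral_norm_le[OF dilation(1-3)[OF f R] t01] unfolding u_def by (intro ennreal_leI)
    also have "\<dots> = (\<integral>\<^sup>+\<theta>. ennreal (indicator {0..2*pi} \<theta> *\<^sub>R (poisson_kernel t \<theta> * u \<theta>)) \<partial>lborel)"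
      unfolding set_lebesgue_integral_def using Pi u0 poisson_kernel_nonneg[OF t01]
      by (intro nn_integral_eq_integral[symmetric]) (auto simp: set_integrable_def)
    also have "\<dots> = (\<integral>\<^sup>+\<theta>\<in>{0..2*pi}. ennreal (poisson_kernel t \<theta> * u \<theta>) \<partial>lborel)"
      by (intro nn_integral_cong) (auto simp: indicator_def)
    also have "\<dots> = (\<Sum>i. \<integral>\<^sup>+\<theta>\<in>dyadic_arc i. ennreal (poisson_kernel t \<theta> * u \<theta>) \<partial>lborel)"
    proof (rule nn_integral_circle_arcs)
      have "(\<lambda>\<theta>. ennreal (indicator {0..2*pi} \<theta> *\<^sub>R (poisson_kernel t \<theta> * u \<theta>))) \<in> borel_measurable borel"
        using borel_measurable_continuous_on_indicator[OF _ Pcont] by simp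
      also have "(\<lambda>\<theta>. ennreal (indicator {0..2*pi} \<theta> *\<^sub>R (poisson_kernel t \<theta> * u \<theta>))) = (\<lambda>\<theta>. ennreal (poisson_kernel t \<theta> * u \<theta>) * indicator {0..2*pi} \<theta>)"
        by (auto simp: indicator_def)
      finally show "(\<lambda>\<theta>. ennreal (poisson_kernel t \<theta> * u \<theta>) * indicator {0..2*pi} \<theta>) \<in> borel_measurable borel" .
    qed
    also have "\<dots> \<le> (\<Sum>i. ennreal (?s ^ k * (32 * (?\<eta> ^ (k - i + (i - k)) * x i))))"
      by (intro suminf_le arc) auto
    also have "\<dots> \<le> ennreal (?s ^ k * (32 * ?S))"
    proof (rule suminf_ennreal_le)
      show "(\<Sum>i<n. ?s ^ k * (32 * (?\<eta> ^ (k - i + (i - k)) * x i))) \<le> ?s ^ k * (32 * ?S)" for n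
        unfolding sum_distrib_left[symmetric] using \<eta> x0
        by (intro mult_left_mono sum_le_suminf schur_dyadic(1)[OF \<eta> p1 x0 xL]) auto
    qed (use x0 in auto)
    finally have le: "2 * pi * norm (f (of_real R * of_real t)) \<le> ?s ^ k * (32 * ?S)"
      by (rule iffD1[OF ennreal_le_iff, rotated])
        (use \<eta> x0 in \<open>auto intro!: mult_nonneg_nonneg suminf_nonneg schur_dyadic(1)[OF \<eta> p1 x0 xL]\<close>)
    have "1 * norm (f (of_real R * of_real t)) \<le> 2 * pi * norm (f (of_real R * of_real t))"
      using pi_ge_two by (intro mult_right_mono) auto
    with le show "norm (f (of_real R * of_real t)) \<le> ?s ^ k * (32 * ?S)" by simp
  qed simp
qed

text \<open>The majorant found for a dilation depends on R, so it cannot be passed to the limit.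
  Instead, sample points \<sigma> k are fixed where |f| is maximal on the closed interval, and the
  finite sums of |f(R \<sigma> k)|^p / 2^k are bounded uniformly before R tends to 1.\<close>

lemma hardy_dyadic_bounded:
  assumes f: "f holomorphic_on ball 0 1" and p: "1 < p" and K: "0 \<le> K" and le: "hardy_norm p f \<le> ennreal K"
  shows "dyadic_bounded p (2 powr p * (3 * (32 powr p * ((2 / (1 - 2 powr (1 / p) / 2)) powr p * (2 * pi * K) powr p)))) f"
proof -
  define L where "L = 32 powr p * ((2 / (1 - 2 powr (1 / p) / 2)) powr p * (2 * pi * K) powr p)"
  define b where "b i = (1 - 1 / 2 ^ i :: real)" for i :: nat
  have b: "0 \<le> b i" "b i < 1" "b i < b (Suc i)" for i
    using one_le_power[of "2::real" i] by (auto simp: b_def field_simps)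
  have int: "dyadic_interval i = {b i..<b (Suc i)}" for i
    by (simp add: dyadic_interval_def b_def power_one_over)
  have "\<exists>\<sigma>\<in>{b i..b (Suc i)}. \<forall>t\<in>{b i..b (Suc i)}. norm (f (of_real t)) \<le> norm (f (of_real \<sigma>))" for i
    using b[of i] b(2)[of "Suc i"] by (intro continuous_attains_sup continuous_intros
      continuous_on_compose2[OF holomorphic_on_imp_continuous_on[OF f]]) auto
  then obtain \<sigma> where \<sigma>: "\<And>i. \<sigma> i \<in> {b i..b (Suc i)}"
    and \<sigma>max: "\<And>i t. t \<in> {b i..b (Suc i)} \<Longrightarrow> norm (f (of_real t)) \<le> norm (f (of_real (\<sigma> i)))"
    by metis
  have R: "(\<Sum>k<n. norm (f (of_real R * of_real (\<sigma> k))) powr p / 2 ^ k) \<le> 2 powr p * (3 * L)"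
    if R: "0 < R" "R < 1" for R n
  proof -
    from hardy_dilation_dyadic_bounded[OF assms R] obtain g where g0: "\<And>k. 0 \<le> g k"
      and g: "\<And>k t. t \<in> dyadic_interval k \<Longrightarrow> norm (f (of_real R * of_real t)) \<le> g k"
      and gL: "\<And>n. (\<Sum>k<n. g k powr p / 2 ^ k) \<le> L"
      unfolding dyadic_bounded_def L_def by blast
    have "norm (f (of_real R * of_real (\<sigma> k))) \<le> g k + g (Suc k)" for k
    \<comment> \<open>The maximum may sit at the right endpoint, which belongs to the next half-open
      interval; therefore g k + g (Suc k).\<close>
    proof (cases "\<sigma> k = b (Suc k)")
      case True
      then have "\<sigma> k \<in> dyadic_interval (Suc k)" unfolding int using b(3)[of "Suc k"] by simp
      from g[OF this] g0[of k] show ?thesis by linarith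
    next
      case False
      then have "\<sigma> k \<in> dyadic_interval k" unfolding int using \<sigma>[of k] by simp
      from g[OF this] g0[of "Suc k"] show ?thesis by linarith
    qed
    then have "norm (f (of_real R * of_real (\<sigma> k))) powr p \<le> 2 powr p * (g k powr p + g (Suc k) powr p)" for k
      using p g0 by (intro order_trans[OF powr_mono2 powr_add_le]) auto
    then have "(\<Sum>k<n. norm (f (of_real R * of_real (\<sigma> k))) powr p / 2 ^ k)
        \<le> (\<Sum>k<n. 2 powr p * (g k powr p + g (Suc k) powr p) / 2 ^ k)"
      by (intro sum_mono divide_right_mono) auto
    also have "\<dots> = (\<Sum>k<n. 2 powr p * (g k powr p / 2 ^ k + 2 * (g (Suc k) powr p / 2 ^ Suc k)))"
      by (intro sum.cong) (auto simp: field_simps)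
    also have "\<dots> = 2 powr p * ((\<Sum>k<n. g k powr p / 2 ^ k) + 2 * (\<Sum>k<n. g (Suc k) powr p / 2 ^ Suc k))"
      by (simp only: sum_distrib_left[symmetric] sum.distrib)
    also have "\<dots> \<le> 2 powr p * (L + 2 * L)"
    proof (intro mult_left_mono add_mono gL)
      have "(\<Sum>k<n. g (Suc k) powr p / 2 ^ Suc k) \<le> (\<Sum>k<Suc n. g k powr p / 2 ^ k)"
        by (subst sum.lessThan_Suc_shift) simp
      then show "(\<Sum>k<n. g (Suc k) powr p / 2 ^ Suc k) \<le> L" using gL[of "Suc n"] by linarith
    qed auto
    finally show ?thesis by simp
  qed
  show ?thesis
    unfolding dyadic_bounded_def L_def[symmetric]
  proof (intro exI[of _ "\<lambda>k. norm (f (of_real (\<sigma> k)))"] conjI allI ballI)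
    show "norm (f (of_real t)) \<le> norm (f (of_real (\<sigma> k)))" if "t \<in> dyadic_interval k" for k t
      using that \<sigma>max[of t k] by (simp add: int)
    fix n
    show "(\<Sum>k<n. norm (f (of_real (\<sigma> k))) powr p / 2 ^ k) \<le> 2 powr p * (3 * L)"
    proof (rule tendsto_upperbound)
      have "((\<lambda>R. f (of_real R * of_real (\<sigma> k))) \<longlongrightarrow> f (of_real 1 * of_real (\<sigma> k))) (at_left 1)" for k
      proof (rule isCont_tendsto_compose[where g = f])
        have "\<bar>\<sigma> k\<bar> < 1" using \<sigma>[of k] b(1)[of k] b(2)[of "Suc k"] by auto
        then show "isCont f (of_real 1 * of_real (\<sigma> k))"
          using continuous_on_interior[OF holomorphic_on_imp_continuous_on[OF f], of "of_real (\<sigma> k)"] by simp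
      qed (intro tendsto_intros)
      then have "((\<lambda>R. \<Sum>k<n. norm (f (of_real R * of_real (\<sigma> k))) powr p / 2 ^ k)
        \<longlongrightarrow> (\<Sum>k<n. norm (f (of_real 1 * of_real (\<sigma> k))) powr p / 2 ^ k)) (at_left 1)"
        using p by (intro tendsto_intros tendsto_powr') auto
      then show "((\<lambda>R. \<Sum>k<n. norm (f (of_real R * of_real (\<sigma> k))) powr p / 2 ^ k)
        \<longlongrightarrow> (\<Sum>k<n. norm (f (of_real (\<sigma> k))) powr p / 2 ^ k)) (at_left 1)"
        by simp
      have "\<forall>\<^sub>F R in at_left (1::real). R \<in> {0<..<1}"
        by (intro eventually_at_left_real) simp
      then show "\<forall>\<^sub>F R in at_left (1::real). (\<Sum>k<n. norm (f (of_real R * of_real (\<sigma> k))) powr p / 2 ^ k) \<le> 2 powr p * (3 * L)"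
        by eventually_elim (use R in auto)
    qed (simp add: trivial_limit_at_left_real)
  qed simp
qed

section \<open>Dyadic majorants and pointwise growth for all four spaces\<close>

lemma space_norm_dyadic_bounded:
  assumes X: "X \<in> space_norms p" and p: "1 < p" and K: "0 \<le> K"
  obtains L where "\<And>f. f holomorphic_on ball 0 1 \<Longrightarrow> X f \<le> ennreal K \<Longrightarrow> dyadic_bounded p L f"
proof -
  have p1: "1 \<le> p" using p by simp
  note L = hardy_dyadic_bounded[OF _ p K] dirichlet_dyadic_bounded[OF _ p1 K]
    hardy_littlewood_dyadic_bounded[OF _ p1 K] mixed_norm_dyadic_bounded[OF _ p1 K]
  from X show ?thesis
    unfolding space_norms_def using L that by (elim insertE emptyE) blast+
qed

lemma dyadic_bounded_growth:
  assumes f: "dyadic_bounded p L f" and p: "0 \<le> p" and t: "0 \<le> t" "t < 1"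
  shows "norm (f (of_real t)) powr p * (1 - t) \<le> L"
proof -
  obtain g where g0: "\<And>k. 0 \<le> g k" and g: "\<And>k t. t \<in> dyadic_interval k \<Longrightarrow> norm (f (of_real t)) \<le> g k"
    and gL: "\<And>n. (\<Sum>k<n. g k powr p / 2 ^ k) \<le> L"
    using f unfolding dyadic_bounded_def by blast
  have "t \<in> (\<Union>k. dyadic_interval k)" unfolding UN_dyadic_interval using t by simp
  then obtain k where k: "t \<in> dyadic_interval k" by blast
  have "norm (f (of_real t)) powr p * (1 - t) \<le> g k powr p * (1 / 2 ^ k)"
    using t p g[OF k] dyadic_interval_one_minus[OF k] by (intro mult_mono powr_mono2) auto
  also have "\<dots> \<le> (\<Sum>k<Suc k. g k powr p / 2 ^ k)"
    by (simp add: sum_nonneg)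
  also note gL
  finally show ?thesis .
qed

text \<open>Growth in the Hardy space is derived directly from the bound 2 / (1 - t) on the Poisson
  kernel, since the dyadic majorant is available only for p > 1 and the exponent 1 is needed
  here.\<close>

lemma hardy_growth:
  assumes f: "f holomorphic_on ball 0 1" and p: "1 \<le> p" and K: "0 \<le> K" and le: "hardy_norm p f \<le> ennreal K"
    and t: "0 \<le> t" "t < 1"
  shows "norm (f (of_real t)) powr p * (1 - t) \<le> 2 * K powr p"
proof -
  have R: "norm (f (of_real R * of_real t)) powr p * (1 - t) \<le> 2 * K powr p" if R: "0 < R" "R < 1" for R
  proof -
    let ?u = "\<lambda>\<theta>. norm (f (of_real R * cis \<theta>)) powr p"
    have uc: "continuous_on {0..2*pi} ?u"
      using p by (intro continuous_on_powr' continuous_intros dilation(4)[OF f R]) auto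
    have "2 * pi * norm (f (of_real R * of_real t)) powr p
        \<le> (LINT \<theta>:{0..2*pi}|lborel. poisson_kernel t \<theta> * ?u \<theta>)"
      by (rule poisson_integral_powr_le[OF dilation(1-3)[OF f R] t p])
    also have "\<dots> \<le> (LINT \<theta>:{0..2*pi}|lborel. 2 / (1 - t) * ?u \<theta>)"
      by (intro set_integral_mono borel_integrable_atLeastAtMost' continuous_intros uc continuous_on_poisson_kernel[OF t]
          mult_right_mono poisson_kernel_le[OF t]) auto
    also have "\<dots> = 2 / (1 - t) * (LINT \<theta>:{0..2*pi}|lborel. ?u \<theta>)" by simp
    also have "\<dots> \<le> 2 / (1 - t) * (2 * pi * K powr p)"
      using t by (intro mult_left_mono hardy_norm_integral_le[OF f p K le R]) auto
    finally have "2 * pi * norm (f (of_real R * of_real t)) powr p \<le> 2 * pi * (2 * K powr p / (1 - t))"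
      by (simp add: mult_ac)
    then have "norm (f (of_real R * of_real t)) powr p \<le> 2 * K powr p / (1 - t)"
      by (subst (asm) mult_le_cancel_left_pos) simp_all
    then show ?thesis using t by (simp add: pos_le_divide_eq)
  qed
  show ?thesis
  proof (rule tendsto_upperbound)
    have "((\<lambda>R. f (of_real R * of_real t)) \<longlongrightarrow> f (of_real 1 * of_real t)) (at_left 1)"
    proof (rule isCont_tendsto_compose[where g = f])
      show "isCont f (of_real 1 * of_real t)"
        using t continuous_on_interior[OF holomorphic_on_imp_continuous_on[OF f], of "of_real t"] by simp
    qed (intro tendsto_intros)
    then have "((\<lambda>R. norm (f (of_real R * of_real t)) powr p * (1 - t)) \<longlongrightarrow> norm (f (of_real 1 * of_real t)) powr p * (1 - t)) (at_left 1)"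
      using p by (intro tendsto_intros tendsto_powr') auto
    then show "((\<lambda>R. norm (f (of_real R * of_real t)) powr p * (1 - t)) \<longlongrightarrow> norm (f (of_real t)) powr p * (1 - t)) (at_left 1)"
      by simp
    have "\<forall>\<^sub>F R in at_left (1::real). R \<in> {0<..<1}"
      by (intro eventually_at_left_real) simp
    then show "\<forall>\<^sub>F R in at_left (1::real). norm (f (of_real R * of_real t)) powr p * (1 - t) \<le> 2 * K powr p"
      by eventually_elim (use R in auto)
  qed (simp add: trivial_limit_at_left_real)
qed

lemma space_norm_growth:
  assumes X: "X \<in> space_norms p" and p: "1 \<le> p" and K: "0 \<le> K"
  obtains C where "\<And>f t. f holomorphic_on ball 0 1 \<Longrightarrow> X f \<le> ennreal K \<Longrightarrow> 0 \<le> t \<Longrightarrow> t < 1 \<Longrightarrow>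
    norm (f (of_real t)) powr p * (1 - t) \<le> C"
proof -
  have p0: "0 \<le> p" using p by simp
  note L = hardy_growth[OF _ p K] dyadic_bounded_growth[OF dirichlet_dyadic_bounded[OF _ p K] p0]
    dyadic_bounded_growth[OF hardy_littlewood_dyadic_bounded[OF _ p K] p0]
    dyadic_bounded_growth[OF mixed_norm_dyadic_bounded[OF _ p K] p0]
  from X show ?thesis
    unfolding space_norms_def using L that by (elim insertE emptyE) blast+
qed

section \<open>Test functions\<close>

text \<open>With e = 1 / 2^(k+1), the k-th annulus has area pi (2 e - 3 e^2), at most pi /
  2^k.\<close>

lemma nn_integral_disc_le_annuli:
  assumes B: "\<And>k. 0 \<le> B k" and le: "\<And>k z. norm z \<in> dyadic_interval k \<Longrightarrow> f z \<le> ennreal (B k)"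
    and L: "\<And>n. (\<Sum>k<n. B k / 2 ^ k) \<le> L"
  shows "(\<integral>\<^sup>+z\<in>ball (0 :: complex) 1. f z \<partial>lborel) \<le> ennreal (pi * L)"
proof -
  let ?A = "\<lambda>k. {z :: complex. norm z \<in> dyadic_interval k}"
  have A: "?A k = ball 0 (1 - (1/2) ^ Suc k) - ball 0 (1 - (1/2) ^ k)" for k
    by (auto simp: dyadic_interval_def)
  have meas: "?A k \<in> sets lborel" for k unfolding A by simp
  have "ball (0 :: complex) 1 = {z. norm z \<in> {0..<1}}" by auto
  also have "\<dots> = (\<Union>k. ?A k)" unfolding UN_dyadic_interval[symmetric] by blast
  finally have ball: "ball (0 :: complex) 1 = (\<Union>k. ?A k)" .
  have em: "emeasure lborel (?A k) \<le> ennreal (pi / 2 ^ k)" for k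
  proof -
    define e where "e = ((1/2) ^ Suc k :: real)"
    have e: "(1/2) ^ k = 2 * e" "0 \<le> e" "2 * e \<le> 1"
      using power_le_one[of "1/2 :: real" k] by (simp_all add: e_def)
    have "emeasure lborel (?A k) = emeasure lborel (ball (0::complex) (1 - e)) - emeasure lborel (ball (0::complex) (1 - 2 * e))"
      unfolding A e(1) e_def[symmetric] using e by (intro emeasure_Diff) (auto simp: emeasure_complex_ball)
    also have "\<dots> = ennreal (pi * (1 - e)\<^sup>2 - pi * (1 - 2 * e)\<^sup>2)"
      using e by (simp add: emeasure_complex_ball ennreal_minus)
    also have "\<dots> \<le> ennreal (pi * (2 * e))"
    proof (rule ennreal_leI)
      have "(1 - e)\<^sup>2 - (1 - 2 * e)\<^sup>2 \<le> 2 * e"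
        using e by (simp add: power2_eq_square algebra_simps)
      then have "pi * ((1 - e)\<^sup>2 - (1 - 2 * e)\<^sup>2) \<le> pi * (2 * e)" by (intro mult_left_mono) auto
      then show "pi * (1 - e)\<^sup>2 - pi * (1 - 2 * e)\<^sup>2 \<le> pi * (2 * e)" by (simp add: algebra_simps)
    qed
    also have "2 * e = 1 / 2 ^ k" by (simp add: e_def power_one_over)
    finally show ?thesis by simp
  qed
  have "(\<integral>\<^sup>+z\<in>ball (0 :: complex) 1. f z \<partial>lborel) \<le> (\<Sum>k. ennreal (B k) * emeasure lborel (?A k))"
    unfolding ball using le meas by (intro set_nn_integral_UN_le) auto
  also have "\<dots> \<le> (\<Sum>k. ennreal (pi * (B k / 2 ^ k)))"
  proof (intro suminf_le)
    fix k
    have "ennreal (B k) * emeasure lborel (?A k) \<le> ennreal (B k) * ennreal (pi / 2 ^ k)"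
      by (intro mult_left_mono em) auto
    also have "\<dots> = ennreal (pi * (B k / 2 ^ k))"
      using B by (simp add: ennreal_mult[symmetric] mult_ac)
    finally show "ennreal (B k) * emeasure lborel (?A k) \<le> ennreal (pi * (B k / 2 ^ k))" .
  qed auto
  also have "\<dots> \<le> ennreal (pi * L)"
  proof (rule suminf_ennreal_le)
    show "(\<Sum>i<n. pi * (B i / 2 ^ i)) \<le> pi * L" for n
      unfolding sum_distrib_left[symmetric] using L by (intro mult_left_mono) auto
  qed (use B in auto)
  finally show ?thesis .
qed

text \<open>A function with a double pole at 1 + 1 / N. It is positive on the radius, where it is
  about c up to distance 1 / N from the point 1, and the exponent 2 serves all q \<ge> 1 at
  once.\<close>

definition test_fun :: "real \<Rightarrow> nat \<Rightarrow> complex \<Rightarrow> complex" where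
  "test_fun c N z = of_real c / (1 + of_nat N * (1 - z))\<^sup>2"

context
  fixes N :: nat and c :: real
  assumes N: "1 \<le> N" and c: "0 < c"
begin

lemma test_denom_ge:
  fixes z :: complex
  assumes "norm z \<le> r"
  shows "1 + real N * (1 - r) \<le> norm (1 + of_nat N * (1 - z))"
proof -
  have "1 + real N * (1 - r) \<le> 1 + real N * (1 - Re z)"
    using complex_Re_le_cmod[of z] assms by (intro add_left_mono mult_left_mono) auto
  also have "\<dots> = Re (1 + of_nat N * (1 - z))" by simp
  also have "\<dots> \<le> norm (1 + of_nat N * (1 - z))" by (rule complex_Re_le_cmod)
  finally show ?thesis .
qed

lemma test_denom_ge_1: "norm (z :: complex) \<le> 1 \<Longrightarrow> 1 \<le> norm (1 + of_nat N * (1 - z))"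
  using test_denom_ge[of z 1] by simp

lemma test_denom_nonzero: "norm (z :: complex) \<le> 1 \<Longrightarrow> 1 + of_nat N * (1 - z) \<noteq> 0"
  using test_denom_ge_1[of z] by (metis norm_zero not_one_le_zero)

lemma test_fun_holomorphic: "test_fun c N holomorphic_on ball 0 1"
  unfolding test_fun_def [abs_def] using test_denom_nonzero
  by (intro holomorphic_intros) auto

text \<open>The denominator has modulus at least 1 on the closed disc, so the exponent 2 q may be
  lowered to 2. This leaves integrals that do not involve q.\<close>

lemma norm_test_fun_powr_le:
  assumes q: "1 \<le> q" and z: "norm z \<le> 1"
  shows "norm (test_fun c N z) powr q \<le> c powr q / (norm (1 + of_nat N * (1 - z)))\<^sup>2"
proof -
  define d where "d = norm (1 + of_nat N * (1 - z))"
  have d: "1 \<le> d" using test_denom_ge_1[OF z] by (simp add: d_def)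
  have "norm (test_fun c N z) powr q = c powr q / (d\<^sup>2) powr q"
    using c by (simp add: test_fun_def d_def norm_divide norm_power powr_divide)
  also have "\<dots> \<le> c powr q / (d\<^sup>2) powr 1"
    using d q by (intro divide_left_mono powr_mono mult_pos_pos) (auto simp: one_le_power)
  also have "\<dots> = c powr q / d\<^sup>2" using d by simp
  finally show ?thesis by (simp add: d_def)
qed

text \<open>Since \<open>1 + N (1 - z) = (1 + N) (1 - s z / r)\<close> for \<open>s = N r / (1 + N)\<close>, the integrand is a multiple of a Poisson kernel.\<close>

lemma test_circle_integral:
  assumes r: "0 \<le> r" "r < 1"
  shows "continuous_on A (\<lambda>\<theta>. 1 / (norm (1 + of_nat N * (1 - of_real r * cis \<theta>)))\<^sup>2)"
    and "(LINT \<theta>:{0..2*pi}|lborel. 1 / (norm (1 + of_nat N * (1 - of_real r * cis \<theta>)))\<^sup>2)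
      \<le> 2 * pi / (real N * (1 + real N * (1 - r)))"
proof -
  have nz: "1 + of_nat N * (1 - of_real r * cis \<theta>) \<noteq> 0" for \<theta>
    using r by (intro test_denom_nonzero) (simp add: norm_mult)
  show "continuous_on A (\<lambda>\<theta>. 1 / (norm (1 + of_nat N * (1 - of_real r * cis \<theta>)))\<^sup>2)" for A
    using nz by (intro continuous_intros) auto
  define s where "s = real N * r / (1 + real N)"
  have Nr: "real N * r \<le> real N * 1" using r by (intro mult_left_mono) auto
  have s: "0 \<le> s" "s < 1" using r Nr by (auto simp: s_def divide_simps)
  have s1: "1 - s = (1 + real N * (1 - r)) / (1 + real N)" by (simp add: s_def field_simps)
  have eq: "1 / (norm (1 + of_nat N * (1 - of_real r * cis \<theta>)))\<^sup>2 = 1 / ((1 + real N)\<^sup>2 * (1 - s\<^sup>2)) * poisson_kernel s \<theta>" for \<theta>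
  proof -
    have "1 + of_nat N * (1 - of_real r * cis \<theta>) = of_real (1 + real N) * (1 - of_real s * cis \<theta>)"
    proof -
      have "(1 + real N) * s = real N * r" by (simp add: s_def)
      then have "complex_of_real (1 + real N) * of_real s = of_nat N * of_real r"
        by (metis of_real_mult of_real_of_nat_eq)
      then show ?thesis by (simp add: algebra_simps)
    qed
    then have "norm (1 + of_nat N * (1 - of_real r * cis \<theta>)) = (1 + real N) * norm (1 - of_real s * cis \<theta>)"
      by (simp only: norm_mult norm_of_real)
    moreover have "1 - s\<^sup>2 \<noteq> 0" using s by (simp add: power2_eq_1_iff)
    ultimately show ?thesis by (simp add: poisson_kernel_def power_mult_distrib)
  qed
  have "(LINT \<theta>:{0..2*pi}|lborel. poisson_kernel s \<theta>) = 2 * pi"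
    using integral_unique[OF integral_poisson_kernel[OF s]] continuous_on_poisson_kernel[OF s]
    by (subst set_borel_integral_eq_integral(2)) (auto intro!: borel_integrable_atLeastAtMost')
  then have "(LINT \<theta>:{0..2*pi}|lborel. 1 / (norm (1 + of_nat N * (1 - of_real r * cis \<theta>)))\<^sup>2)
      = 1 / ((1 + real N)\<^sup>2 * (1 - s\<^sup>2)) * (2 * pi)"
    unfolding eq by simp
  also have "\<dots> \<le> 1 / ((1 + real N)\<^sup>2 * (1 - s)) * (2 * pi)"
  proof -
    have "s * s \<le> s * 1" using s by (intro mult_left_mono) auto
    then have "1 - s \<le> 1 - s\<^sup>2" by (simp add: power2_eq_square)
    then show ?thesis using s by (intro mult_right_mono divide_left_mono mult_left_mono mult_pos_pos) auto
  qed
  also have "\<dots> = 2 * pi / ((1 + real N) * (1 + real N * (1 - r)))"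
    unfolding s1 by (simp add: power2_eq_square)
  also have "\<dots> \<le> 2 * pi / (real N * (1 + real N * (1 - r)))"
    using N r by (intro divide_left_mono mult_right_mono mult_pos_pos add_pos_nonneg) auto
  finally show "(LINT \<theta>:{0..2*pi}|lborel. 1 / (norm (1 + of_nat N * (1 - of_real r * cis \<theta>)))\<^sup>2)
      \<le> 2 * pi / (real N * (1 + real N * (1 - r)))" .
qed

lemma mixed_norm_test_fun_le:
  assumes q: "1 \<le> q" and cq: "c powr q \<le> real N"
  shows "mixed_norm_infinity q (test_fun c N) \<le> 1"
proof -
  have "(\<integral>\<^sup>+r\<in>{0..<1}. ennreal (max_mean r (test_fun c N) powr q) \<partial>lborel)
    \<le> (\<integral>\<^sup>+r. ennreal (c powr q * (1 / (1 + real N * (1 - r))\<^sup>2)) * indicator {0..1} r \<partial>lborel)"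
  proof (rule nn_integral_mono)
    fix r :: real
    show "ennreal (max_mean r (test_fun c N) powr q) * indicator {0..<1} r
      \<le> ennreal (c powr q * (1 / (1 + real N * (1 - r))\<^sup>2)) * indicator {0..1} r"
    proof (cases "r \<in> {0..<1}")
      case True
      let ?B = "(c powr q / (1 + real N * (1 - r))\<^sup>2) powr (1 / q)"
      have pos: "0 < 1 + real N * (1 - r)" using True by (intro add_pos_nonneg) auto
      have b: "norm (test_fun c N z) \<le> ?B" if "norm z \<le> r" for z
      proof -
        have "norm (test_fun c N z) powr q \<le> c powr q / (norm (1 + of_nat N * (1 - z)))\<^sup>2"
          using that True by (intro norm_test_fun_powr_le q) auto
        also have "\<dots> \<le> c powr q / (1 + real N * (1 - r))\<^sup>2"
          using test_denom_ge[OF that] pos by (intro divide_left_mono power_mono mult_pos_pos zero_less_power) auto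
        finally have "(norm (test_fun c N z) powr q) powr (1 / q) \<le> ?B"
          using q by (intro powr_mono2) auto
        then show ?thesis using q by (simp add: powr_powr)
      qed
      have "max_mean r (test_fun c N) \<le> ?B"
        using True by (intro max_mean_le b) (simp add: norm_mult)
      moreover have "0 \<le> max_mean r (test_fun c N)"
        by (rule order_trans[OF norm_ge_zero max_mean_ge[OF test_fun_holomorphic, of r 0]]) (use True in auto)
      ultimately have "max_mean r (test_fun c N) powr q \<le> ?B powr q"
        using q by (intro powr_mono2) auto
      also have "\<dots> = c powr q * (1 / (1 + real N * (1 - r))\<^sup>2)" using q by (simp add: powr_powr)
      finally show ?thesis using True by (simp add: ennreal_leI)
    qed auto
  qed
  also have "\<dots> = ennreal (c powr q / (real N * (1 + real N * (1 - 1))) - c powr q / (real N * (1 + real N * (1 - 0))))"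
  proof (rule nn_integral_FTC_Icc)
    fix x :: real assume x: "x \<in> {0..1}"
    have pos: "0 < 1 + real N * (1 - x)" using x by (intro add_pos_nonneg) auto
    show "((\<lambda>x. c powr q / (real N * (1 + real N * (1 - x)))) has_field_derivative
        c powr q * (1 / (1 + real N * (1 - x))\<^sup>2)) (at x)"
      using pos N by (auto intro!: derivative_eq_intros simp: power2_eq_square)
  qed auto
  also have "\<dots> \<le> ennreal (c powr q / real N)"
    using N by (intro ennreal_leI) simp
  also have "\<dots> \<le> ennreal (1 powr q)"
    using cq N by (intro ennreal_leI) simp
  finally show ?thesis unfolding mixed_norm_infinity_def using q ennroot_leI[of _ 1 q] by simp
qed

lemma hardy_norm_test_fun_le:
  assumes q: "1 \<le> q" and cq: "c powr q \<le> real N"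
  shows "hardy_norm q (test_fun c N) \<le> 1"
  unfolding hardy_norm_def
proof (rule SUP_least)
  fix r :: real assume "r \<in> {0<..<1}"
  then have r: "0 \<le> r" "r < 1" by auto
  let ?u = "\<lambda>\<theta>. norm (test_fun c N (of_real r * cis \<theta>)) powr q"
  have cont: "continuous_on {0..2*pi} (\<lambda>\<theta>. test_fun c N (of_real r * cis \<theta>))"
    using r by (intro continuous_on_compose2[OF holomorphic_on_imp_continuous_on[OF test_fun_holomorphic]] continuous_intros)
      (auto simp: norm_mult)
  have "(LINT \<theta>:{0..2*pi}|lborel. ?u \<theta>)
    \<le> (LINT \<theta>:{0..2*pi}|lborel. c powr q * (1 / (norm (1 + of_nat N * (1 - of_real r * cis \<theta>)))\<^sup>2))"
  proof (rule set_integral_mono)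
    show "set_integrable lborel {0..2*pi} ?u"
      using q by (intro borel_integrable_atLeastAtMost' continuous_on_powr' continuous_intros cont) auto
    show "set_integrable lborel {0..2*pi} (\<lambda>\<theta>. c powr q * (1 / (norm (1 + of_nat N * (1 - of_real r * cis \<theta>)))\<^sup>2))"
      by (intro borel_integrable_atLeastAtMost' continuous_on_mult continuous_on_const test_circle_integral(1)[OF r])
    show "?u \<theta> \<le> c powr q * (1 / (norm (1 + of_nat N * (1 - of_real r * cis \<theta>)))\<^sup>2)" for \<theta>
      using norm_test_fun_powr_le[OF q, of "of_real r * cis \<theta>"] r by (simp add: norm_mult)
  qed
  also have "\<dots> \<le> c powr q * (2 * pi / (real N * (1 + real N * (1 - r))))"
    unfolding set_integral_mult_right by (intro mult_left_mono test_circle_integral(2)[OF r]) simp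
  also have "\<dots> \<le> c powr q * (2 * pi / real N)"
    using r N by (intro mult_left_mono divide_left_mono mult_pos_pos add_pos_nonneg) auto
  also have "\<dots> \<le> 2 * pi"
    using cq N by (simp add: field_simps)
  finally have "(LINT \<theta>:{0..2*pi}|lborel. ?u \<theta>) / (2 * pi) \<le> 1" by simp
  moreover have "0 \<le> (LINT \<theta>:{0..2*pi}|lborel. ?u \<theta>)"
    unfolding set_lebesgue_integral_def by (intro Bochner_Integration.integral_nonneg) auto
  ultimately have "((LINT \<theta>:{0..2*pi}|lborel. ?u \<theta>) / (2 * pi)) powr (1 / q) \<le> 1 powr (1 / q)"
    using q by (intro powr_mono2) auto
  then show "ennreal (integral_mean q r (test_fun c N)) \<le> 1"
    by (simp add: integral_mean_def ennreal_le_1)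
qed

text \<open>The coefficients are c (n + 1) s^n / (1 + N)^2 with s = N / (1 + N). The normalised
  numbers \<open>v n\<close> are at most 4, so v powr q is at most 4 powr (q - 1) times v; after
  cancelling (n + 1)^2 a geometric series with sum 1 + N remains.\<close>

lemma hardy_littlewood_norm_test_fun_le:
  assumes q: "1 \<le> q" and cq: "4 powr (q - 1) * c powr q \<le> real N"
  shows "hardy_littlewood_norm q (test_fun c N) \<le> 1"
proof -
  define s where "s = real N / (1 + real N)"
  have s: "0 \<le> s" "s < 1" by (auto simp: s_def)
  define v where "v n = (real n + 1)\<^sup>2 * s ^ n / (1 + real N)\<^sup>2" for n
  have v0: "0 \<le> v n" for n using s by (simp add: v_def)
  have coeff: "taylor_coeff (test_fun c N) n = of_real (c * (real n + 1) * s ^ n / (1 + real N)\<^sup>2)" for n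
  proof (rule power_series_on_disc(2))
    fix z :: complex assume z: "norm z < 1"
    have "s * norm z \<le> 1 * norm z" using s by (intro mult_right_mono) auto
    then have "(\<lambda>n. of_nat (Suc n) * (of_real s * z) ^ n) sums (1 / (1 - of_real s * z)\<^sup>2)"
      using s z by (intro geometric_deriv_sums) (simp add: norm_mult)
    then have "(\<lambda>n. of_real (c / (1 + real N)\<^sup>2) * (of_nat (Suc n) * (of_real s * z) ^ n)) sums
        (of_real (c / (1 + real N)\<^sup>2) * (1 / (1 - of_real s * z)\<^sup>2))"
      by (rule sums_mult)
    moreover have "of_real (c / (1 + real N)\<^sup>2) * (1 / (1 - of_real s * z)\<^sup>2) = test_fun c N z"
    proof -
      have "(1 + real N) * s = real N" by (simp add: s_def)
      then have "complex_of_real (1 + real N) * of_real s = of_nat N"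
        by (metis of_real_mult of_real_of_nat_eq)
      then have "1 + of_nat N * (1 - z) = of_real (1 + real N) * (1 - of_real s * z)"
        by (simp add: algebra_simps)
      then show ?thesis by (simp add: test_fun_def power_mult_distrib)
    qed
    moreover have "(\<lambda>n. of_real (c / (1 + real N)\<^sup>2) * (of_nat (Suc n) * (of_real s * z) ^ n))
        = (\<lambda>n. of_real (c * (real n + 1) * s ^ n / (1 + real N)\<^sup>2) * z ^ n)"
      by (simp add: fun_eq_iff power_mult_distrib add.commute)
    ultimately show "(\<lambda>n. of_real (c * (real n + 1) * s ^ n / (1 + real N)\<^sup>2) * z ^ n) sums test_fun c N z"
      by simp
  qed
  have v4: "v n \<le> 4" for n
  proof -
    have "v n \<le> (real n + 1)\<^sup>2 * (4 / (1 + real n * (1 - s))\<^sup>2) / (1 + real N)\<^sup>2"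
      unfolding v_def using power_le_inverse_square[OF s, of n] by (intro divide_right_mono mult_left_mono) auto
    also have "\<dots> = 4 * ((real n + 1) / ((1 + real n * (1 - s)) * (1 + real N)))\<^sup>2"
      by (simp add: power_divide power_mult_distrib)
    also have "(1 + real n * (1 - s)) * (1 + real N) = 1 + real N + real n"
      by (simp add: s_def field_simps)
    also have "4 * ((real n + 1) / (1 + real N + real n))\<^sup>2 \<le> 4 * 1\<^sup>2"
      by (intro mult_left_mono power_mono) (auto simp: divide_simps)
    finally show ?thesis by simp
  qed
  have coeff_le: "norm (taylor_coeff (test_fun c N) n) powr q * (real n + 1) powr (q - 2)
      \<le> 4 powr (q - 1) * c powr q / (1 + real N)\<^sup>2 * s ^ n" for n
  proof -
    have "norm (taylor_coeff (test_fun c N) n) = c * v n / (real n + 1)"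
      unfolding coeff norm_of_real using c s by (simp add: v_def power2_eq_square)
    then have "norm (taylor_coeff (test_fun c N) n) powr q * (real n + 1) powr (q - 2)
        = c powr q * v n powr q / (real n + 1)\<^sup>2"
      using c v0 by (simp add: powr_mult powr_divide powr_diff powr_numeral)
    also have "v n powr q \<le> 4 powr (q - 1) * v n"
    proof (cases "v n = 0")
      case False
      then have "v n powr q = v n powr (q - 1) * v n" using v0[of n] by (simp add: powr_diff)
      also have "\<dots> \<le> 4 powr (q - 1) * v n" using v0 v4 q by (intro mult_right_mono powr_mono2) auto
      finally show ?thesis .
    qed simp
    then have "c powr q * v n powr q / (real n + 1)\<^sup>2 \<le> c powr q * (4 powr (q - 1) * v n) / (real n + 1)\<^sup>2"
      by (intro divide_right_mono mult_left_mono) auto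
    also have "\<dots> = 4 powr (q - 1) * c powr q / (1 + real N)\<^sup>2 * s ^ n"
      by (simp add: v_def)
    finally show ?thesis .
  qed
  have "(\<Sum>n. ennreal (norm (taylor_coeff (test_fun c N) n) powr q * (real n + 1) powr (q - 2))) \<le> ennreal (1 powr q)"
  proof (rule suminf_ennreal_le)
    fix m
    have "(\<Sum>n<m. norm (taylor_coeff (test_fun c N) n) powr q * (real n + 1) powr (q - 2))
        \<le> 4 powr (q - 1) * c powr q / (1 + real N)\<^sup>2 * (\<Sum>n<m. s ^ n)"
      unfolding sum_distrib_left by (intro sum_mono coeff_le)
    also have "\<dots> \<le> 4 powr (q - 1) * c powr q / (1 + real N)\<^sup>2 * (1 + real N)"
    proof (intro mult_left_mono)
      have "(\<Sum>n<m. s ^ n) \<le> (\<Sum>n. s ^ n)" using s by (intro sum_le_suminf summable_geometric) auto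
      also have "\<dots> = 1 / (1 - s)" using s by (intro suminf_geometric) auto
      also have "\<dots> = 1 + real N" by (simp add: s_def field_simps)
      finally show "(\<Sum>n<m. s ^ n) \<le> 1 + real N" .
    qed auto
    also have "\<dots> = 4 powr (q - 1) * c powr q / (1 + real N)" by (simp add: power2_eq_square)
    also have "\<dots> \<le> 1 powr q" using cq by simp
    finally show "(\<Sum>n<m. norm (taylor_coeff (test_fun c N) n) powr q * (real n + 1) powr (q - 2)) \<le> 1 powr q" .
  qed auto
  then show ?thesis unfolding hardy_littlewood_norm_def using q ennroot_leI[of _ 1 q] by simp
qed

lemma deriv_test_fun:
  assumes "norm z < 1"
  shows "deriv (test_fun c N) z = of_real (2 * c * real N) / (1 + of_nat N * (1 - z)) ^ 3"
proof (rule DERIV_imp_deriv)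
  have nz: "1 + of_nat N * (1 - z) \<noteq> 0" using assms by (intro test_denom_nonzero) auto
  have "(test_fun c N has_field_derivative
      - (of_real c * (2 * (1 + of_nat N * (1 - z)) * (- of_nat N))) / ((1 + of_nat N * (1 - z))\<^sup>2 * (1 + of_nat N * (1 - z))\<^sup>2)) (at z)"
    unfolding test_fun_def [abs_def] using nz by (auto intro!: derivative_eq_intros)
  also have "- (of_real c * (2 * (1 + of_nat N * (1 - z)) * (- of_nat N))) / ((1 + of_nat N * (1 - z))\<^sup>2 * (1 + of_nat N * (1 - z))\<^sup>2)
      = of_real (2 * c * real N) / (1 + of_nat N * (1 - z)) ^ 3"
  proof -
    have "- (C * (2 * d * (- n))) / (d\<^sup>2 * d\<^sup>2) = 2 * C * n / d ^ 3" if "d \<noteq> 0" for C d n :: complex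
      using that by (simp add: power2_eq_square power3_eq_cube mult_ac)
    from this[OF nz] show ?thesis by simp
  qed
  finally show "(test_fun c N has_field_derivative of_real (2 * c * real N) / (1 + of_nat N * (1 - z)) ^ 3) (at z)" .
qed

text \<open>A dyadic Riemann sum for the integral of 1 / (1 + N u)^2, compared with the telescoping
  differences of b k = 1 / (1 + A / 2^k), where A = N / 2.\<close>

lemma sum_inverse_square_dyadic_le:
  "(\<Sum>k<n. (1 / (1 + real N / 2 ^ Suc k)\<^sup>2) / 2 ^ k) \<le> 4 / real N"
proof -
  define A where "A = real N / 2"
  have A: "0 < A" using N by (simp add: A_def)
  define b where "b k = 1 / (1 + A / 2 ^ k)" for k :: nat
  have "(1 / (1 + real N / 2 ^ Suc k)\<^sup>2) / 2 ^ k \<le> 2 / A * (b (Suc k) - b k)" for k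
  proof -
    define y where "y = A / 2 ^ Suc k"
    have y: "0 < y" using A by (simp add: y_def)
    have e: "A / 2 ^ k = 2 * y" "real N / 2 ^ Suc k = 2 * y" "1 / 2 ^ k = 2 * y / A"
      using A by (simp_all add: y_def A_def)
    have "b (Suc k) - b k = y / ((1 + y) * (1 + 2 * y))"
      unfolding b_def e y_def[symmetric] using y by (simp add: divide_simps)
    also have "y / ((1 + y) * (1 + 2 * y)) \<ge> y / ((1 + 2 * y) * (1 + 2 * y))"
      using y by (intro divide_left_mono mult_right_mono mult_pos_pos) auto
    finally have "2 / A * (y / (1 + 2 * y)\<^sup>2) \<le> 2 / A * (b (Suc k) - b k)"
      using A by (intro mult_left_mono) (auto simp: power2_eq_square)
    moreover have "(1 / (1 + real N / 2 ^ Suc k)\<^sup>2) / 2 ^ k = 2 / A * (y / (1 + 2 * y)\<^sup>2)"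
    proof -
      have "(1 / (1 + real N / 2 ^ Suc k)\<^sup>2) / 2 ^ k = (1 / (1 + real N / 2 ^ Suc k)\<^sup>2) * (1 / 2 ^ k)" by simp
      then show ?thesis unfolding e by simp
    qed
    ultimately show ?thesis by simp
  qed
  then have "(\<Sum>k<n. (1 / (1 + real N / 2 ^ Suc k)\<^sup>2) / 2 ^ k) \<le> (\<Sum>k<n. 2 / A * (b (Suc k) - b k))"
    by (intro sum_mono)
  also have "\<dots> = 2 / A * (b n - b 0)"
    by (simp only: sum_distrib_left[symmetric] sum_lessThan_telescope)
  also have "\<dots> \<le> 2 / A * 1"
  proof (intro mult_left_mono)
    have "0 \<le> A / 2 ^ n" "0 \<le> A / 2 ^ 0" using A by auto
    moreover have "1 / (1 + e) \<le> 1" "0 \<le> 1 / (1 + e)" if "0 \<le> e" for e :: real using that by auto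
    ultimately have "b n \<le> 1" "0 \<le> b 0" unfolding b_def by blast+
    then show "b n - b 0 \<le> 1" by simp
  qed (use A in auto)
  finally show ?thesis by (simp add: A_def)
qed

text \<open>On the circle of radius r, one of the three factors in the denominator is replaced by
  its minimum ?D = 1 + N (1 - r); the other two are integrated by
  \<open>test_circle_integral\<close>. The resulting radial function is summed over annuli.\<close>

lemma test_disc_integral:
  "(\<integral>\<^sup>+z\<in>ball (0 :: complex) 1. ennreal (real N / norm (1 + of_nat N * (1 - z)) ^ 3) \<partial>lborel) \<le> ennreal (4 * pi / real N)"
proof -
  define H where "H = (\<lambda>z. ennreal (real N / norm (1 + of_nat N * (1 - z)) ^ 3) * indicator (ball 0 1) (z :: complex))"
  define V where "V r = (if r < 1 then ennreal (2 * pi / (1 + real N * (1 - r))\<^sup>2) else 0)" for r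
  have [measurable]: "H \<in> borel_measurable borel"
  proof -
    have "ball (0 :: complex) 1 \<in> sets borel" by simp
    then show ?thesis unfolding H_def by measurable
  qed
  have circ: "(\<integral>\<^sup>+\<theta>\<in>{0..2*pi}. H (of_real r * cis \<theta>) \<partial>lborel) \<le> V r" if r0: "0 \<le> r" for r
  proof (cases "r < 1")
    case False
    then have "H (of_real r * cis \<theta>) = 0" for \<theta> using r0 by (simp add: H_def norm_mult)
    then show ?thesis by simp
  next
    case True
    let ?d = "\<lambda>\<theta>. norm (1 + of_nat N * (1 - of_real r * cis \<theta>))"
    let ?D = "1 + real N * (1 - r)"
    have D: "0 < ?D" using True by (intro add_pos_nonneg) auto
    have dD: "?D \<le> ?d \<theta>" for \<theta> using r0 by (intro test_denom_ge) (simp add: norm_mult)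
    have si: "set_integrable lborel {0..2*pi} (\<lambda>\<theta>. real N / ?D * (1 / (?d \<theta>)\<^sup>2))"
      by (intro borel_integrable_atLeastAtMost' continuous_on_mult continuous_on_const test_circle_integral(1)[OF r0 True])
    have "(\<integral>\<^sup>+\<theta>\<in>{0..2*pi}. H (of_real r * cis \<theta>) \<partial>lborel)
        \<le> (\<integral>\<^sup>+\<theta>. ennreal (indicator {0..2*pi} \<theta> *\<^sub>R (real N / ?D * (1 / (?d \<theta>)\<^sup>2))) \<partial>lborel)"
    proof (rule nn_integral_mono)
      fix \<theta>
      have "real N / ?d \<theta> ^ 3 = real N / (?d \<theta> * (?d \<theta>)\<^sup>2)" by (simp add: power3_eq_cube power2_eq_square)
      also have "\<dots> \<le> real N / (?D * (?d \<theta>)\<^sup>2)"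
        using D dD[of \<theta>] by (intro divide_left_mono mult_right_mono mult_pos_pos zero_less_power) auto
      finally show "H (of_real r * cis \<theta>) * indicator {0..2*pi} \<theta>
          \<le> ennreal (indicator {0..2*pi} \<theta> *\<^sub>R (real N / ?D * (1 / (?d \<theta>)\<^sup>2)))"
        using r0 True by (auto simp: H_def indicator_def norm_mult intro!: ennreal_leI)
    qed
    also have "\<dots> = ennreal (LINT \<theta>:{0..2*pi}|lborel. real N / ?D * (1 / (?d \<theta>)\<^sup>2))"
      using si D unfolding set_integrable_def set_lebesgue_integral_def
      by (intro nn_integral_eq_integral) (auto intro!: AE_I2 mult_nonneg_nonneg)
    also have "\<dots> \<le> ennreal (real N / ?D * (2 * pi / (real N * ?D)))"
      unfolding set_integral_mult_right using D
      by (intro ennreal_leI mult_left_mono test_circle_integral(2)[OF r0 True]) auto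
    also have "real N / ?D * (2 * pi / (real N * ?D)) = 2 * pi / ?D\<^sup>2"
      using N by (simp add: power2_eq_square)
    finally show ?thesis using True by (simp add: V_def)
  qed
  have "ennreal (2 * pi) * (\<integral>\<^sup>+z. H z \<partial>lborel) \<le> (\<integral>\<^sup>+z. V (norm (z :: complex)) \<partial>lborel)"
    by (rule nn_integral_disc_le_radial[OF _ circ]) auto
  also have "\<dots> = (\<integral>\<^sup>+z\<in>ball 0 1. V (norm (z :: complex)) \<partial>lborel)"
    by (intro nn_integral_cong) (auto simp: V_def indicator_def)
  also have "\<dots> \<le> ennreal (pi * (2 * pi * (4 / real N)))"
  proof (rule nn_integral_disc_le_annuli)
    fix k and z :: complex assume z: "norm z \<in> dyadic_interval k"
    then have z1: "norm z < 1" using subsetD[OF dyadic_interval_subset] by force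
    have "real N * (1 / 2 ^ Suc k) \<le> real N * (1 - norm z)"
      using dyadic_interval_one_minus[OF z] by (intro mult_left_mono) auto
    then have "2 * pi / (1 + real N * (1 - norm z))\<^sup>2 \<le> 2 * pi / (1 + real N / 2 ^ Suc k)\<^sup>2"
      using N z1 by (intro divide_left_mono power_mono mult_pos_pos zero_less_power add_pos_nonneg) auto
    then show "V (norm z) \<le> ennreal (2 * pi * (1 / (1 + real N / 2 ^ Suc k)\<^sup>2))"
      using z1 by (simp add: V_def ennreal_leI)
  next
    fix n
    have "(\<Sum>k<n. 2 * pi * (1 / (1 + real N / 2 ^ Suc k)\<^sup>2) / 2 ^ k)
        = 2 * pi * (\<Sum>k<n. (1 / (1 + real N / 2 ^ Suc k)\<^sup>2) / 2 ^ k)"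
      unfolding sum_distrib_left by (intro sum.cong) auto
    also have "\<dots> \<le> 2 * pi * (4 / real N)"
      by (intro mult_left_mono sum_inverse_square_dyadic_le) auto
    finally show "(\<Sum>k<n. 2 * pi * (1 / (1 + real N / 2 ^ Suc k)\<^sup>2) / 2 ^ k) \<le> 2 * pi * (4 / real N)" .
  qed auto
  also have "\<dots> = ennreal (2 * pi) * ennreal (4 * pi / real N)"
    by (simp add: ennreal_mult[symmetric] mult_ac)
  finally have "(\<integral>\<^sup>+z. H z \<partial>lborel) \<le> ennreal (4 * pi / real N)"
    by (subst (asm) ennreal_mult_le_mult_iff) auto
  then show ?thesis by (simp add: H_def)
qed

text \<open>Writing |f'|^q (1 - |z|)^(q-1) as |f'| times the (q-1)-th power of |f'| (1 - |z|), which
  is at most 2 c, reduces the integral to that of |f'| itself.\<close>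

lemma dirichlet_norm_test_fun_le:
  assumes q: "1 \<le> q" and cq: "(1 + 4 * 2 powr q) * c powr q \<le> real N"
  shows "dirichlet_norm q (test_fun c N) \<le> 1"
proof -
  have f0: "norm (test_fun c N 0) powr q \<le> c powr q / real N"
  proof -
    have "norm (test_fun c N 0) powr q \<le> c powr q / (norm (1 + of_nat N * (1 - 0) :: complex))\<^sup>2"
      by (rule norm_test_fun_powr_le[OF q]) simp
    also have "norm (1 + of_nat N * (1 - 0) :: complex) = 1 + real N"
      by (simp flip: of_nat_Suc)
    also have "c powr q / (1 + real N)\<^sup>2 \<le> c powr q / real N"
    proof -
      have "real N * 1 \<le> (1 + real N) * (1 + real N)" by (intro mult_mono) auto
      then show ?thesis using N by (intro divide_left_mono mult_pos_pos) (auto simp: power2_eq_square)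
    qed
    finally show ?thesis .
  qed
  have pt: "norm (deriv (test_fun c N) z) powr q * (1 - norm z) powr (q - 1) / pi
      \<le> (2 * c) powr q / pi * (real N / norm (1 + of_nat N * (1 - z)) ^ 3)" if z: "norm z < 1" for z
  proof -
    define d where "d = norm (1 + of_nat N * (1 - z))"
    have d: "1 \<le> d" unfolding d_def using z by (intro test_denom_ge_1) auto
    define D where "D = norm (deriv (test_fun c N) z)"
    have D: "D = 2 * c * real N / d ^ 3"
      unfolding D_def deriv_test_fun[OF z] d_def using c by (simp add: norm_divide norm_mult norm_power)
    have "D * (1 - norm z) \<le> 2 * c"
    proof -
      have "real N * (1 - norm z) \<le> d" using test_denom_ge[of z "norm z"] by (simp add: d_def)
      then have "real N * (1 - norm z) \<le> d * d ^ 2" using d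
        by (intro order_trans[OF _ mult_left_mono[of 1 "d ^ 2" d]]) (auto simp: one_le_power)
      then have "2 * c * (real N * (1 - norm z)) \<le> 2 * c * (d * d ^ 2)"
        using c by (intro mult_left_mono) auto
      then show ?thesis unfolding D using d by (simp add: divide_simps power3_eq_cube power2_eq_square mult_ac)
    qed
    then have "(D * (1 - norm z)) powr (q - 1) \<le> (2 * c) powr (q - 1)"
      using q z by (intro powr_mono2) (auto simp: D_def)
    then have "D * (D * (1 - norm z)) powr (q - 1) \<le> D * (2 * c) powr (q - 1)"
      by (rule mult_left_mono) (simp add: D_def)
    moreover have "D * (D * (1 - norm z)) powr (q - 1) = D powr q * (1 - norm z) powr (q - 1)"
      using z by (cases "D = 0") (auto simp: D_def powr_mult powr_diff)
    moreover have "D * (2 * c) powr (q - 1) = (2 * c) powr q * (real N / d ^ 3)"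
      unfolding D using c by (simp add: powr_diff)
    ultimately have "D powr q * (1 - norm z) powr (q - 1) \<le> (2 * c) powr q * (real N / d ^ 3)" by simp
    then have "D powr q * (1 - norm z) powr (q - 1) / pi \<le> (2 * c) powr q * (real N / d ^ 3) / pi"
      by (rule divide_right_mono) simp
    then show ?thesis by (simp add: D_def d_def mult.commute[of pi])
  qed
  have "(\<integral>\<^sup>+z\<in>ball 0 1. ennreal (norm (deriv (test_fun c N) z) powr q * (1 - norm z) powr (q - 1) / pi) \<partial>lborel)
      \<le> (\<integral>\<^sup>+z. ennreal ((2 * c) powr q / pi) * (ennreal (real N / norm (1 + of_nat N * (1 - z)) ^ 3) * indicator (ball (0 :: complex) 1) z) \<partial>lborel)"
    using pt by (intro nn_integral_mono) (auto simp: indicator_def ennreal_mult[symmetric] intro!: ennreal_leI)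
  also have "\<dots> = ennreal ((2 * c) powr q / pi) * (\<integral>\<^sup>+z\<in>ball (0 :: complex) 1. ennreal (real N / norm (1 + of_nat N * (1 - z)) ^ 3) \<partial>lborel)"
  proof (rule nn_integral_cmult)
    have "ball (0 :: complex) 1 \<in> sets borel" by simp
    then show "(\<lambda>z :: complex. ennreal (real N / norm (1 + of_nat N * (1 - z)) ^ 3) * indicator (ball 0 1) z) \<in> borel_measurable lborel"
      by measurable
  qed
  also have "\<dots> \<le> ennreal ((2 * c) powr q / pi) * ennreal (4 * pi / real N)"
    by (intro mult_left_mono test_disc_integral) auto
  also have "\<dots> = ennreal (4 * 2 powr q * c powr q / real N)"
    using c by (simp add: ennreal_mult[symmetric] powr_mult mult_ac)
  finally have "ennreal (norm (test_fun c N 0) powr q) +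
      (\<integral>\<^sup>+z\<in>ball 0 1. ennreal (norm (deriv (test_fun c N) z) powr q * (1 - norm z) powr (q - 1) / pi) \<partial>lborel)
    \<le> ennreal (c powr q / real N) + ennreal (4 * 2 powr q * c powr q / real N)"
    using f0 by (intro add_mono ennreal_leI)
  also have "\<dots> = ennreal ((1 + 4 * 2 powr q) * c powr q / real N)"
    by (simp add: ennreal_plus[symmetric] algebra_simps add_divide_distrib del: ennreal_plus)
  also have "\<dots> \<le> ennreal (1 powr q)" using cq N by (intro ennreal_leI) simp
  finally show ?thesis unfolding dirichlet_norm_def using q ennroot_leI[of _ 1 q] by simp
qed

end

lemma space_norm_test_fun:
  assumes X: "X \<in> space_norms q" and q: "1 \<le> q"
  obtains \<kappa> where "0 < \<kappa>" "\<And>N. 1 \<le> N \<Longrightarrow> X (test_fun (\<kappa> * real N powr (1 / q)) N) \<le> 1"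
proof -
  \<comment> \<open>M dominates the constants 1, 4 powr (q - 1) and 1 + 4 * 2 powr q demanded by the
    norm estimates, and \<kappa> is chosen to make the q-th power of the coefficient equal to N /
    M.\<close>
  define M where "M = 1 + 4 * 2 powr q + 4 powr (q - 1)"
  have M: "1 \<le> M" "4 powr (q - 1) \<le> M" "1 + 4 * 2 powr q \<le> M" "0 < M"
    by (simp_all add: M_def add_pos_nonneg)
  define \<kappa> where "\<kappa> = (1 / M) powr (1 / q)"
  have \<kappa>: "0 < \<kappa>" using M by (simp add: \<kappa>_def)
  have "X (test_fun (\<kappa> * real N powr (1 / q)) N) \<le> 1" if N: "1 \<le> N" for N
  proof -
    let ?c = "\<kappa> * real N powr (1 / q)"
    have c: "0 < ?c" using \<kappa> N by simp
    have cq: "?c powr q = real N / M"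
      using q M N \<kappa> by (simp add: \<kappa>_def powr_mult powr_powr)
    have A: "A * ?c powr q \<le> real N" if "A \<le> M" for A
    proof -
      have "A * (real N / M) \<le> M * (real N / M)" using that M by (intro mult_right_mono) auto
      then show ?thesis unfolding cq using M by simp
    qed
    have "?c powr q \<le> real N" using A[of 1] M by simp
    note all = mixed_norm_test_fun_le[OF N c q this] hardy_norm_test_fun_le[OF N c q this]
      hardy_littlewood_norm_test_fun_le[OF N c q A[OF M(2)]] dirichlet_norm_test_fun_le[OF N c q A[OF M(3)]]
    from X show ?thesis unfolding space_norms_def using all by (elim insertE emptyE) simp_all
  qed
  with \<kappa> that show ?thesis by blast
qed

section \<open>Norm bounds from derivative bounds\<close>

locale derivative_bound =
  fixes p M L :: real
  assumes p: "1 < p" and M: "0 \<le> M" and L: "0 \<le> L"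
begin

text \<open>The coefficient condition is listed separately because integrating 1 / |1 - z| over a
  circle, as Cauchy's estimate would require, produces a logarithmic factor.\<close>

definition admissible :: "(complex \<Rightarrow> complex) \<Rightarrow> (nat \<Rightarrow> real) \<Rightarrow> bool" where
  "admissible F \<Phi> \<longleftrightarrow> F holomorphic_on ball 0 1 \<and> norm (F 0) \<le> M \<and> (\<forall>j. 0 \<le> \<Phi> j) \<and>
    (\<forall>j z. norm z \<le> 1 - 1 / 2 ^ Suc j \<longrightarrow> norm (deriv F z) * norm (1 - z) \<le> \<Phi> j) \<and>
    (\<forall>j n. n + 1 < 2 ^ Suc j \<longrightarrow> (real n + 1) * norm (taylor_coeff F (Suc n)) \<le> \<Phi> j) \<and>
    (\<forall>n. (\<Sum>j<n. \<Phi> j powr p / 2 ^ j) \<le> L)"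

definition s :: real where "s = 2 powr (1 / p)"

text \<open>Two rates of decay occur: 1 / s for scales coarser than the target, and s / 2 for finer
  ones, where the distance of the ray to the point 1 stops shrinking.\<close>

definition \<eta> :: real where "\<eta> = max (1 / s) (s / 2)"

lemma s_bounds: "1 < s" "s < 2"
proof -
  show "1 < s" using p root2_bounds[of p] by (simp add: s_def)
  have "2 powr (1 / p) < (2 powr 1 :: real)" using p by (intro powr_less_mono) auto
  then show "s < 2" by (simp add: s_def)
qed

lemma \<eta>_bounds: "0 \<le> \<eta>" "\<eta> < 1" "1 / s \<le> \<eta>" "s / 2 \<le> \<eta>"
  using s_bounds by (auto simp: \<eta>_def)

lemma one_le_s_\<eta>_power: "1 \<le> s ^ m * \<eta> ^ m"
proof -
  have "1 \<le> s * \<eta>" using \<eta>_bounds(3) s_bounds by (simp add: field_simps)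
  then show ?thesis using one_le_power[of "s * \<eta>" m] by (simp add: power_mult_distrib)
qed

lemma s_powr: "(s ^ k) powr p = 2 ^ k"
  using p root2_powr[of p k] by (simp add: s_def)

context
  fixes F \<Phi>
  assumes adm: "admissible F \<Phi>"
begin

lemma F_hol: "F holomorphic_on ball 0 1" and F0: "norm (F 0) \<le> M" and \<Phi>0: "0 \<le> \<Phi> j"
  and F_deriv: "norm z \<le> 1 - 1 / 2 ^ Suc j \<Longrightarrow> norm (deriv F z) * norm (1 - z) \<le> \<Phi> j"
  and F_coeff: "n + 1 < 2 ^ Suc j \<Longrightarrow> (real n + 1) * norm (taylor_coeff F (Suc n)) \<le> \<Phi> j"
  and \<Phi>L: "(\<Sum>j<n. \<Phi> j powr p / 2 ^ j) \<le> L"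
  using adm by (auto simp: admissible_def)

definition x :: "nat \<Rightarrow> real" where "x i = \<Phi> i / s ^ i + (if i = 0 then M else 0)"

definition S :: "nat \<Rightarrow> real" where "S j = (\<Sum>i. \<eta> ^ (j - i + (i - j)) * x i)"

lemma x_nonneg: "0 \<le> x i"
  using \<Phi>0[of i] s_bounds M by (simp add: x_def)

lemma x_sum: "(\<Sum>i<n. x i powr p) \<le> 2 powr p * (L + M powr p)"
proof -
  have "x i powr p \<le> 2 powr p * (\<Phi> i powr p / 2 ^ i + (if i = 0 then M powr p else 0))" for i
  proof -
    have "(\<Phi> i / s ^ i) powr p = \<Phi> i powr p / 2 ^ i"
      using \<Phi>0[of i] s_bounds by (simp add: powr_divide s_powr)
    then show ?thesis
      using powr_add_le[of "\<Phi> i / s ^ i" "if i = 0 then M else 0" p] \<Phi>0[of i] s_bounds p M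
      by (auto simp: x_def split: if_splits)
  qed
  then have "(\<Sum>i<n. x i powr p) \<le> (\<Sum>i<n. 2 powr p * (\<Phi> i powr p / 2 ^ i + (if i = 0 then M powr p else 0)))"
    by (intro sum_mono)
  also have "\<dots> = 2 powr p * ((\<Sum>i<n. \<Phi> i powr p / 2 ^ i) + (\<Sum>i<n. if i = 0 then M powr p else 0))"
    by (simp only: sum_distrib_left[symmetric] sum.distrib)
  also have "\<dots> \<le> 2 powr p * (L + M powr p)"
  proof (intro mult_left_mono add_mono \<Phi>L)
    show "(\<Sum>i<n. if i = 0 then M powr p else 0) \<le> M powr p" by (simp add: sum.delta)
  qed auto
  finally show ?thesis .
qed

lemma S_facts: "0 \<le> S j" "(\<Sum>i\<le>k. \<eta> ^ (j - i + (i - j)) * x i) \<le> S j"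
  "(\<Sum>j<n. S j powr p) \<le> (2 / (1 - \<eta>)) powr p * (2 powr p * (L + M powr p))"
proof -
  have p1: "1 \<le> p" using p by simp
  note sch = schur_dyadic[OF \<eta>_bounds(1,2) p1 x_nonneg x_sum]
  show "0 \<le> S j" unfolding S_def using \<eta>_bounds x_nonneg by (intro suminf_nonneg sch(1)) auto
  show "(\<Sum>i\<le>k. \<eta> ^ (j - i + (i - j)) * x i) \<le> S j"
    unfolding S_def using \<eta>_bounds x_nonneg by (intro sum_le_suminf sch(1)) auto
  show "(\<Sum>j<n. S j powr p) \<le> (2 / (1 - \<eta>)) powr p * (2 powr p * (L + M powr p))"
    unfolding S_def by (rule sch(2))
qed

text \<open>One summation for two purposes. The maximum mean uses d = 1 and the target l = j; the
  Hardy norm uses the index l of the arc containing \<theta> and a factor d that decays beyond l, so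
  that the bound becomes independent of j. The term M for F 0 fits in since s \<eta> \<ge>
  1.\<close>

lemma ray_bound:
  assumes c: "\<And>i \<rho>. 1 - 1 / 2 ^ i \<le> \<rho> \<Longrightarrow> \<rho> \<le> 1 - 1 / 2 ^ Suc i \<Longrightarrow> norm (deriv F (of_real \<rho> * cis \<theta>)) \<le> 2 ^ Suc i * (d i * \<Phi> i)"
    and d: "\<And>i. i \<le> j \<Longrightarrow> d i * s ^ i \<le> A * (s ^ l * \<eta> ^ (l - i + (i - l)))" and A: "1 \<le> A"
    and r: "r \<in> dyadic_interval j"
  shows "norm (F (of_real r * cis \<theta>)) \<le> A * (s ^ l * S l)"
proof -
  have "norm (F (of_real r * cis \<theta>)) \<le> norm (F 0) + (\<Sum>i\<le>j. 2 ^ Suc i * (d i * \<Phi> i) / 2 ^ Suc i)"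
    by (rule ray_growth[OF F_hol c r])
  also have "\<dots> = norm (F 0) + (\<Sum>i\<le>j. d i * \<Phi> i)" by simp
  also have "\<dots> \<le> (\<Sum>i\<le>j. d i * \<Phi> i + (if i = 0 then M else 0))"
    using F0 by (simp add: sum.distrib sum.delta)
  also have "\<dots> \<le> (\<Sum>i\<le>j. A * (s ^ l * (\<eta> ^ (l - i + (i - l)) * x i)))"
  proof (rule sum_mono)
    fix i assume i: "i \<in> {..j}"
    have "d i * \<Phi> i = d i * s ^ i * (\<Phi> i / s ^ i)" using s_bounds by simp
    also have "\<dots> \<le> A * (s ^ l * \<eta> ^ (l - i + (i - l))) * (\<Phi> i / s ^ i)"
      using d[of i] i \<Phi>0[of i] s_bounds by (intro mult_right_mono) auto
    finally have 1: "d i * \<Phi> i \<le> A * (s ^ l * \<eta> ^ (l - i + (i - l))) * (\<Phi> i / s ^ i)" .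
    have "M \<le> A * (s ^ l * \<eta> ^ l) * M"
    proof -
      have "1 \<le> s ^ l * \<eta> ^ l" by (rule one_le_s_\<eta>_power)
      then have "1 * 1 \<le> A * (s ^ l * \<eta> ^ l)" using A by (intro mult_mono) auto
      then show ?thesis using M mult_right_mono[of 1 "A * (s ^ l * \<eta> ^ l)" M] by simp
    qed
    then have 2: "(if i = 0 then M else 0) \<le> A * (s ^ l * \<eta> ^ (l - i + (i - l))) * (if i = 0 then M else 0)"
      by auto
    have "A * (s ^ l * (\<eta> ^ (l - i + (i - l)) * x i))
      = A * (s ^ l * \<eta> ^ (l - i + (i - l))) * (\<Phi> i / s ^ i) + A * (s ^ l * \<eta> ^ (l - i + (i - l))) * (if i = 0 then M else 0)"
      by (simp add: x_def distrib_left mult.assoc)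
    then show "d i * \<Phi> i + (if i = 0 then M else 0) \<le> A * (s ^ l * (\<eta> ^ (l - i + (i - l)) * x i))"
      using 1 2 by linarith
  qed
  also have "\<dots> = A * (s ^ l * (\<Sum>i\<le>j. \<eta> ^ (l - i + (i - l)) * x i))" by (simp only: sum_distrib_left)
  also have "\<dots> \<le> A * (s ^ l * S l)"
    using A s_bounds S_facts(2) by (intro mult_left_mono) auto
  finally show ?thesis .
qed

lemma deriv_radial_bound:
  assumes \<rho>: "1 - 1 / 2 ^ i \<le> \<rho>" "\<rho> \<le> 1 - 1 / 2 ^ Suc i"
  shows "norm (deriv F (of_real \<rho> * cis \<theta>)) \<le> 2 ^ Suc i * (1 * \<Phi> i)"
proof -
  have "0 \<le> \<rho>" using \<rho>(1) one_le_power[of "2::real" i] by (simp add: order_trans[rotated])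
  then have n: "norm (of_real \<rho> * cis \<theta>) = \<rho>" by (simp add: norm_mult)
  have "1 / 2 ^ Suc i \<le> norm (1 - of_real \<rho> * cis \<theta>)"
    using norm_one_minus_ge[of "of_real \<rho> * cis \<theta>"] \<rho> n by linarith
  then have "norm (deriv F (of_real \<rho> * cis \<theta>)) * (1 / 2 ^ Suc i) \<le> norm (deriv F (of_real \<rho> * cis \<theta>)) * norm (1 - of_real \<rho> * cis \<theta>)"
    by (rule mult_left_mono) simp
  also have "\<dots> \<le> \<Phi> i" using \<rho> n by (intro F_deriv) simp
  finally show ?thesis by (simp add: field_simps)
qed

lemma mixed_norm_le:
  "mixed_norm_infinity p F \<le> ennreal (((2 / (1 - \<eta>)) powr p * (2 powr p * (L + M powr p))) powr (1 / p))"
proof -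
  let ?K = "(2 / (1 - \<eta>)) powr p * (2 powr p * (L + M powr p))"
  have "(\<integral>\<^sup>+r\<in>{0..<1}. ennreal (max_mean r F powr p) \<partial>lborel) \<le> (\<Sum>j. ennreal ((s ^ j * S j) powr p) * emeasure lborel (dyadic_interval j))"
    unfolding UN_dyadic_interval[symmetric]
  proof (rule set_nn_integral_UN_le)
    fix j r assume r: "r \<in> dyadic_interval j"
    then have r01: "0 \<le> r" "r < 1" using subsetD[OF dyadic_interval_subset] by force+
    have "norm (F (of_real r * cis \<theta>)) \<le> 1 * (s ^ j * S j)" for \<theta>
    proof (rule ray_bound[OF deriv_radial_bound _ _ r])
      fix i assume "i \<le> j"
      then have e: "s ^ j = s ^ i * s ^ (j - i)" by (simp flip: power_add)
      have "1 \<le> s ^ (j - i) * \<eta> ^ (j - i)" by (rule one_le_s_\<eta>_power)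
      then have "s ^ i * 1 \<le> s ^ i * (s ^ (j - i) * \<eta> ^ (j - i))" using s_bounds by (intro mult_left_mono) auto
      then show "1 * s ^ i \<le> 1 * (s ^ j * \<eta> ^ (j - i + (i - j)))" using \<open>i \<le> j\<close> by (simp add: e mult.assoc)
    qed simp_all
    then have "max_mean r F \<le> s ^ j * S j" by (intro max_mean_le) simp
    moreover have "0 \<le> max_mean r F"
      by (rule order_trans[OF norm_ge_zero max_mean_ge[OF F_hol, of r 0]]) (use r01 in auto)
    ultimately show "ennreal (max_mean r F powr p) \<le> ennreal ((s ^ j * S j) powr p)"
      using p by (intro ennreal_leI powr_mono2) auto
  qed simp
  also have "\<dots> \<le> (\<Sum>j. ennreal (S j powr p))"
  proof (intro suminf_le)
    fix j
    have "emeasure lborel (dyadic_interval j) = ennreal (1 / 2 ^ Suc j)"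
      by (simp add: dyadic_interval_def power_one_over field_simps)
    then have "ennreal ((s ^ j * S j) powr p) * emeasure lborel (dyadic_interval j) = ennreal (S j powr p / 2)"
      using S_facts(1)[of j] s_bounds by (simp add: powr_mult s_powr ennreal_mult[symmetric])
    also have "\<dots> \<le> ennreal (S j powr p)" by (intro ennreal_leI) simp
    finally show "ennreal ((s ^ j * S j) powr p) * emeasure lborel (dyadic_interval j) \<le> ennreal (S j powr p)" .
  qed auto
  also have "\<dots> \<le> ennreal ?K" by (intro suminf_ennreal_le S_facts(3)) auto
  also have "?K = (?K powr (1 / p)) powr p" using p L by (simp add: powr_powr)
  finally show ?thesis unfolding mixed_norm_infinity_def using p by (intro ennroot_leI) auto
qed

text \<open>On a ray in arc l, the distance |1 - z| is at least about 1 / 2^i up to scale l and at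
  least about 1 / 2^l afterwards. The finer pieces then sum geometrically, and on arc l, of measure
  about 1 / 2^l, F is bounded by 2 s^l S l uniformly in r.\<close>

lemma hardy_norm_le:
  "hardy_norm p F \<le> ennreal ((2 powr (p + 1) * ((2 / (1 - \<eta>)) powr p * (2 powr p * (L + M powr p)))) powr (1 / p))"
proof -
  let ?K = "(2 / (1 - \<eta>)) powr p * (2 powr p * (L + M powr p))"
  have "integral_mean p r F \<le> (2 powr (p + 1) * ?K) powr (1 / p)" if r01: "0 < r" "r < 1" for r
  proof -
    let ?u = "\<lambda>\<theta>. norm (F (of_real r * cis \<theta>)) powr p"
    have "r \<in> (\<Union>k. dyadic_interval k)" unfolding UN_dyadic_interval using r01 by simp
    then obtain j where r: "r \<in> dyadic_interval j" by blast
    have uc: "continuous_on {0..2*pi} ?u"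
      using p by (intro continuous_on_powr' continuous_intros dilation(4)[OF F_hol r01]) auto
    have ui: "set_integrable lborel {0..2*pi} ?u" by (rule borel_integrable_atLeastAtMost'[OF uc])
    have arc: "norm (F (of_real r * cis \<theta>)) \<le> 2 * (s ^ l * S l)" if \<theta>: "\<theta> \<in> dyadic_arc l" for l \<theta>
    proof (rule ray_bound[OF _ _ _ r])
      \<comment> \<open>For i > l the arc gives |F'| \<le> 4 * 2^l * \<Phi> i, which is 2 ^ Suc i
        times this factor times \<Phi> i.\<close>
      let ?d = "\<lambda>i. if i \<le> l then 1 else 2 * (2 ^ l / 2 ^ i) :: real"
      show "norm (deriv F (of_real \<rho> * cis \<theta>)) \<le> 2 ^ Suc i * (?d i * \<Phi> i)"
        if \<rho>: "1 - 1 / 2 ^ i \<le> \<rho>" "\<rho> \<le> 1 - 1 / 2 ^ Suc i" for i \<rho>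
      proof (cases "i \<le> l")
        case True
        then show ?thesis using deriv_radial_bound[OF \<rho>] by simp
      next
        case False
        have \<rho>0: "0 \<le> \<rho>" using \<rho>(1) one_le_power[of "2::real" i] by (simp add: order_trans[rotated])
        have "norm (deriv F (of_real \<rho> * cis \<theta>)) * (1 / (4 * 2 ^ l)) \<le> norm (deriv F (of_real \<rho> * cis \<theta>)) * norm (1 - of_real \<rho> * cis \<theta>)"
          by (intro mult_left_mono norm_one_minus_cis_ge_arc[OF \<theta> \<rho>0]) simp
        also have "\<dots> \<le> \<Phi> i" using \<rho> \<rho>0 by (intro F_deriv) (simp add: norm_mult)
        finally show ?thesis using False by (simp add: field_simps)
      qed
      show "?d i * s ^ i \<le> 2 * (s ^ l * \<eta> ^ (l - i + (i - l)))" for i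
      proof (cases "i \<le> l")
        case True
        then have e: "s ^ l = s ^ i * s ^ (l - i)" by (simp flip: power_add)
        have "1 \<le> s ^ (l - i) * \<eta> ^ (l - i)" by (rule one_le_s_\<eta>_power)
        then have "s ^ i * 1 \<le> s ^ i * (s ^ (l - i) * \<eta> ^ (l - i))" using s_bounds by (intro mult_left_mono) auto
        moreover have "0 < s ^ i" using s_bounds by simp
        ultimately have "s ^ i \<le> 2 * (s ^ i * (s ^ (l - i) * \<eta> ^ (l - i)))" by linarith
        then show ?thesis using True by (simp add: e mult.assoc)
      next
        case False
        then obtain m where m: "i = l + m" by (metis le_add_diff_inverse nat_le_linear)
        have "s ^ l * (s / 2) ^ m \<le> s ^ l * \<eta> ^ m"
          using \<eta>_bounds(4) s_bounds by (intro mult_left_mono power_mono) auto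
        then show ?thesis using False by (simp add: m power_add power_divide mult_ac)
      qed
    qed simp
    have "ennreal (LINT \<theta>:{0..2*pi}|lborel. ?u \<theta>) = (\<integral>\<^sup>+\<theta>. ennreal (indicator {0..2*pi} \<theta> *\<^sub>R ?u \<theta>) \<partial>lborel)"
      using ui unfolding set_integrable_def set_lebesgue_integral_def
      by (intro nn_integral_eq_integral[symmetric]) auto
    also have "\<dots> = (\<integral>\<^sup>+\<theta>\<in>{0..2*pi}. ennreal (?u \<theta>) \<partial>lborel)"
      by (intro nn_integral_cong) (auto simp: indicator_def)
    also have "\<dots> \<le> ennreal (2 * pi * (2 powr p * ?K))"
    proof (rule nn_integral_circle_le)
      show "ennreal (?u \<theta>) \<le> ennreal ((2 * (s ^ l * S l)) powr p)" if "\<theta> \<in> dyadic_arc l" for l \<theta>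
        using p arc[OF that] by (intro ennreal_leI powr_mono2) auto
      fix n
      have "(\<Sum>l<n. (2 * (s ^ l * S l)) powr p / 2 ^ l) = 2 powr p * (\<Sum>l<n. S l powr p)"
        using S_facts(1) s_bounds by (simp add: powr_mult s_powr sum_distrib_left)
      also have "\<dots> \<le> 2 powr p * ?K" by (intro mult_left_mono S_facts(3)) auto
      finally show "(\<Sum>l<n. (2 * (s ^ l * S l)) powr p / 2 ^ l) \<le> 2 powr p * ?K" .
    qed auto
    finally have "(LINT \<theta>:{0..2*pi}|lborel. ?u \<theta>) \<le> 2 * pi * (2 powr p * ?K)"
      by (rule iffD1[OF ennreal_le_iff, rotated]) (use L in auto)
    also have "\<dots> \<le> 2 * pi * (2 powr (p + 1) * ?K)"
      using L by (intro mult_left_mono mult_right_mono powr_mono) auto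
    finally have "(LINT \<theta>:{0..2*pi}|lborel. ?u \<theta>) / (2 * pi) \<le> 2 powr (p + 1) * ?K"
      by (simp add: divide_le_eq mult.commute)
    moreover have "0 \<le> (LINT \<theta>:{0..2*pi}|lborel. ?u \<theta>)"
      unfolding set_lebesgue_integral_def by (intro Bochner_Integration.integral_nonneg) auto
    ultimately show ?thesis
      unfolding integral_mean_def using p by (intro powr_mono2) auto
  qed
  then show ?thesis unfolding hardy_norm_def by (intro SUP_least ennreal_leI) auto
qed

text \<open>In block j the coefficient bound gives (n + 1) |a_n| \<le> 2 \<Phi> j, so each of the
  2^j terms is at most (2 \<Phi> j)^p / 4^j. Block 0 contains only the constant term, controlled by
  M.\<close>

lemma hardy_littlewood_norm_le:
  "hardy_littlewood_norm p F \<le> ennreal ((M powr p + 2 powr p * L) powr (1 / p))"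
proof -
  let ?c = "\<lambda>n. norm (taylor_coeff F n) powr p * (real n + 1) powr (p - 2)"
  have block: "(\<Sum>n = 2 ^ j - 1..<2 ^ Suc j - 1. ?c n) \<le> (if j = 0 then M powr p else 0) + 2 powr p * (\<Phi> j powr p / 2 ^ j)" for j
  proof (cases "j = 0")
    case True
    have "norm (taylor_coeff F 0) powr p \<le> M powr p"
      using F0 p by (intro powr_mono2) (auto simp: taylor_coeff_def)
    moreover have "{2 ^ j - 1..<2 ^ Suc j - 1 :: nat} = {0}" using True by auto
    moreover have "0 \<le> 2 powr p * (\<Phi> j powr p / 2 ^ j)" by simp
    ultimately show ?thesis using True by (simp add: add_increasing2)
  next
    case False
    have "(\<Sum>n = 2 ^ j - 1..<2 ^ Suc j - 1. ?c n) \<le> (\<Sum>n = 2 ^ j - 1..<2 ^ Suc j - 1 :: nat. (2 * \<Phi> j) powr p / (2 ^ j)\<^sup>2)"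
    proof (rule sum_mono)
      fix n :: nat assume n: "n \<in> {2 ^ j - 1..<2 ^ Suc j - 1}"
      have "2 ^ 1 \<le> (2 ^ j :: nat)" using False by (intro power_increasing) auto
      then obtain m where m: "n = Suc m" using n by (cases n) auto
      have "n + 1 < 2 ^ Suc j + 1" "2 ^ j \<le> n + 1" using n by auto
      then have "2 ^ j \<le> real n + 1" by (simp flip: of_nat_le_iff[where 'a = real])
      have "(real m + 1) * norm (taylor_coeff F (Suc m)) \<le> \<Phi> j"
        using n m by (intro F_coeff) auto
      \<comment> \<open>\<open>F_coeff\<close> pairs the coefficient of index Suc m with m + 1;
        raising this to n + 1 = m + 2 costs the factor 2.\<close>
      moreover have "(real n + 1) * norm (taylor_coeff F n) \<le> 2 * ((real m + 1) * norm (taylor_coeff F (Suc m)))"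
        unfolding m mult.assoc[symmetric] by (intro mult_right_mono) auto
      ultimately have "(real n + 1) * norm (taylor_coeff F n) \<le> 2 * \<Phi> j" by linarith
      then have "((real n + 1) * norm (taylor_coeff F n)) powr p \<le> (2 * \<Phi> j) powr p"
        using p by (intro powr_mono2) auto
      moreover have "?c n = ((real n + 1) * norm (taylor_coeff F n)) powr p / (real n + 1)\<^sup>2"
        by (simp add: powr_mult powr_diff)
      moreover have "(2 ^ j)\<^sup>2 \<le> (real n + 1)\<^sup>2" using \<open>2 ^ j \<le> real n + 1\<close> by (intro power_mono) auto
      ultimately show "?c n \<le> (2 * \<Phi> j) powr p / (2 ^ j)\<^sup>2"
        by (simp only:) (intro frac_le; simp)
    qed
    also have "\<dots> = 2 powr p * (\<Phi> j powr p / 2 ^ j)"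
      using \<Phi>0[of j] by (simp add: powr_mult power2_eq_square)
    finally show ?thesis using False by simp
  qed
  have "(\<Sum>n. ennreal (?c n)) \<le> ennreal (M powr p + 2 powr p * L)"
  proof (rule suminf_ennreal_le)
    fix N
    have "N \<le> 2 ^ N - 1" using less_exp[of N] by linarith
    then have "(\<Sum>n<N. ?c n) \<le> (\<Sum>n<2 ^ N - 1. ?c n)" by (intro sum_mono2) auto
    also have "\<dots> \<le> (\<Sum>j<N. (if j = 0 then M powr p else 0) + 2 powr p * (\<Phi> j powr p / 2 ^ j))"
      unfolding sum_dyadic_blocks by (intro sum_mono block)
    also have "\<dots> = (\<Sum>j<N. if j = 0 then M powr p else 0) + 2 powr p * (\<Sum>j<N. \<Phi> j powr p / 2 ^ j)"
      by (simp only: sum_distrib_left sum.distrib)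
    also have "\<dots> \<le> M powr p + 2 powr p * L"
    proof (intro add_mono mult_left_mono \<Phi>L)
      show "(\<Sum>j<N. if j = 0 then M powr p else 0) \<le> M powr p" by (simp add: sum.delta)
    qed auto
    finally show "(\<Sum>n<N. ?c n) \<le> M powr p + 2 powr p * L" .
  qed auto
  also have "M powr p + 2 powr p * L = ((M powr p + 2 powr p * L) powr (1 / p)) powr p"
    using p L by (simp add: powr_powr)
  finally show ?thesis unfolding hardy_littlewood_norm_def using p by (intro ennroot_leI) auto
qed

text \<open>Arc i contributes about 2^(i(p-1)) up to i = k and 2^(kp) / 2^i afterwards. For p > 1
  both sides decrease geometrically away from i = k, with ratios 2 powr (1 - p) and 1/2, so the
  value 2^(k(p-1)) at i = k dominates.\<close>

lemma circle_integral_inverse_powr_le: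
  assumes r: "r \<in> dyadic_interval k"
  shows "(\<integral>\<^sup>+\<theta>\<in>{0..2*pi}. ennreal (1 / norm (1 - of_real r * cis \<theta>) powr p) \<partial>lborel)
    \<le> ennreal (2 * pi * (4 powr p * (2 ^ k) powr (p - 1) * (2 / (1 - max (2 powr (1 - p)) (1 / 2)))))"
proof (rule nn_integral_circle_le)
  let ?\<tau> = "max (2 powr (1 - p)) (1 / 2) :: real"
  have r01: "0 \<le> r" "r < 1" using subsetD[OF dyadic_interval_subset r] by auto
  have "2 powr (1 - p) < (2 powr 0 :: real)" using p by (intro powr_less_mono) auto
  then have \<tau>: "0 \<le> ?\<tau>" "?\<tau> < 1" by (auto simp: max_def)
  fix i
  show "0 \<le> (4 * 2 ^ min i k) powr p" by simp
  show "ennreal (1 / norm (1 - of_real r * cis \<theta>) powr p) \<le> ennreal ((4 * 2 ^ min i k) powr p)"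
    if \<theta>: "\<theta> \<in> dyadic_arc i" for \<theta>
  proof (rule ennreal_leI)
    let ?d = "norm (1 - of_real r * cis \<theta>)"
    have "1 / (4 * 2 ^ i) \<le> ?d" using norm_one_minus_cis_ge_arc[OF \<theta> r01(1)] .
    moreover have "1 / (4 * 2 ^ k) \<le> ?d"
    proof -
      have "1 / (4 * 2 ^ k) \<le> 1 / (2 ^ Suc k :: real)" by (simp add: field_simps)
      also have "\<dots> \<le> 1 - norm (of_real r * cis \<theta>)" using dyadic_interval_one_minus[OF r] r01 by (simp add: norm_mult)
      also have "\<dots> \<le> ?d" by (rule norm_one_minus_ge)
      finally show ?thesis .
    qed
    ultimately have d: "1 / (4 * 2 ^ min i k) \<le> ?d" by (simp add: min_def)
    have d0: "0 < ?d" using one_minus_cis_nonzero[OF r01] by simp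
    have "1 / ?d \<le> 4 * 2 ^ min i k"
    proof -
      have "1 / D \<le> e" if "1 / e \<le> D" "0 < e" "0 < D" for D e :: real
        using that by (simp add: field_simps)
      from this[OF d _ d0] show ?thesis by simp
    qed
    then have "(1 / ?d) powr p \<le> (4 * 2 ^ min i k) powr p" using p by (intro powr_mono2) auto
    then show "1 / ?d powr p \<le> (4 * 2 ^ min i k) powr p" by (simp add: powr_divide)
  qed
  fix n
  have "(\<Sum>i<n. (4 * 2 ^ min i k) powr p / 2 ^ i) \<le> (\<Sum>i<n. 4 powr p * (2 ^ k) powr (p - 1) * ?\<tau> ^ (k - i + (i - k)))"
  proof (rule sum_mono)
    fix i
    have "(2 ^ min i k) powr p / 2 ^ i \<le> (2 ^ k) powr (p - 1) * ?\<tau> ^ (k - i + (i - k))"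
    proof (cases "i \<le> k")
      case True
      then obtain m where m: "k = i + m" by (metis le_add_diff_inverse)
      have "(2 ^ i) powr p / 2 ^ i = (2 ^ i) powr (p - 1)" by (simp add: powr_diff)
      also have "\<dots> = (2 ^ k) powr (p - 1) * (2 powr (1 - p)) ^ m"
      proof -
        have "(2 powr (1 - p)) ^ m = ((2::real) ^ m) powr (1 - p)"
          by (simp add: powr_powr powr_realpow[symmetric] mult.commute del: powr_realpow)
        moreover have "(2 ^ k) powr (p - 1) = (2 ^ i) powr (p - 1) * ((2::real) ^ m) powr (p - 1)"
          unfolding m power_add by (simp add: powr_mult)
        moreover have "((2::real) ^ m) powr (p - 1) * (2 ^ m) powr (1 - p) = 1"
          by (simp add: powr_add[symmetric])
        ultimately show ?thesis by simp
      qed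
      also have "\<dots> \<le> (2 ^ k) powr (p - 1) * ?\<tau> ^ m"
        by (intro mult_left_mono power_mono) auto
      finally show ?thesis using True m by simp
    next
      case False
      then obtain m where m: "i = k + m" by (metis le_add_diff_inverse nat_le_linear)
      have "(2 ^ k) powr p / 2 ^ i = (2 ^ k) powr (p - 1) * (1 / 2) ^ m"
        unfolding m power_add by (simp add: powr_diff power_one_over)
      also have "\<dots> \<le> (2 ^ k) powr (p - 1) * ?\<tau> ^ m"
        by (intro mult_left_mono power_mono) auto
      finally show ?thesis using False m by simp
    qed
    then have "4 powr p * ((2 ^ min i k) powr p / 2 ^ i) \<le> 4 powr p * ((2 ^ k) powr (p - 1) * ?\<tau> ^ (k - i + (i - k)))"
      by (rule mult_left_mono) simp
    then show "(4 * 2 ^ min i k) powr p / 2 ^ i \<le> 4 powr p * (2 ^ k) powr (p - 1) * ?\<tau> ^ (k - i + (i - k))"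
      by (simp add: powr_mult mult.assoc)
  qed
  also have "\<dots> \<le> 4 powr p * (2 ^ k) powr (p - 1) * (2 / (1 - ?\<tau>))"
    unfolding sum_distrib_left[symmetric] using \<tau> by (intro mult_left_mono sum_power_dist_le) auto
  finally show "(\<Sum>i<n. (4 * 2 ^ min i k) powr p / 2 ^ i) \<le> 4 powr p * (2 ^ k) powr (p - 1) * (2 / (1 - ?\<tau>))" .
qed

text \<open>On the k-th annulus |F'|^p is at most \<Phi> k ^ p / |1 - z|^p, and the weight is at
  most 2^(-k(p-1)), which cancels the growth of the circle integral of 1 / |1 - z|^p.\<close>

lemma dirichlet_norm_le:
  "dirichlet_norm p F \<le> ennreal ((M powr p + 4 powr p * (2 / (1 - max (2 powr (1 - p)) (1 / 2))) * L) powr (1 / p))"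
proof -
  let ?T = "2 / (1 - max (2 powr (1 - p)) (1 / 2)) :: real"
  have "2 powr (1 - p) < (2 powr 0 :: real)" using p by (intro powr_less_mono) auto
  then have T: "0 \<le> ?T" by (auto simp: max_def)
  have df: "deriv F holomorphic_on ball 0 1" using F_hol by (intro holomorphic_deriv) auto
  define H where "H z = ennreal (norm (deriv F z) powr p * (1 - norm z) powr (p - 1) / pi) * indicator (ball 0 1) z" for z
  define V where "V r = (\<integral>\<^sup>+\<theta>\<in>{0..2*pi}. H (of_real r * cis \<theta>) \<partial>lborel)" for r :: real
  have [measurable]: "H \<in> borel_measurable borel"
    unfolding H_def by (rule borel_measurable_dirichlet_density[OF F_hol])
  have V: "V r \<le> ennreal (2 * (4 powr p * ?T) * \<Phi> k powr p)" if r: "r \<in> dyadic_interval k" for r k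
  proof -
    have r01: "0 \<le> r" "r < 1" using subsetD[OF dyadic_interval_subset r] by auto
    note rk = dyadic_interval_one_minus[OF r]
    have [measurable]: "cis \<in> borel_measurable borel" by (intro borel_measurable_continuous_onI continuous_intros)
    let ?w = "\<Phi> k powr p * (1 / (2 ^ k) powr (p - 1)) / pi"
    have "V r \<le> (\<integral>\<^sup>+\<theta>. ennreal ?w * (ennreal (1 / norm (1 - of_real r * cis \<theta>) powr p) * indicator {0..2*pi} \<theta>) \<partial>lborel)"
      unfolding V_def
    proof (rule nn_integral_mono)
      fix \<theta>
      let ?z = "of_real r * cis \<theta>"
      have nz: "norm ?z = r" using r01 by (simp add: norm_mult)
      have d0: "0 < norm (1 - ?z)" using one_minus_cis_nonzero[OF r01] by simp
      have "norm (deriv F ?z) * norm (1 - ?z) \<le> \<Phi> k" using rk nz by (intro F_deriv) simp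
      then have "norm (deriv F ?z) \<le> \<Phi> k / norm (1 - ?z)" using d0 by (simp add: pos_le_divide_eq)
      then have "norm (deriv F ?z) powr p \<le> (\<Phi> k / norm (1 - ?z)) powr p" using p by (intro powr_mono2) auto
      moreover have "(1 - norm ?z) powr (p - 1) \<le> (1 / 2 ^ k) powr (p - 1)"
        unfolding nz using rk r01 p by (intro powr_mono2) auto
      ultimately have "norm (deriv F ?z) powr p * (1 - norm ?z) powr (p - 1) \<le> (\<Phi> k / norm (1 - ?z)) powr p * (1 / 2 ^ k) powr (p - 1)"
        by (intro mult_mono) auto
      also have "\<dots> = \<Phi> k powr p * (1 / (2 ^ k) powr (p - 1)) * (1 / norm (1 - ?z) powr p)"
        using \<Phi>0[of k] by (simp add: powr_divide)
      finally have "norm (deriv F ?z) powr p * (1 - norm ?z) powr (p - 1) / pi \<le> \<Phi> k powr p * (1 / (2 ^ k) powr (p - 1)) * (1 / norm (1 - ?z) powr p) / pi"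
        by (rule divide_right_mono) simp
      also have "\<dots> = ?w * (1 / norm (1 - ?z) powr p)" by simp
      finally have "ennreal (norm (deriv F ?z) powr p * (1 - norm ?z) powr (p - 1) / pi) \<le> ennreal (?w * (1 / norm (1 - ?z) powr p))"
        by (rule ennreal_leI)
      also have "\<dots> = ennreal ?w * ennreal (1 / norm (1 - ?z) powr p)"
        by (rule ennreal_mult) auto
      finally show "H ?z * indicator {0..2*pi} \<theta> \<le> ennreal ?w * (ennreal (1 / norm (1 - ?z) powr p) * indicator {0..2*pi} \<theta>)"
        using nz r01 by (auto simp: H_def indicator_def)
    qed
    also have "\<dots> = ennreal ?w * (\<integral>\<^sup>+\<theta>\<in>{0..2*pi}. ennreal (1 / norm (1 - of_real r * cis \<theta>) powr p) \<partial>lborel)"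
      by (rule nn_integral_cmult) measurable
    also have "\<dots> \<le> ennreal ?w * ennreal (2 * pi * (4 powr p * (2 ^ k) powr (p - 1) * ?T))"
      by (intro mult_left_mono circle_integral_inverse_powr_le[OF r]) auto
    also have "\<dots> = ennreal (2 * (4 powr p * ?T) * \<Phi> k powr p)"
      using T by (subst ennreal_mult[symmetric]) (auto simp: mult_ac)
    finally show ?thesis .
  qed
  have "ennreal (2 * pi) * (\<integral>\<^sup>+z. H z \<partial>lborel) \<le> (\<integral>\<^sup>+z. V (norm (z :: complex)) \<partial>lborel)"
    by (rule nn_integral_disc_le_radial) (simp_all add: V_def)
  also have "\<dots> = (\<integral>\<^sup>+z\<in>ball 0 1. V (norm (z :: complex)) \<partial>lborel)"
  proof (rule nn_integral_cong)
    fix z :: complex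
    have "V (norm z) = 0" if "\<not> norm z < 1" using that by (simp add: V_def H_def norm_mult)
    then show "V (norm z) = V (norm z) * indicator (ball 0 1) z" by (auto simp: indicator_def)
  qed
  also have "\<dots> \<le> ennreal (pi * (2 * (4 powr p * ?T) * L))"
  proof (rule nn_integral_disc_le_annuli[OF _ V])
    show "0 \<le> 2 * (4 powr p * ?T) * \<Phi> k powr p" for k using T by simp
    fix n
    have "(\<Sum>k<n. 2 * (4 powr p * ?T) * \<Phi> k powr p / 2 ^ k) = 2 * (4 powr p * ?T) * (\<Sum>k<n. \<Phi> k powr p / 2 ^ k)"
      by (simp only: sum_distrib_left times_divide_eq_right)
    also have "\<dots> \<le> 2 * (4 powr p * ?T) * L" using T by (intro mult_left_mono \<Phi>L) auto
    finally show "(\<Sum>k<n. 2 * (4 powr p * ?T) * \<Phi> k powr p / 2 ^ k) \<le> 2 * (4 powr p * ?T) * L" .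
  qed
  also have "\<dots> = ennreal (2 * pi) * ennreal (4 powr p * ?T * L)"
    using T L by (subst ennreal_mult[symmetric]) (auto simp: mult_ac)
  finally have HL: "(\<integral>\<^sup>+z. H z \<partial>lborel) \<le> ennreal (4 powr p * ?T * L)"
    by (subst (asm) ennreal_mult_le_mult_iff) auto
  have "norm (F 0) powr p \<le> M powr p" using F0 p by (intro powr_mono2) auto
  then have "ennreal (norm (F 0) powr p) + (\<integral>\<^sup>+z. H z \<partial>lborel) \<le> ennreal (M powr p) + ennreal (4 powr p * ?T * L)"
    using HL by (intro add_mono ennreal_leI)
  also have "\<dots> = ennreal (M powr p + 4 powr p * ?T * L)"
    using T L by (simp add: ennreal_plus)
  also have "M powr p + 4 powr p * ?T * L = ((M powr p + 4 powr p * ?T * L) powr (1 / p)) powr p"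
    using T L p by (simp add: powr_powr)
  finally show ?thesis unfolding dirichlet_norm_def H_def using p by (intro ennroot_leI) auto
qed

end

lemma space_norm_admissible_bound:
  assumes Y: "Y \<in> space_norms p"
  obtains C where "0 \<le> C" "\<And>F \<Phi>. admissible F \<Phi> \<Longrightarrow> Y F \<le> ennreal C"
proof -
  note all = mixed_norm_le hardy_norm_le hardy_littlewood_norm_le dirichlet_norm_le
  from Y show ?thesis
    unfolding space_norms_def using all that by (elim insertE emptyE) (blast intro: powr_ge_zero)+
qed

end

section \<open>Necessary conditions on the moments\<close>

context radial
begin

definition hilb :: "(real \<Rightarrow> complex) \<Rightarrow> complex \<Rightarrow> complex" where
  "hilb \<phi> z = (LINT t:{0..<1}|lebesgue. \<phi> t * (\<Sum>n. of_real (kc n) * (of_real t * z) ^ n))"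

text \<open>Both operators are the same linear operator applied to \<open>u f\<close>, which is \<open>f\<close> or \<open>|f|\<close> on the radius; the two agree on the test functions.\<close>

lemma operator_cases:
  assumes "T \<in> {hilbert_op \<omega>, sublinear_hilbert_op \<omega>}"
  obtains u :: "(complex \<Rightarrow> complex) \<Rightarrow> real \<Rightarrow> complex"
  where "\<And>f t. norm (u f t) = norm (f (of_real t))"
    and "\<And>f t. f (of_real t) = of_real (norm (f (of_real t))) \<Longrightarrow> u f t = f (of_real t)"
    and "\<And>f. f holomorphic_on ball 0 1 \<Longrightarrow> continuous_on {0..<1} (u f)"
    and "\<And>f. set_integrable lebesgue {0..<1} (\<lambda>t. u f t * of_real (\<omega> t)) \<Longrightarrow>
      \<exists>F. T f = Some F \<and> (\<forall>z. norm z < 1 \<longrightarrow> F z = hilb (\<lambda>t. u f t * of_real (\<omega> t)) z)"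
proof -
  have conv: "set_integrable lebesgue {0..<1} (\<lambda>t. v t * hilbert_kernel \<omega> t z * of_real (\<omega> t))
      \<and> (LINT t:{0..<1}|lebesgue. v t * hilbert_kernel \<omega> t z * of_real (\<omega> t)) = hilb (\<lambda>t. v t * of_real (\<omega> t)) z"
    if v: "set_integrable lebesgue {0..<1} (\<lambda>t. v t * of_real (\<omega> t))" and z: "norm z < 1" for v :: "real \<Rightarrow> complex" and z
  proof -
    have eq: "v t * hilbert_kernel \<omega> t z * of_real (\<omega> t) = v t * of_real (\<omega> t) * (\<Sum>n. of_real (kc n) * (of_real t * z) ^ n)"
      if "t \<in> {0..<1}" for t
      using that hilbert_kernel_series[of t z] z by simp
    have "summable (\<lambda>n. norm (complex_of_real (kc n)) * norm z ^ n)"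
      using summable_kc[of "norm z"] z kc_pos by (simp add: less_imp_le)
    from integral_power_series_swap(1)[OF v this]
    have "set_integrable lebesgue {0..<1} (\<lambda>t. v t * hilbert_kernel \<omega> t z * of_real (\<omega> t))"
      by (rule set_integrable_cong[THEN iffD2, OF refl refl eq, rotated])
    then show ?thesis
      unfolding hilb_def using eq by (intro conjI set_lebesgue_integral_cong) auto
  qed
  have cont: "continuous_on {0..<1} (\<lambda>t. f (complex_of_real t))" if "f holomorphic_on ball 0 1" for f
    by (intro continuous_on_compose2[OF holomorphic_on_imp_continuous_on[OF that]] continuous_intros) auto
  from assms consider "T = hilbert_op \<omega>" | "T = sublinear_hilbert_op \<omega>" by auto
  then show ?thesis
  proof cases
    case 1
    show ?thesis
      by (rule that[of "\<lambda>f t. f (of_real t)"]) (use cont conv in \<open>auto simp: 1 hilbert_op_def\<close>)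
  next
    case 2
    show ?thesis
      by (rule that[of "\<lambda>f t. of_real (norm (f (of_real t)))"])
        (use cont conv in \<open>auto simp: 2 sublinear_hilbert_op_def intro!: continuous_intros\<close>)
  qed
qed

lemma hilb_series:
  assumes "set_integrable lebesgue {0..<1} \<phi>" "norm z < 1"
  shows "(\<lambda>n. of_real (kc n) * (LINT t:{0..<1}|lebesgue. \<phi> t * of_real t ^ n) * z ^ n) sums hilb \<phi> z"
  unfolding hilb_def
  using summable_kc[of "norm z"] assms kc_pos by (intro integral_power_series_swap(2)) (auto simp: less_imp_le)

text \<open>All Taylor coefficients of the image are nonnegative, so on the radius the series may be
  cut down to any finite S. The factor 1/8 combines 1/4 from bounding the test function below by t^N
  and 1/2 from \<open>kc\<close>.\<close>

lemma test_operator_lower_bound: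
  assumes N: "1 \<le> N" and c: "0 < c" and r: "0 \<le> r" "r < 1" and S: "finite S"
    and u: "\<And>t. t \<in> {0..<1} \<Longrightarrow> u t = test_fun c N (of_real t)"
    and F: "F (of_real r) = hilb (\<lambda>t. u t * of_real (\<omega> t)) (of_real r)"
    and int: "set_integrable lebesgue {0..<1} (\<lambda>t. u t * of_real (\<omega> t))"
  shows "c / 8 * (\<Sum>n\<in>S. mom (N + n) * r ^ n / ((real n + 1) * mom (2 * n + 1))) \<le> norm (F (of_real r))"
proof -
  define v where "v t = c / (1 + real N * (1 - t))\<^sup>2" for t
  have uv: "u t = of_real (v t)" if "t \<in> {0..<1}" for t
    unfolding u[OF that] by (simp add: test_fun_def v_def)
  have v_ge: "c / 4 * t ^ N \<le> v t" if "t \<in> {0..<1}" for t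
  proof -
    have "c / 4 * t ^ N \<le> c / 4 * (4 / (1 + real N * (1 - t))\<^sup>2)"
      using power_le_inverse_square[of t N] that c by (intro mult_left_mono) auto
    then show ?thesis by (simp add: v_def)
  qed
  define a where "a n = (LINT t:{0..<1}|lebesgue. v t * \<omega> t * t ^ n)" for n
  have vi: "set_integrable lebesgue {0..<1} (\<lambda>t. v t * \<omega> t * t ^ n)" for n
  proof -
    have "set_integrable lebesgue {0..<1} (\<lambda>t. (v t * t ^ n) * \<omega> t)"
    proof (rule set_integrable_continuous_mult[OF w_int, where B = c])
      have nz: "1 + real N * (1 - t) \<noteq> 0" if "t \<in> {0..<1}" for t
        using that by (intro less_imp_neq[symmetric] add_pos_nonneg) auto
      show "continuous_on {0..<1} (\<lambda>t. v t * t ^ n)"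
        unfolding v_def using nz by (intro continuous_intros) auto
      fix t :: real assume t: "t \<in> {0..<1}"
      have "1 \<le> (1 + real N * (1 - t))\<^sup>2" using t by (intro one_le_power) auto
      then have "v t \<le> c" "0 \<le> v t" using c by (auto simp: v_def divide_le_eq mult_le_cancel_left1)
      moreover have "t ^ n \<le> 1" "0 \<le> t ^ n" using t by (auto intro: power_le_one)
      ultimately have "v t * t ^ n \<le> c * 1" by (intro mult_mono) auto
      then show "norm (v t * t ^ n) \<le> c" using \<open>0 \<le> v t\<close> \<open>0 \<le> t ^ n\<close> by simp
    qed simp
    then show ?thesis by (simp add: mult_ac)
  qed
  have a_ge: "c / 4 * mom (N + n) \<le> a n" for n
  proof -
    have "c / 4 * mom (N + n) = (LINT t:{0..<1}|lebesgue. c / 4 * (t ^ (N + n) * \<omega> t))"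
      using N by (simp add: mom_eq)
    also have "\<dots> \<le> a n"
      unfolding a_def
    proof (intro set_integral_mono vi)
      show "set_integrable lebesgue {0..<1} (\<lambda>t. c / 4 * (t ^ (N + n) * \<omega> t))"
        using mom_integrable[of "N + n"] by simp
      fix t :: real assume t: "t \<in> {0..<1}"
      have "c / 4 * t ^ N * (\<omega> t * t ^ n) \<le> v t * (\<omega> t * t ^ n)"
        using t v_ge w_nonneg by (intro mult_right_mono) auto
      then show "c / 4 * (t ^ (N + n) * \<omega> t) \<le> v t * \<omega> t * t ^ n" by (simp add: power_add mult_ac)
    qed
    finally show ?thesis .
  qed
  have coef: "(LINT t:{0..<1}|lebesgue. u t * of_real (\<omega> t) * of_real t ^ n) = of_real (a n)" for n
    unfolding a_def set_integral_complex_of_real[symmetric]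
    by (rule set_lebesgue_integral_cong) (auto simp: uv)
  have "(\<lambda>n. complex_of_real (kc n * a n * r ^ n)) sums F (of_real r)"
    using hilb_series[OF int, of "of_real r"] r unfolding coef F[symmetric] by simp
  then have "(\<lambda>n. Re (complex_of_real (kc n * a n * r ^ n))) sums Re (F (of_real r))"
    by (rule sums_Re)
  then have sums: "(\<lambda>n. kc n * a n * r ^ n) sums Re (F (of_real r))" by simp
  have a0: "0 \<le> a n" for n
    using a_ge[of n] c mom_pos[of "N + n"] N by (smt (verit) divide_pos_pos mult_pos_pos trans_le_add1)
  have "c / 8 * (\<Sum>n\<in>S. mom (N + n) * r ^ n / ((real n + 1) * mom (2 * n + 1))) = (\<Sum>n\<in>S. kc n * (c / 4 * mom (N + n)) * r ^ n)"
  proof -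
    have "c / 8 * (m * \<rho> / (y * b)) = 1 / (2 * y * b) * (c / 4 * m) * \<rho>" for m \<rho> y b :: real by simp
    then show ?thesis unfolding sum_distrib_left kc_def by (intro sum.cong) blast+
  qed
  also have "\<dots> \<le> (\<Sum>n\<in>S. kc n * a n * r ^ n)"
    using kc_pos r a_ge by (intro sum_mono mult_right_mono mult_left_mono) (auto simp: less_imp_le)
  also have "\<dots> \<le> (\<Sum>n. kc n * a n * r ^ n)"
    using kc_pos r a0 S by (intro sum_le_suminf sums_summable[OF sums]) (auto simp: less_imp_le)
  also have "\<dots> = Re (F (of_real r))" by (rule sums_unique[OF sums, symmetric])
  also have "\<dots> \<le> norm (F (of_real r))" by (rule complex_Re_le_cmod)
  finally show ?thesis .
qed

text \<open>The coefficient of the test function contributes N^(1/q) on the left, the growth of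
  functions in Y contributes (1 - r)^(-1/q) on the right; dividing leaves a power of N (1 -
  r).\<close>

lemma necessary_moment_bound:
  assumes T: "T \<in> {hilbert_op \<omega>, sublinear_hilbert_op \<omega>}" and q: "1 \<le> q"
    and X: "X \<in> space_norms q" and Y: "Y \<in> space_norms q" and bdd: "bounded_operator T X Y"
  obtains C where "0 < C" "\<And>N r S. 1 \<le> N \<Longrightarrow> 0 \<le> r \<Longrightarrow> r < 1 \<Longrightarrow> finite S \<Longrightarrow>
    (\<Sum>n\<in>S. mom (N + n) * r ^ n / ((real n + 1) * mom (2 * n + 1))) \<le> C * (real N * (1 - r)) powr (- 1 / q)"
proof -
  obtain \<kappa> where \<kappa>: "0 < \<kappa>" and Xtest: "\<And>N. 1 \<le> N \<Longrightarrow> X (test_fun (\<kappa> * real N powr (1 / q)) N) \<le> 1"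
    using space_norm_test_fun[OF X q] by blast
  define B where "B = (SUP f\<in>{f \<in> analytic_space X. X f \<le> 1}. Y (the (T f)))"
  have "B < \<infinity>" using bdd by (simp add: bounded_operator_def B_def)
  then obtain K where K: "0 \<le> K" "B = ennreal K" by (cases B) auto
  obtain G where G: "\<And>f t. f holomorphic_on ball 0 1 \<Longrightarrow> Y f \<le> ennreal K \<Longrightarrow> 0 \<le> t \<Longrightarrow> t < 1 \<Longrightarrow>
    norm (f (of_real t)) powr q * (1 - t) \<le> G"
    using space_norm_growth[OF Y q K(1)] by blast
  obtain u where u1: "\<And>f t. norm (u f t) = norm (f (of_real t))"
    and u2: "\<And>f t. f (of_real t) = of_real (norm (f (of_real t))) \<Longrightarrow> u f t = f (of_real t)"
    and u3: "\<And>f. f holomorphic_on ball 0 1 \<Longrightarrow> continuous_on {0..<1} (u f)"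
    and u4: "\<And>f. set_integrable lebesgue {0..<1} (\<lambda>t. u f t * of_real (\<omega> t)) \<Longrightarrow>
      \<exists>F. T f = Some F \<and> (\<forall>z. norm z < 1 \<longrightarrow> F z = hilb (\<lambda>t. u f t * of_real (\<omega> t)) z)"
    using operator_cases[OF T] by blast
  \<comment> \<open>G comes without information on its sign; a positive constant makes the final C
    positive.\<close>
  define G' where "G' = max G 1"
  have "(\<Sum>n\<in>S. mom (N + n) * r ^ n / ((real n + 1) * mom (2 * n + 1)))
      \<le> 8 / \<kappa> * G' powr (1 / q) * (real N * (1 - r)) powr (- 1 / q)"
    if N: "1 \<le> N" and r: "0 \<le> r" "r < 1" and S: "finite S" for N r S
  proof -
    define c where "c = \<kappa> * real N powr (1 / q)"
    have c: "0 < c" using \<kappa> N by (simp add: c_def)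
    let ?f = "test_fun c N"
    let ?\<Sigma> = "\<Sum>n\<in>S. mom (N + n) * r ^ n / ((real n + 1) * mom (2 * n + 1))"
    have hol: "?f holomorphic_on ball 0 1" by (rule test_fun_holomorphic[OF N c])
    have X1: "X ?f \<le> 1" unfolding c_def by (rule Xtest[OF N])
    then have fX: "?f \<in> analytic_space X" using hol by (auto simp: analytic_space_def intro: le_less_trans)
    have ut: "u ?f t = ?f (of_real t)" if "t \<in> {0..<1}" for t
    proof (rule u2)
      have "?f (of_real t) = of_real (c / (1 + real N * (1 - t))\<^sup>2)" by (simp add: test_fun_def)
      moreover have "0 \<le> c / (1 + real N * (1 - t))\<^sup>2" using c by simp
      ultimately show "?f (of_real t) = of_real (norm (?f (of_real t)))" by (simp only: norm_of_real abs_of_nonneg)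
    qed
    have int: "set_integrable lebesgue {0..<1} (\<lambda>t. u ?f t * of_real (\<omega> t))"
    proof (rule set_integrable_continuous_mult[where B = c])
      show "set_integrable lebesgue {0..<1} (\<lambda>t. complex_of_real (\<omega> t))"
        using integrable_of_real[OF w_int[unfolded set_integrable_def], where 'a = complex]
        by (simp add: set_integrable_def scaleR_conv_of_real)
      show "continuous_on {0..<1} (u ?f)" by (rule u3[OF hol])
      fix t :: real assume "t \<in> {0..<1}"
      then have t: "norm (complex_of_real t) \<le> 1" by auto
      have "1 \<le> (norm (1 + of_nat N * (1 - complex_of_real t)))\<^sup>2"
        using test_denom_ge_1[OF N c t] by (rule one_le_power)
      then show "norm (u ?f t) \<le> c"
        unfolding u1 using c by (simp add: test_fun_def norm_divide norm_power divide_le_eq mult_le_cancel_left1)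
    qed simp
    obtain F where F: "T ?f = Some F" "\<And>z. norm z < 1 \<Longrightarrow> F z = hilb (\<lambda>t. u ?f t * of_real (\<omega> t)) z"
      using u4[OF int] by blast
    have FY: "F \<in> analytic_space Y" using bdd fX F(1) unfolding bounded_operator_def by (metis option.inject)
    have "Y (the (T ?f)) \<le> B" unfolding B_def using fX X1 by (intro SUP_upper) auto
    then have YF: "Y F \<le> ennreal K" using F(1) K(2) by simp
    have "norm (F (of_real r)) powr q * (1 - r) \<le> G"
      using FY YF r by (intro G) (auto simp: analytic_space_def)
    then have g: "norm (F (of_real r)) powr q \<le> G' / (1 - r)"
      using r by (simp add: pos_le_divide_eq G'_def)
    have "c / 8 * ?\<Sigma> \<le> norm (F (of_real r))"
      using F(2)[of "of_real r"] r by (intro test_operator_lower_bound[OF N c r S ut _ int]) auto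
    also have "norm (F (of_real r)) = (norm (F (of_real r)) powr q) powr (1 / q)" using q by (simp add: powr_powr)
    also have "\<dots> \<le> (G' / (1 - r)) powr (1 / q)" using q g by (intro powr_mono2) auto
    also have "\<dots> = G' powr (1 / q) * (1 - r) powr (- 1 / q)"
      by (simp add: powr_divide powr_minus_divide)
    finally have "8 / c * (c / 8 * ?\<Sigma>) \<le> 8 / c * (G' powr (1 / q) * (1 - r) powr (- 1 / q))"
      using c by (intro mult_left_mono) auto
    then have "?\<Sigma> \<le> 8 / c * (G' powr (1 / q) * (1 - r) powr (- 1 / q))" using c by simp
    also have "\<dots> = 8 / \<kappa> * G' powr (1 / q) * (real N * (1 - r)) powr (- 1 / q)"
      using r by (simp add: c_def powr_mult powr_minus divide_inverse)
    finally show ?thesis .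
  qed
  then show ?thesis using that[of "8 / \<kappa> * G' powr (1 / q)"] \<kappa> by (simp add: G'_def)
qed

lemma power_one_minus_ge: "1 \<le> M \<Longrightarrow> (1 / 2) ^ k \<le> (1 - 1 / (2 * real M)) ^ (M * k)"
proof -
  assume M: "1 \<le> M"
  have "1 + real M * (- (1 / (2 * real M))) \<le> (1 + (- (1 / (2 * real M)))) ^ M"
    using M by (intro Bernoulli_inequality) (auto simp: field_simps)
  then have "1 / 2 \<le> (1 - 1 / (2 * real M)) ^ M" using M by simp
  then show ?thesis unfolding power_mult by (rule power_mono) simp
qed

text \<open>With r = 1 - 1/(2M), each of the M terms of the block has r^n \<ge> 1 / 2^(a+1), n + 1
  \<le> (a+1) M, N + n \<le> P and 2 n + 1 \<ge> Q; monotonicity of the moments does the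
  rest.\<close>

lemma moment_sum_ge:
  assumes M: "1 \<le> M" and a: "1 \<le> a" and N: "N + (a + 1) * M \<le> P" and Q: "1 \<le> Q" "Q \<le> 2 * a * M"
  shows "mom P / (2 ^ (a + 1) * (real a + 1) * mom Q)
    \<le> (\<Sum>n = a * M..<(a + 1) * M. mom (N + n) * (1 - 1 / (2 * real M)) ^ n / ((real n + 1) * mom (2 * n + 1)))"
proof -
  let ?r = "1 - 1 / (2 * real M)"
  have r: "0 \<le> ?r" "?r \<le> 1" using M by (auto simp: field_simps)
  have P1: "1 \<le> P" using N M a by (cases P) auto
  have "mom P / (2 ^ (a + 1) * (real a + 1) * mom Q) = (\<Sum>n = a * M..<(a + 1) * M. mom P * (1 / 2) ^ (a + 1) / ((real a + 1) * real M * mom Q))"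
    using M by (simp add: power_one_over)
  also have "\<dots> \<le> (\<Sum>n = a * M..<(a + 1) * M. mom (N + n) * ?r ^ n / ((real n + 1) * mom (2 * n + 1)))"
  proof (rule sum_mono)
    fix n assume n: "n \<in> {a * M..<(a + 1) * M}"
    have "1 \<le> a * M" using a M by simp
    moreover have "a * M \<le> n" using n by simp
    ultimately have n1: "1 \<le> N + n" by linarith
    have "n + 1 \<le> (a + 1) * M" using n by auto
    then have "real (n + 1) \<le> real ((a + 1) * M)" by (simp only: of_nat_le_iff)
    then have nM: "real n + 1 \<le> (real a + 1) * real M" by (simp add: algebra_simps)
    have "(1 / 2) ^ (a + 1) \<le> ?r ^ (M * (a + 1))" by (rule power_one_minus_ge[OF M])
    also have "\<dots> \<le> ?r ^ n" using n r by (intro power_decreasing) (auto simp: mult.commute)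
    finally have rn: "(1 / 2) ^ (a + 1) \<le> ?r ^ n" .
    have m1: "mom P \<le> mom (N + n)" using n N n1 by (intro mom_antimono) auto
    have m2: "mom (2 * n + 1) \<le> mom Q" using n Q by (intro mom_antimono) auto
    show "mom P * (1 / 2) ^ (a + 1) / ((real a + 1) * real M * mom Q) \<le> mom (N + n) * ?r ^ n / ((real n + 1) * mom (2 * n + 1))"
      using rn m1 m2 nM mom_pos[OF P1] mom_pos[OF n1] mom_pos[of "2 * n + 1"] mom_pos[OF Q(1)] r
      by (intro frac_le mult_mono mult_pos_pos mult_nonneg_nonneg) auto
  qed
  finally show ?thesis .
qed

text \<open>The two conditions are two choices of parameters in one inequality. Doubling comes from
  N = M, where N (1 - r) is constant and the block lies far enough out that Q exceeds P; decay comes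
  from N = 2^k and M = 2^j, where the right-hand side is a power of 2^(k-j).\<close>

lemma necessary_moment_conditions:
  assumes T: "T \<in> {hilbert_op \<omega>, sublinear_hilbert_op \<omega>}" and q: "1 \<le> q"
    and X: "X \<in> space_norms q" and Y: "Y \<in> space_norms q" and bdd: "bounded_operator T X Y"
  obtains K C where "1 \<le> K" "\<And>k. mom (2 ^ k) \<le> K * mom (2 ^ Suc k)"
    and "0 \<le> C" "\<And>j k. j \<le> k \<Longrightarrow> mom (2 ^ k) \<le> C * (1 / 2 powr (1 / q)) ^ (k - j) * mom (2 ^ j)"
proof -
  obtain A where A: "0 < A" and bound: "\<And>N r S. 1 \<le> N \<Longrightarrow> 0 \<le> r \<Longrightarrow> r < 1 \<Longrightarrow> finite S \<Longrightarrow>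
    (\<Sum>n\<in>S. mom (N + n) * r ^ n / ((real n + 1) * mom (2 * n + 1))) \<le> A * (real N * (1 - r)) powr (- 1 / q)"
    using necessary_moment_bound[OF assms] by blast
  have both: "mom P / (2 ^ (a + 1) * (real a + 1) * mom Q) \<le> A * (real N / (2 * real M)) powr (- 1 / q)"
    if M: "1 \<le> M" and N: "1 \<le> N" and a: "1 \<le> a" and P: "N + (a + 1) * M \<le> P" and Q: "1 \<le> Q" "Q \<le> 2 * a * M" for N M a P Q
  proof -
    have "0 \<le> 1 - 1 / (2 * real M)" "1 - 1 / (2 * real M) < 1" using M by (auto simp: field_simps)
    from order_trans[OF moment_sum_ge[OF M a P Q] bound[OF N this]] show ?thesis by simp
  qed
  define D where "D = max 1 (896 * A * (1 / 2) powr (- 1 / q))"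
  have D1: "1 \<le> D" by (simp add: D_def)
  have d: "mom (8 * N) \<le> D * mom (12 * N)" if N: "1 \<le> N" for N
  proof -
    \<comment> \<open>For M = N the admissible ratio Q / P is 2 a / (a + 2), always below 2; a = 6
      gives 3/2. The constant 896 is 2^7 times 7.\<close>
    have "mom (8 * N) / (2 ^ (6 + 1) * (real 6 + 1) * mom (12 * N)) \<le> A * (real N / (2 * real N)) powr (- 1 / q)"
      using N by (intro both) auto
    then have "mom (8 * N) \<le> 896 * A * (1 / 2) powr (- 1 / q) * mom (12 * N)"
      using N mom_pos[of "12 * N"] by (simp add: pos_divide_le_eq mult_ac)
    also have "\<dots> \<le> D * mom (12 * N)"
      using N mom_pos[of "12 * N"] by (intro mult_right_mono) (auto simp: D_def)
    finally show ?thesis .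
  qed
  have d64: "mom (64 * N) \<le> D * D * mom (128 * N)" if N: "1 \<le> N" for N
  proof -
    \<comment> \<open>Two steps of ratio 3/2 lead from 64 N to 144 N, past 128 N.\<close>
    have "mom (64 * N) \<le> D * mom (96 * N)" using d[of "8 * N"] N by simp
    also have "\<dots> \<le> D * (D * mom (144 * N))" using d[of "12 * N"] N D1 by (intro mult_left_mono) auto
    also have "mom (144 * N) \<le> mom (128 * N)" using N by (intro mom_antimono) auto
    finally show ?thesis using D1 by (simp add: mult_left_mono mult.assoc)
  qed
  \<comment> \<open>The second entry covers the exponents k < 6, which are not of the form 64
    N.\<close>
  define K where "K = max (D * D) (mom 1 / mom 64)"
  have K1: "1 \<le> K" using mult_mono[of 1 D 1 D] D1 by (simp add: K_def max_def)
  have K: "mom (2 ^ k) \<le> K * mom (2 ^ Suc k)" for k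
  proof (cases "k < 6")
    case True
    have k1: "(1::nat) \<le> 2 ^ k" "(1::nat) \<le> 2 ^ Suc k" by simp_all
    have "2 ^ Suc k \<le> (2 ^ 6 :: nat)" using True by (intro power_increasing) auto
    then have "mom 64 \<le> mom (2 ^ Suc k)" using k1 by (intro mom_antimono) auto
    have "mom (2 ^ k) \<le> mom 1" using k1 by (intro mom_antimono) auto
    also have "\<dots> = mom 1 / mom 64 * mom 64" using mom_pos[of 64] by simp
    also have "\<dots> \<le> K * mom (2 ^ Suc k)"
      using K1 \<open>mom 64 \<le> mom (2 ^ Suc k)\<close> mom_pos[of 64] by (intro mult_mono) (auto simp: K_def)
    finally show ?thesis .
  next
    case False
    then obtain j where j: "k = 6 + j" by (metis le_add_diff_inverse not_less)
    have "mom (2 ^ k) \<le> D * D * mom (2 ^ Suc k)"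
      using d64[of "2 ^ j"] by (simp add: j power_add)
    also have "\<dots> \<le> K * mom (2 ^ Suc k)"
      using mom_pos[of "2 ^ Suc k"] by (intro mult_right_mono) (auto simp: K_def)
    finally show ?thesis .
  qed
  define C where "C = K * K * (8 * A * 2 powr (1 / q))"
  have C: "mom (2 ^ k) \<le> C * (1 / 2 powr (1 / q)) ^ (k - j) * mom (2 ^ j)" if jk: "j \<le> k" for j k
  proof -
    have "(2::nat) ^ j \<le> 2 ^ k" using jk by (intro power_increasing) auto
    \<comment> \<open>Here a = 1, M = Q = 2^j and N = 2^k; j \<le> k ensures N + 2 M \<le> 4 *
      2^k.\<close>
    then have "mom (4 * 2 ^ k) / (2 ^ (1 + 1) * (real 1 + 1) * mom (2 ^ j)) \<le> A * (real (2 ^ k) / (2 * real (2 ^ j))) powr (- 1 / q)"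
      by (intro both) (auto simp del: power_increasing_iff)
    then have 1: "mom (4 * 2 ^ k) \<le> 8 * A * (2 ^ k / (2 * 2 ^ j)) powr (- 1 / q) * mom (2 ^ j)"
      using mom_pos[of "2 ^ j"] by (simp add: pos_divide_le_eq mult_ac)
    have 2: "(2 ^ k / (2 * 2 ^ j)) powr (- 1 / q) = 2 powr (1 / q) * (1 / 2 powr (1 / q)) ^ (k - j)"
    proof -
      have "(2::real) ^ k / (2 * 2 ^ j) = 2 powr (real (k - j) - 1)"
        using jk by (simp add: powr_diff powr_realpow power_diff)
      then have "(2 ^ k / (2 * 2 ^ j)) powr (- 1 / q) = (2::real) powr ((real (k - j) - 1) * (- 1 / q))"
        by (simp add: powr_powr)
      also have "(real (k - j) - 1) * (- 1 / q) = 1 / q + - (1 / q) * real (k - j)" using q by (simp add: field_simps)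
      also have "2 powr (1 / q + - (1 / q) * real (k - j)) = 2 powr (1 / q) * (2 powr (- (1 / q))) powr real (k - j)"
        by (simp only: powr_add powr_powr)
      also have "(2 powr (- (1 / q))) powr real (k - j) = (1 / 2 powr (1 / q)) ^ (k - j)"
        by (simp add: powr_realpow powr_minus divide_inverse)
      finally show ?thesis .
    qed
    \<comment> \<open>The decay estimate concerns index 4 * 2^k; doubling is applied twice to come
      back to 2^k.\<close>
    have "mom (2 ^ k) \<le> K * mom (2 ^ Suc k)" by (rule K)
    also have "\<dots> \<le> K * (K * mom (2 ^ Suc (Suc k)))" using K1 by (intro mult_left_mono K) auto
    also have "mom (2 ^ Suc (Suc k)) = mom (4 * 2 ^ k)" by simp
    also have "K * (K * mom (4 * 2 ^ k)) \<le> K * (K * (8 * A * (2 ^ k / (2 * 2 ^ j)) powr (- 1 / q) * mom (2 ^ j)))"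
      using K1 1 by (intro mult_left_mono) auto
    also have "\<dots> = C * (1 / 2 powr (1 / q)) ^ (k - j) * mom (2 ^ j)"
      unfolding 2 C_def by (simp only: mult_ac)
    finally show ?thesis .
  qed
  have "0 \<le> C" using K1 A by (simp add: C_def)
  from that[OF K1 K this C] show ?thesis .
qed

end

section \<open>Sufficiency of the moment conditions\<close>

text \<open>Induction on the exponent: multiplication by 1 - \<rho> replaces the powers by their
  differences, which Bernoulli's inequality bounds by \<sigma> + 1 times the next lower power. The
  boundary term in \<open>id\<close> is nonnegative and dropped.\<close>

lemma sum_power_geometric_le:
  fixes \<rho> :: real
  assumes \<rho>: "0 \<le> \<rho>" "\<rho> < 1"
  shows "(\<Sum>n<m. (real n + 1) ^ \<sigma> * \<rho> ^ n) \<le> fact \<sigma> / (1 - \<rho>) ^ (\<sigma> + 1)"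
proof (induction \<sigma> arbitrary: m)
  case 0
  have "(\<Sum>n<m. \<rho> ^ n) \<le> (\<Sum>n. \<rho> ^ n)" using \<rho> by (intro sum_le_suminf summable_geometric) auto
  also have "\<dots> = 1 / (1 - \<rho>)" using \<rho> by (intro suminf_geometric) auto
  finally show ?case by simp
next
  case (Suc \<sigma>)
  have id: "(1 - \<rho>) * (\<Sum>n<m. (real n + 1) ^ Suc \<sigma> * \<rho> ^ n) + real m ^ Suc \<sigma> * \<rho> ^ m
      = (\<Sum>n<m. ((real n + 1) ^ Suc \<sigma> - real n ^ Suc \<sigma>) * \<rho> ^ n)" for m
    by (induction m) (simp_all add: algebra_simps)
  have diff: "(real n + 1) ^ Suc \<sigma> - real n ^ Suc \<sigma> \<le> real (Suc \<sigma>) * (real n + 1) ^ \<sigma>" for n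
  proof -
    let ?x = "real n + 1"
    have "1 + real (Suc \<sigma>) * (- (1 / ?x)) \<le> (1 + (- (1 / ?x))) ^ Suc \<sigma>"
      by (intro Bernoulli_inequality) (simp add: field_simps)
    then have "?x ^ Suc \<sigma> * (1 + real (Suc \<sigma>) * (- (1 / ?x))) \<le> ?x ^ Suc \<sigma> * (1 + (- (1 / ?x))) ^ Suc \<sigma>"
      by (rule mult_left_mono) simp
    also have "\<dots> = (?x * (1 + (- (1 / ?x)))) ^ Suc \<sigma>" by (simp only: power_mult_distrib)
    also have "?x * (1 + (- (1 / ?x))) = real n" by (simp add: field_simps)
    finally have *: "?x ^ Suc \<sigma> * (1 + real (Suc \<sigma>) * (- (1 / ?x))) \<le> real n ^ Suc \<sigma>" .
    have "y ^ Suc \<sigma> * (1 + a * (- (1 / y))) = y ^ Suc \<sigma> - a * y ^ \<sigma>" if "y \<noteq> 0" for y a :: real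
      using that by (simp add: field_simps)
    from this[of ?x "real (Suc \<sigma>)"] * show ?thesis by simp
  qed
  have "(1 - \<rho>) * (\<Sum>n<m. (real n + 1) ^ Suc \<sigma> * \<rho> ^ n) \<le> (\<Sum>n<m. ((real n + 1) ^ Suc \<sigma> - real n ^ Suc \<sigma>) * \<rho> ^ n)"
    unfolding id[symmetric] using \<rho> by simp
  also have "\<dots> \<le> (\<Sum>n<m. real (Suc \<sigma>) * ((real n + 1) ^ \<sigma> * \<rho> ^ n))"
    unfolding mult.assoc[symmetric] using \<rho> diff by (intro sum_mono mult_right_mono) auto
  also have "\<dots> = real (Suc \<sigma>) * (\<Sum>n<m. (real n + 1) ^ \<sigma> * \<rho> ^ n)" by (simp only: sum_distrib_left)
  also have "\<dots> \<le> real (Suc \<sigma>) * (fact \<sigma> / (1 - \<rho>) ^ (\<sigma> + 1))" by (intro mult_left_mono Suc.IH) auto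
  also have "\<dots> = (1 - \<rho>) * (fact (Suc \<sigma>) / (1 - \<rho>) ^ (Suc \<sigma> + 1))" using \<rho> by simp
  finally show ?case using \<rho> by (subst (asm) mult_le_cancel_left_pos) auto
qed

text \<open>Multiplication by \<open>1 - w\<close> turns increasing coefficients into nonnegative increments.\<close>

lemma norm_power_series_increasing:
  fixes b :: "nat \<Rightarrow> real" and w :: complex
  assumes b: "0 \<le> b 0" "\<And>n. b n \<le> b (Suc n)" and sm: "summable (\<lambda>n. b n * norm w ^ n)"
    and w: "norm w \<le> 1"
  shows "norm (\<Sum>n. of_real (b n) * w ^ n) * norm (1 - w) \<le> (1 - norm w) * (\<Sum>n. b n * norm w ^ n)"
    and "b n * norm w ^ n \<le> (1 - norm w) * (\<Sum>n. b n * norm w ^ n)"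
proof -
  \<comment> \<open>Increments of b with b extended by 0 to the left, so that e 0 = b 0: the
    coefficients of (1 - w) times the series.\<close>
  define e where "e n = b n - (case n of 0 \<Rightarrow> 0 | Suc k \<Rightarrow> b k)" for n
  have e0: "0 \<le> e n" for n using b by (auto simp: e_def split: nat.split)
  have bn: "0 \<le> b n" for n using b by (induction n) (auto intro: order_trans)
  have shift: "(\<lambda>n. of_real (e n) * v ^ n) sums ((1 - v) * (\<Sum>n. of_real (b n) * v ^ n))"
    if "summable (\<lambda>n. of_real (b n) * v ^ n)" for v :: "'a :: {real_normed_field, banach}"
  proof -
    let ?B = "\<Sum>n. of_real (b n) * v ^ n"
    have 1: "(\<lambda>n. of_real (b n) * v ^ n) sums ?B" using that by (rule summable_sums)
    have "(\<lambda>n. of_real (b n) * v ^ n * v) sums (?B * v)" by (rule sums_mult2[OF 1])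
    then have "(\<lambda>n. of_real (case Suc n of 0 \<Rightarrow> 0 | Suc k \<Rightarrow> b k) * v ^ Suc n) sums (?B * v)"
      by (simp add: mult_ac)
    from sums_Suc[OF this] have "(\<lambda>n. of_real (case n of 0 \<Rightarrow> 0 | Suc k \<Rightarrow> b k) * v ^ n) sums (?B * v)"
      by simp
    from sums_diff[OF 1 this] show ?thesis by (simp add: e_def algebra_simps)
  qed
  have smw: "summable (\<lambda>n. of_real (b n) * w ^ n)"
    by (rule summable_norm_cancel) (use sm bn in \<open>simp add: norm_mult norm_power\<close>)
  have real: "(\<lambda>n. e n * norm w ^ n) sums ((1 - norm w) * (\<Sum>n. b n * norm w ^ n))"
    using shift[of "norm w"] sm by simp
  have "norm ((1 - w) * (\<Sum>n. of_real (b n) * w ^ n)) = norm (\<Sum>n. of_real (e n) * w ^ n)"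
    using sums_unique[OF shift[OF smw]] by simp
  also have "\<dots> \<le> (\<Sum>n. norm (of_real (e n) * w ^ n))"
    by (rule summable_norm) (use sums_summable[OF real] e0 in \<open>simp add: norm_mult norm_power\<close>)
  also have "\<dots> = (\<Sum>n. e n * norm w ^ n)" using e0 by (simp add: norm_mult norm_power)
  also have "\<dots> = (1 - norm w) * (\<Sum>n. b n * norm w ^ n)" by (rule sums_unique[OF real, symmetric])
  finally show "norm (\<Sum>n. of_real (b n) * w ^ n) * norm (1 - w) \<le> (1 - norm w) * (\<Sum>n. b n * norm w ^ n)"
    by (simp add: norm_mult mult.commute)
  show "b n * norm w ^ n \<le> (1 - norm w) * (\<Sum>n. b n * norm w ^ n)"
  proof -
    have "b n = (\<Sum>m\<le>n. e m)" by (induction n) (auto simp: e_def)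
    then have "b n * norm w ^ n = (\<Sum>m\<le>n. e m * norm w ^ n)" by (simp add: sum_distrib_right)
    also have "\<dots> \<le> (\<Sum>m\<le>n. e m * norm w ^ m)"
      using e0 w by (intro sum_mono mult_left_mono power_decreasing) auto
    also have "\<dots> \<le> (\<Sum>m. e m * norm w ^ m)"
      using e0 by (intro sum_le_suminf sums_summable[OF real]) auto
    also have "\<dots> = (1 - norm w) * (\<Sum>n. b n * norm w ^ n)" by (rule sums_unique[OF real, symmetric])
    finally show ?thesis .
  qed
qed

section \<open>Kernel estimates under doubling and decay of the moments\<close>

locale moment_conditions = radial +
  fixes K C q p :: real
  assumes K: "1 \<le> K" "mom (2 ^ k) \<le> K * mom (2 ^ Suc k)"
    and C: "0 \<le> C" "j \<le> k \<Longrightarrow> mom (2 ^ k) \<le> C * (1 / 2 powr (1 / q)) ^ (k - j) * mom (2 ^ j)"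
    and q: "1 \<le> q" and pq: "q < p"
begin

lemma mom2_pos: "0 < mom (2 ^ k)"
  by (rule mom_pos) simp

lemma mom_doubling_iterated: "mom (2 ^ k) \<le> K ^ i * mom (2 ^ (k + i))"
proof (induction i)
  case (Suc i)
  have "K ^ i * mom (2 ^ (k + i)) \<le> K ^ i * (K * mom (2 ^ Suc (k + i)))"
    using K(1) by (intro mult_left_mono K(2)) auto
  with Suc show ?case by (simp add: mult_ac)
qed simp

text \<open>Doubling with K \<le> 2^\<sigma> is polynomial growth of order \<sigma> of the
  reciprocal moments; an integer order allows sums with powers of n + 1 to be treated by
  induction.\<close>

definition \<sigma> :: nat where "\<sigma> = (SOME \<sigma>. K \<le> 2 ^ \<sigma>)"

lemma K_le: "K \<le> 2 ^ \<sigma>"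
proof -
  have "\<exists>\<sigma>. K \<le> 2 ^ \<sigma>" using real_arch_pow[of 2 K] by (auto intro: less_imp_le)
  then show ?thesis unfolding \<sigma>_def by (rule someI_ex)
qed

lemma kb_le: "kb n \<le> 6 ^ \<sigma> * (1 + ((real n + 1) / 2 ^ k) ^ \<sigma>) / mom (2 ^ k)"
proof -
  have m: "0 < mom (2 * n + 3)" by (rule mom_pos) simp
  have main: "mom (2 ^ k) \<le> 6 ^ \<sigma> * (1 + ((real n + 1) / 2 ^ k) ^ \<sigma>) * mom (2 * n + 3)"
  proof (cases "2 * n + 3 \<le> 2 ^ k")
    case True
    then have "mom (2 ^ k) \<le> 1 * mom (2 * n + 3)" by (simp add: mom_antimono)
    also have "\<dots> \<le> 6 ^ \<sigma> * (1 + ((real n + 1) / 2 ^ k) ^ \<sigma>) * mom (2 * n + 3)"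
    proof (intro mult_right_mono)
      have "1 * 1 \<le> 6 ^ \<sigma> * (1 + ((real n + 1) / 2 ^ k) ^ \<sigma>)" by (intro mult_mono) auto
      then show "1 \<le> 6 ^ \<sigma> * (1 + ((real n + 1) / 2 ^ k) ^ \<sigma>)" by simp
    qed (use m in simp)
    finally show ?thesis .
  next
    case False
    \<comment> \<open>The least i with y \<le> 2^i is the number of doublings from 2^k to beyond 2 n
      + 3; minimality gives 2^i \<le> 2 y, hence 2^i \<le> 6 (n + 1) / 2^k.\<close>
    define y where "y = real (2 * n + 3) / 2 ^ k"
    have y1: "1 < y" using False by (simp add: y_def not_le flip: of_nat_less_iff[where 'a = real])
    have "\<exists>i. y \<le> 2 ^ i" using real_arch_pow[of 2 y] by (auto intro: less_imp_le)
    then obtain i where i: "y \<le> 2 ^ i" "\<And>j. j < i \<Longrightarrow> \<not> y \<le> 2 ^ j"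
      using exists_least_iff[of "\<lambda>i. y \<le> 2 ^ i"] by auto
    have "i \<noteq> 0" using i(1) y1 by (cases i) auto
    then obtain j where j: "i = Suc j" by (cases i) auto
    have "2 ^ j \<le> y" using i(2)[of j] j by simp
    have "real (2 * n + 3) \<le> 2 ^ (k + i)" using i(1) by (simp add: y_def power_add pos_divide_le_eq mult.commute)
    then have "2 * n + 3 \<le> 2 ^ (k + i)" by (simp flip: of_nat_le_iff[where 'a = real])
    then have "mom (2 ^ (k + i)) \<le> mom (2 * n + 3)" by (intro mom_antimono) auto
    have "mom (2 ^ k) \<le> K ^ i * mom (2 ^ (k + i))" by (rule mom_doubling_iterated)
    also have "\<dots> \<le> (2 ^ \<sigma>) ^ i * mom (2 * n + 3)"
      using \<open>mom (2 ^ (k + i)) \<le> mom (2 * n + 3)\<close> K(1) K_le mom2_pos[of "k + i"]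
      by (intro mult_mono power_mono) auto
    also have "(2 ^ \<sigma>) ^ i = ((2 :: real) ^ i) ^ \<sigma>" by (simp add: power_mult[symmetric] mult.commute)
    also have "(2 ^ i) ^ \<sigma> * mom (2 * n + 3) \<le> (6 * ((real n + 1) / 2 ^ k)) ^ \<sigma> * mom (2 * n + 3)"
    proof (intro mult_right_mono power_mono)
      have "2 ^ i \<le> 2 * y" using \<open>2 ^ j \<le> y\<close> j by simp
      also have "\<dots> \<le> 6 * ((real n + 1) / 2 ^ k)" by (simp add: y_def divide_right_mono)
      finally show "2 ^ i \<le> 6 * ((real n + 1) / 2 ^ k)" .
    qed (use m in auto)
    also have "\<dots> \<le> 6 ^ \<sigma> * (1 + ((real n + 1) / 2 ^ k) ^ \<sigma>) * mom (2 * n + 3)"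
      using m unfolding power_mult_distrib by (intro mult_right_mono mult_left_mono) auto
    finally show ?thesis .
  qed
  have "kb n \<le> 1 / mom (2 * n + 3)" by (rule kb_le_inverse_mom)
  also have "\<dots> \<le> 6 ^ \<sigma> * (1 + ((real n + 1) / 2 ^ k) ^ \<sigma>) / mom (2 ^ k)"
  proof -
    have "1 / b \<le> A / a" if "a \<le> A * b" "0 < a" "0 < b" for a b A :: real
      using that by (simp add: field_simps)
    from this[OF main mom2_pos m] show ?thesis .
  qed
  finally show ?thesis .
qed

text \<open>The majorant of |1 - w| times the modulus of the \<open>kb\<close> series on the circle
  |w| = \<rho>.\<close>

definition kD :: "real \<Rightarrow> real" where "kD \<rho> = (1 - \<rho>) * (\<Sum>n. kb n * \<rho> ^ n)"

definition Dc :: real where "Dc = 6 ^ \<sigma> * (1 + fact \<sigma>)"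

text \<open>The polynomial bound on \<open>kb\<close> is summed against \<rho>^n; since 1 / (1 -
  \<rho>) \<le> 2^k, the denominators (2^k)^\<sigma> absorb the excess power and only 1 / (1 -
  \<rho>) is left, cancelled by the factor in \<open>kD\<close>.\<close>

lemma kD_le:
  assumes \<rho>: "0 \<le> \<rho>" "\<rho> \<le> 1 - 1 / 2 ^ k"
  shows "kD \<rho> \<le> Dc / mom (2 ^ k)"
proof -
  have \<rho>1: "\<rho> < 1" using \<rho>(2) by (rule le_less_trans) simp
  have inv: "1 / (1 - \<rho>) \<le> 2 ^ k"
  proof -
    have "1 / x \<le> y" if "1 / y \<le> x" "0 < x" "0 < y" for x y :: real using that by (simp add: field_simps)
    from this[of "2 ^ k" "1 - \<rho>"] show ?thesis using \<rho> \<rho>1 by simp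
  qed
  have part: "(\<Sum>n<m. kb n * \<rho> ^ n) \<le> Dc / mom (2 ^ k) / (1 - \<rho>)" for m
  proof -
    have "(\<Sum>n<m. kb n * \<rho> ^ n) \<le> (\<Sum>n<m. 6 ^ \<sigma> / mom (2 ^ k) * ((real n + 1) ^ 0 * \<rho> ^ n + (1 / (2 ^ k) ^ \<sigma>) * ((real n + 1) ^ \<sigma> * \<rho> ^ n)))"
    proof (rule sum_mono)
      fix n
      have "kb n * \<rho> ^ n \<le> 6 ^ \<sigma> * (1 + ((real n + 1) / 2 ^ k) ^ \<sigma>) / mom (2 ^ k) * \<rho> ^ n"
        using \<rho> by (intro mult_right_mono kb_le) auto
      also have "\<dots> = 6 ^ \<sigma> / mom (2 ^ k) * ((real n + 1) ^ 0 * \<rho> ^ n + (1 / (2 ^ k) ^ \<sigma>) * ((real n + 1) ^ \<sigma> * \<rho> ^ n))"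
      proof -
        have "A * (1 + X / Y) / m * r = A / m * (1 * r + 1 / Y * (X * r))" for A X Y m r :: real
          by (simp add: algebra_simps add_divide_distrib)
        then show ?thesis unfolding power_divide power_0 .
      qed
      finally show "kb n * \<rho> ^ n \<le> 6 ^ \<sigma> / mom (2 ^ k) * ((real n + 1) ^ 0 * \<rho> ^ n + (1 / (2 ^ k) ^ \<sigma>) * ((real n + 1) ^ \<sigma> * \<rho> ^ n))" .
    qed
    also have "\<dots> = 6 ^ \<sigma> / mom (2 ^ k) * ((\<Sum>n<m. (real n + 1) ^ 0 * \<rho> ^ n) + (1 / (2 ^ k) ^ \<sigma>) * (\<Sum>n<m. (real n + 1) ^ \<sigma> * \<rho> ^ n))"
      by (simp only: sum_distrib_left[symmetric] sum.distrib)
    also have "\<dots> \<le> 6 ^ \<sigma> / mom (2 ^ k) * (fact 0 / (1 - \<rho>) ^ (0 + 1) + (1 / (2 ^ k) ^ \<sigma>) * (fact \<sigma> / (1 - \<rho>) ^ (\<sigma> + 1)))"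
      using mom2_pos[of k] \<rho> \<rho>1 by (intro mult_left_mono add_mono sum_power_geometric_le) auto
    also have "\<dots> = 6 ^ \<sigma> / mom (2 ^ k) * (1 / (1 - \<rho>) + (1 / (2 ^ k) ^ \<sigma>) * (fact \<sigma> * (1 / (1 - \<rho>)) ^ \<sigma> * (1 / (1 - \<rho>))))"
      by (simp add: power_one_over)
    also have "\<dots> \<le> 6 ^ \<sigma> / mom (2 ^ k) * (1 / (1 - \<rho>) + (1 / (2 ^ k) ^ \<sigma>) * (fact \<sigma> * (2 ^ k) ^ \<sigma> * (1 / (1 - \<rho>))))"
      using mom2_pos[of k] \<rho> \<rho>1 inv by (intro mult_left_mono add_left_mono mult_right_mono power_mono) auto
    also have "\<dots> = Dc / mom (2 ^ k) / (1 - \<rho>)" by (simp add: Dc_def add_divide_distrib distrib_left)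
    finally show ?thesis .
  qed
  have "(\<Sum>n. kb n * \<rho> ^ n) \<le> Dc / mom (2 ^ k) / (1 - \<rho>)"
    by (rule suminf_le_const[OF summable_kb[OF \<rho>(1) \<rho>1] part])
  then have "(1 - \<rho>) * (\<Sum>n. kb n * \<rho> ^ n) \<le> (1 - \<rho>) * (Dc / mom (2 ^ k) / (1 - \<rho>))"
    using \<rho>1 by (intro mult_left_mono) auto
  then show ?thesis using \<rho>1 by (simp add: kD_def)
qed

lemma kernel_deriv_bound:
  fixes w :: complex
  assumes "norm w < 1"
  shows "norm (\<Sum>n. of_real (kb n) * w ^ n) * norm (1 - w) \<le> kD (norm w)"
  unfolding kD_def using kb_pos[of 0] kb_mono summable_kb[of "norm w"] assms
  by (intro norm_power_series_increasing(1)) (auto simp: less_imp_le)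

lemma kb_power_le:
  assumes "0 \<le> \<rho>" "\<rho> < 1"
  shows "kb n * \<rho> ^ n \<le> kD \<rho>"
proof -
  have "kb n * norm (complex_of_real \<rho>) ^ n \<le> (1 - norm (complex_of_real \<rho>)) * (\<Sum>n. kb n * norm (complex_of_real \<rho>) ^ n)"
    using kb_pos[of 0] kb_mono summable_kb[of \<rho>] assms
    by (intro norm_power_series_increasing(2)) (auto simp: less_imp_le)
  then show ?thesis using assms by (simp add: kD_def)
qed

lemma weight_meas: "(\<lambda>t. ennreal (\<omega> t) * indicator (dyadic_interval k) t) \<in> borel_measurable lebesgue"
proof -
  have "(\<lambda>t. indicator {0..<1} t *\<^sub>R \<omega> t) \<in> borel_measurable lebesgue"
    using w_int unfolding set_integrable_def by simp
  moreover have "dyadic_interval k \<in> sets lebesgue" by simp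
  ultimately have "(\<lambda>t. ennreal (indicator {0..<1} t *\<^sub>R \<omega> t) * indicator (dyadic_interval k) t) \<in> borel_measurable lebesgue"
    by measurable
  also have "(\<lambda>t. ennreal (indicator {0..<1} t *\<^sub>R \<omega> t) * indicator (dyadic_interval k) t) = (\<lambda>t. ennreal (\<omega> t) * indicator (dyadic_interval k) t)"
    using subsetD[OF dyadic_interval_subset] by (fastforce simp: indicator_def)
  finally show ?thesis .
qed

definition Wc :: real where "Wc = max 4 ((LINT t:{0..<1}|lebesgue. \<omega> t) / mom 1)"

lemma Wc_pos: "0 < Wc"
  by (simp add: Wc_def less_max_iff_disj)

text \<open>For k \<ge> 1 the power t^(2^k) is at least 1/4 on interval k, by Bernoulli. Interval 0
  contains t = 0, where no power of t is bounded below, so there the total mass is compared with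
  \<open>mom 1\<close>; \<open>Wc\<close> is the larger constant.\<close>

lemma weight_dyadic_interval_le:
  "(\<integral>\<^sup>+t\<in>dyadic_interval k. ennreal (\<omega> t) \<partial>lebesgue) \<le> ennreal (Wc * mom (2 ^ k))"
proof -
  have nn: "(\<integral>\<^sup>+t\<in>dyadic_interval k. ennreal (\<omega> t) \<partial>lebesgue) \<le> ennreal (LINT t:{0..<1}|lebesgue. h t * \<omega> t)"
    if h: "\<And>t. t \<in> dyadic_interval k \<Longrightarrow> 1 \<le> h t" "\<And>t. t \<in> {0..<1} \<Longrightarrow> 0 \<le> h t"
      and hi: "set_integrable lebesgue {0..<1} (\<lambda>t. h t * \<omega> t)" for h
  proof -
    have "(\<integral>\<^sup>+t\<in>dyadic_interval k. ennreal (\<omega> t) \<partial>lebesgue) \<le> (\<integral>\<^sup>+t. ennreal (indicator {0..<1} t *\<^sub>R (h t * \<omega> t)) \<partial>lebesgue)"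
    proof (rule nn_integral_mono)
      fix t
      show "ennreal (\<omega> t) * indicator (dyadic_interval k) t \<le> ennreal (indicator {0..<1} t *\<^sub>R (h t * \<omega> t))"
      proof (cases "t \<in> dyadic_interval k")
        case True
        then have t: "t \<in> {0..<1}" by (rule subsetD[OF dyadic_interval_subset])
        have "1 * \<omega> t \<le> h t * \<omega> t" using h(1)[OF True] w_nonneg[OF t] by (rule mult_right_mono)
        then show ?thesis using True t by (simp add: ennreal_leI)
      qed simp
    qed
    also have "\<dots> = ennreal (LINT t:{0..<1}|lebesgue. h t * \<omega> t)"
      unfolding set_lebesgue_integral_def using hi w_nonneg h(2)
      by (intro nn_integral_eq_integral) (auto simp: set_integrable_def indicator_def)
    finally show ?thesis .
  qed
  show ?thesis
  proof (cases "k = 0")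
    case True
    have "(LINT t:{0..<1}|lebesgue. 1 * \<omega> t) = (LINT t:{0..<1}|lebesgue. \<omega> t) / mom 1 * mom 1"
      using mom_pos[of 1] by simp
    also have "\<dots> \<le> Wc * mom 1"
      using mom_pos[of 1] by (intro mult_right_mono) (auto simp: Wc_def)
    finally have "(LINT t:{0..<1}|lebesgue. 1 * \<omega> t) \<le> Wc * mom (2 ^ k)" using True by simp
    then have "ennreal (LINT t:{0..<1}|lebesgue. 1 * \<omega> t) \<le> ennreal (Wc * mom (2 ^ k))" by (rule ennreal_leI)
    then show ?thesis using order_trans[OF nn[of "\<lambda>_. 1"]] w_int by simp
  next
    case False
    then obtain j where j: "k = Suc j" by (cases k) auto
    have "(LINT t:{0..<1}|lebesgue. 4 * t ^ (2 ^ k) * \<omega> t) = 4 * mom (2 ^ k)"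
      by (simp add: mom_eq mult.assoc)
    also have "\<dots> \<le> Wc * mom (2 ^ k)" using mom2_pos[of k] by (intro mult_right_mono) (auto simp: Wc_def)
    finally have "ennreal (LINT t:{0..<1}|lebesgue. 4 * t ^ (2 ^ k) * \<omega> t) \<le> ennreal (Wc * mom (2 ^ k))"
      by (rule ennreal_leI)
    moreover have "(\<integral>\<^sup>+t\<in>dyadic_interval k. ennreal (\<omega> t) \<partial>lebesgue) \<le> ennreal (LINT t:{0..<1}|lebesgue. 4 * t ^ (2 ^ k) * \<omega> t)"
    proof (rule nn)
      fix t assume t: "t \<in> dyadic_interval k"
      have "(1 / 2) ^ 2 \<le> (1 - 1 / (2 * real (2 ^ j))) ^ (2 ^ j * 2)" by (rule power_one_minus_ge) simp
      also have "\<dots> \<le> t ^ (2 ^ k)"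
      proof -
        have "(1 - 1 / (2 * real (2 ^ j))) ^ (2 ^ j * 2) = (1 - 1 / 2 ^ k) ^ (2 ^ k)" by (simp add: j mult.commute)
        also have "\<dots> \<le> t ^ (2 ^ k)"
        proof (rule power_mono)
          show "1 - 1 / 2 ^ k \<le> t" using dyadic_interval_one_minus[OF t] by simp
          show "0 \<le> 1 - 1 / (2::real) ^ k" by simp
        qed
        finally show ?thesis .
      qed
      finally show "1 \<le> 4 * t ^ (2 ^ k)" by (simp add: power2_eq_square)
    next
      show "set_integrable lebesgue {0..<1} (\<lambda>t. 4 * t ^ (2 ^ k) * \<omega> t)"
        using mom_integrable[of "2 ^ k"] by (simp add: mult.assoc)
    qed auto
    ultimately show ?thesis by (rule order_trans[rotated])
  qed
qed

text \<open>The product t r stays below both dyadic levels, so the coarser one decides; one doubling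
  step shifts the index from Suc to the plain minimum. The alternative k \<le> j admits r = 1, as
  needed for the Taylor coefficients.\<close>

lemma kD_dyadic_le:
  assumes "t \<in> dyadic_interval k" "0 \<le> r" "r \<le> 1" "r \<le> 1 - 1 / 2 ^ Suc j \<or> k \<le> j"
  shows "kD (t * r) \<le> Dc * K / mom (2 ^ min j k)"
proof -
  have t: "0 \<le> t" "t < 1" using subsetD[OF dyadic_interval_subset assms(1)] by auto
  note tk = dyadic_interval_one_minus(1)[OF assms(1)]
  have "t * r \<le> 1 - 1 / 2 ^ Suc (min j k)"
  proof (cases "k \<le> j")
    case True
    have "t * r \<le> t * 1" using t assms by (intro mult_left_mono) auto
    then show ?thesis using tk True by (simp add: min_def)
  next
    case False
    have "t * r \<le> 1 * r" using t assms by (intro mult_right_mono) auto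
    then show ?thesis using assms(4) False by (simp add: min_def)
  qed
  then have "kD (t * r) \<le> Dc / mom (2 ^ Suc (min j k))" using t assms by (intro kD_le) auto
  also have "\<dots> \<le> Dc * K / mom (2 ^ min j k)"
  proof -
    have "D / b \<le> D * K / a" if "a \<le> K * b" "0 < a" "0 < b" "0 \<le> D" for a b D :: real
    proof -
      have "1 / b \<le> K / a" using that by (simp add: field_simps)
      then have "D * (1 / b) \<le> D * (K / a)" using that by (intro mult_left_mono) auto
      then show ?thesis by simp
    qed
    from this[OF K(2) mom2_pos mom2_pos] show ?thesis by (simp add: Dc_def)
  qed
  finally show ?thesis .
qed

text \<open>One constant for all estimates: 2 Dc K is for the derivative, Dc K and K K are for the
  two cases of the coefficient bound.\<close>

definition Bc :: real where "Bc = 2 * (Dc * K) + K * K"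

lemma Bc_bounds: "0 \<le> Bc" "2 * (Dc * K) \<le> Bc" "Dc * K \<le> Bc" "K * K \<le> Bc"
proof -
  have "0 \<le> Dc * K" using K(1) by (simp add: Dc_def)
  moreover have "0 \<le> K * K" by simp
  ultimately show "0 \<le> Bc" "2 * (Dc * K) \<le> Bc" "Dc * K \<le> Bc" "K * K \<le> Bc" unfolding Bc_def by linarith+
qed

definition s :: real where "s = 2 powr (1 / p)"

text \<open>The second entry is the decay of the moments measured against the normalisation s; it is
  below 1 precisely when q < p.\<close>

definition \<eta> :: real where "\<eta> = max (1 / s) (s * (1 / 2 powr (1 / q)))"

lemma p_gt_1: "1 < p"
  using q pq by simp

lemma s_gt_1: "1 < s"
  using root2_bounds(1)[of p] p_gt_1 by (simp add: s_def)

lemma \<eta>_bounds: "0 \<le> \<eta>" "\<eta> < 1"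
proof -
  have "1 / p < 1 / q" using q pq by (intro divide_strict_left_mono) auto
  then have "s < 2 powr (1 / q)" unfolding s_def by (intro powr_less_mono) auto
  then show "0 \<le> \<eta>" "\<eta> < 1" using s_gt_1 by (auto simp: \<eta>_def max_def)
qed

section \<open>The image of a function with a dyadic majorant\<close>

context
  fixes g :: "nat \<Rightarrow> real" and L :: real and \<phi> :: "real \<Rightarrow> complex" and v :: "real \<Rightarrow> complex"
  assumes g: "\<And>k. 0 \<le> g k" and gL: "\<And>n. (\<Sum>k<n. g k powr p / 2 ^ k) \<le> L"
    and v: "continuous_on {0..<1} v" "\<And>k t. t \<in> dyadic_interval k \<Longrightarrow> norm (v t) \<le> g k"
    and \<phi>: "\<And>t. \<phi> t = v t * of_real (\<omega> t)"
begin

definition S :: "nat \<Rightarrow> real" where "S j = (\<Sum>k. \<eta> ^ (j - k + (k - j)) * (g k / s ^ k))"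

lemma S_facts: "summable (\<lambda>k. \<eta> ^ (j - k + (k - j)) * (g k / s ^ k))" "0 \<le> S j"
  "(\<Sum>j<n. S j powr p) \<le> (2 / (1 - \<eta>)) powr p * L"
proof -
  have p1: "1 \<le> p" using p_gt_1 by simp
  have x0: "0 \<le> g k / s ^ k" for k using g s_gt_1 by simp
  have "(g k / s ^ k) powr p = g k powr p / 2 ^ k" for k
    using g s_gt_1 root2_powr[of p k] p1 by (simp add: powr_divide s_def)
  then have xL: "(\<Sum>k<m. (g k / s ^ k) powr p) \<le> L" for m using gL by simp
  note sch = schur_dyadic[OF \<eta>_bounds p1 x0 xL]
  show "summable (\<lambda>k. \<eta> ^ (j - k + (k - j)) * (g k / s ^ k))" by (rule sch(1))
  show "0 \<le> S j" unfolding S_def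
    by (intro suminf_nonneg sch(1) mult_nonneg_nonneg zero_le_power x0 \<eta>_bounds)
  show "(\<Sum>j<n. S j powr p) \<le> (2 / (1 - \<eta>)) powr p * L" unfolding S_def by (rule sch(2))
qed

text \<open>For k \<le> j the quotient is 1 and the decay comes from s^k being smaller than s^j. For
  k > j the decay of the moments with exponent 1/q outweighs the growth of s^k, with exponent
  1/p.\<close>

lemma moment_ratio_le:
  "g k * (mom (2 ^ k) / mom (2 ^ min j k)) \<le> max 1 C * s ^ j * (\<eta> ^ (j - k + (k - j)) * (g k / s ^ k))"
proof -
  have "mom (2 ^ k) / mom (2 ^ min j k) * s ^ k \<le> max 1 C * s ^ j * \<eta> ^ (j - k + (k - j))"
  proof (cases "k \<le> j")
    case True
    then have e: "s ^ j = s ^ k * s ^ (j - k)" by (simp flip: power_add)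
    have "1 \<le> s * \<eta>"
      using s_gt_1 by (simp add: \<eta>_def max_def field_simps)
    then have "1 \<le> s ^ (j - k) * \<eta> ^ (j - k)" using one_le_power[of "s * \<eta>" "j - k"] by (simp add: power_mult_distrib)
    then have "1 * (s ^ k * 1) \<le> max 1 C * (s ^ k * (s ^ (j - k) * \<eta> ^ (j - k)))"
      using s_gt_1 by (intro mult_mono mult_left_mono) auto
    moreover have "min j k = k" "j - k + (k - j) = j - k" using True by simp_all
    ultimately show ?thesis unfolding e using mom2_pos[of k] by (simp only: mult.assoc) simp
  next
    case False
    then obtain m where m: "k = j + m" by (metis le_add_diff_inverse nat_le_linear)
    have "mom (2 ^ k) \<le> C * (1 / 2 powr (1 / q)) ^ m * mom (2 ^ j)" using C(2)[of j k] m by simp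
    then have "mom (2 ^ k) / mom (2 ^ min j k) \<le> C * (1 / 2 powr (1 / q)) ^ m"
      using mom2_pos[of j] m by (simp add: pos_divide_le_eq)
    then have "mom (2 ^ k) / mom (2 ^ min j k) * s ^ k \<le> C * (1 / 2 powr (1 / q)) ^ m * s ^ k"
      using s_gt_1 by (intro mult_right_mono) auto
    also have "\<dots> = C * s ^ j * (s * (1 / 2 powr (1 / q))) ^ m"
      unfolding m power_add power_mult_distrib by (simp only: mult_ac)
    also have "\<dots> \<le> max 1 C * s ^ j * \<eta> ^ m"
      using s_gt_1 C(1) by (intro mult_mono power_mono mult_nonneg_nonneg) (auto simp: \<eta>_def)
    finally show ?thesis using m by simp
  qed
  then have "mom (2 ^ k) / mom (2 ^ min j k) * s ^ k * (g k / s ^ k) \<le> max 1 C * s ^ j * \<eta> ^ (j - k + (k - j)) * (g k / s ^ k)"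
    using g s_gt_1 by (intro mult_right_mono) auto
  then show ?thesis using s_gt_1 by (simp add: mult_ac)
qed

lemma \<phi>_meas: "(\<lambda>t. indicator {0..<1} t *\<^sub>R \<phi> t) \<in> borel_measurable lebesgue"
proof -
  have "(\<lambda>t. indicator {0..<1} t *\<^sub>R v t) \<in> borel_measurable lborel"
    using borel_measurable_continuous_on_indicator[OF _ v(1)] by simp
  then have 1: "(\<lambda>t. indicator {0..<1} t *\<^sub>R v t) \<in> borel_measurable lebesgue" by (rule measurable_completion)
  have "(\<lambda>t. indicator {0..<1} t *\<^sub>R \<omega> t) \<in> borel_measurable lebesgue"
    using w_int unfolding set_integrable_def by simp
  then have "(\<lambda>t. complex_of_real (indicator {0..<1} t *\<^sub>R \<omega> t)) \<in> borel_measurable lebesgue" by measurable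
  with 1 have "(\<lambda>t. (indicator {0..<1} t *\<^sub>R v t) * complex_of_real (indicator {0..<1} t *\<^sub>R \<omega> t)) \<in> borel_measurable lebesgue"
    by measurable
  also have "(\<lambda>t. (indicator {0..<1} t *\<^sub>R v t) * complex_of_real (indicator {0..<1} t *\<^sub>R \<omega> t)) = (\<lambda>t. indicator {0..<1} t *\<^sub>R \<phi> t)"
    by (auto simp: indicator_def \<phi>)
  finally show ?thesis .
qed

text \<open>The central estimate: on interval k the integrand is at most g k times B / mom (2 ^ min
  j k) times \<omega>, and \<omega> has mass about mom (2^k) there, so the quotient of moments
  appears and the sum over k becomes S j.\<close>

lemma weighted_integral_le:
  assumes B: "0 \<le> B" and h: "\<And>k t. t \<in> dyadic_interval k \<Longrightarrow> h t \<le> B / mom (2 ^ min j k)"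
  shows "(\<integral>\<^sup>+t\<in>{0..<1}. ennreal (norm (\<phi> t) * h t) \<partial>lebesgue) \<le> ennreal (B * Wc * max 1 C * (s ^ j * S j))"
proof -
  have "(\<integral>\<^sup>+t\<in>{0..<1}. ennreal (norm (\<phi> t) * h t) \<partial>lebesgue)
      \<le> (\<integral>\<^sup>+t. (\<Sum>k. ennreal (g k * (B / mom (2 ^ min j k))) * (ennreal (\<omega> t) * indicator (dyadic_interval k) t)) \<partial>lebesgue)"
  proof (rule nn_integral_mono)
    fix t :: real
    show "ennreal (norm (\<phi> t) * h t) * indicator {0..<1} t
        \<le> (\<Sum>k. ennreal (g k * (B / mom (2 ^ min j k))) * (ennreal (\<omega> t) * indicator (dyadic_interval k) t))"
    proof (cases "t \<in> {0..<1}")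
      case True
      then have "t \<in> (\<Union>k. dyadic_interval k)" unfolding UN_dyadic_interval .
      then obtain k where k: "t \<in> dyadic_interval k" by blast
      have "norm (\<phi> t) * h t \<le> norm (\<phi> t) * (B / mom (2 ^ min j k))"
        by (intro mult_left_mono h k) simp
      also have "\<dots> \<le> g k * \<omega> t * (B / mom (2 ^ min j k))"
        using v(2)[OF k] w_nonneg[OF True] B mom2_pos[of "min j k"]
        by (intro mult_right_mono) (auto simp: \<phi> norm_mult intro!: mult_right_mono)
      finally have "norm (\<phi> t) * h t \<le> g k * (B / mom (2 ^ min j k)) * \<omega> t" by (simp only: mult_ac)
      then have "ennreal (norm (\<phi> t) * h t) * indicator {0..<1} t \<le> ennreal (g k * (B / mom (2 ^ min j k)) * \<omega> t)"
        using True by (simp add: ennreal_leI)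
      also have "\<dots> = ennreal (g k * (B / mom (2 ^ min j k))) * ennreal (\<omega> t)"
        using g B mom2_pos[of "min j k"] w_nonneg[OF True] by (intro ennreal_mult mult_nonneg_nonneg) auto
      also have "\<dots> = (\<Sum>k\<in>{k}. ennreal (g k * (B / mom (2 ^ min j k))) * (ennreal (\<omega> t) * indicator (dyadic_interval k) t))"
        using k by simp
      also have "\<dots> \<le> (\<Sum>k. ennreal (g k * (B / mom (2 ^ min j k))) * (ennreal (\<omega> t) * indicator (dyadic_interval k) t))"
        by (intro sum_le_suminf) auto
      finally show ?thesis .
    qed simp
  qed
  also have "\<dots> = (\<Sum>k. \<integral>\<^sup>+t. ennreal (g k * (B / mom (2 ^ min j k))) * (ennreal (\<omega> t) * indicator (dyadic_interval k) t) \<partial>lebesgue)"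
    using weight_meas by (intro nn_integral_suminf) simp
  also have "\<dots> \<le> (\<Sum>k. ennreal (B * Wc * max 1 C * s ^ j * (\<eta> ^ (j - k + (k - j)) * (g k / s ^ k))))"
  proof (intro suminf_le)
    fix k
    have "(\<integral>\<^sup>+t. ennreal (g k * (B / mom (2 ^ min j k))) * (ennreal (\<omega> t) * indicator (dyadic_interval k) t) \<partial>lebesgue)
      = ennreal (g k * (B / mom (2 ^ min j k))) * (\<integral>\<^sup>+t\<in>dyadic_interval k. ennreal (\<omega> t) \<partial>lebesgue)"
      using weight_meas by (intro nn_integral_cmult) simp
    also have "\<dots> \<le> ennreal (g k * (B / mom (2 ^ min j k))) * ennreal (Wc * mom (2 ^ k))"
      by (intro mult_left_mono weight_dyadic_interval_le) auto
    also have "\<dots> = ennreal (B * Wc * (g k * (mom (2 ^ k) / mom (2 ^ min j k))))"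
      using g[of k] B mom2_pos[of "min j k"] mom2_pos[of k] Wc_pos by (subst ennreal_mult[symmetric]) (auto simp: mult_ac)
    also have "\<dots> \<le> ennreal (B * Wc * (max 1 C * s ^ j * (\<eta> ^ (j - k + (k - j)) * (g k / s ^ k))))"
      using B Wc_pos by (intro ennreal_leI mult_left_mono moment_ratio_le) auto
    finally show "(\<integral>\<^sup>+t. ennreal (g k * (B / mom (2 ^ min j k))) * (ennreal (\<omega> t) * indicator (dyadic_interval k) t) \<partial>lebesgue)
        \<le> ennreal (B * Wc * max 1 C * s ^ j * (\<eta> ^ (j - k + (k - j)) * (g k / s ^ k)))"
      by (simp only: mult.assoc)
  qed auto
  also have "\<dots> \<le> ennreal (B * Wc * max 1 C * (s ^ j * S j))"
  proof (rule suminf_ennreal_le)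
    fix n
    have "(\<Sum>k<n. B * Wc * max 1 C * s ^ j * (\<eta> ^ (j - k + (k - j)) * (g k / s ^ k)))
        = B * Wc * max 1 C * s ^ j * (\<Sum>k<n. \<eta> ^ (j - k + (k - j)) * (g k / s ^ k))"
      by (simp only: sum_distrib_left)
    also have "\<dots> \<le> B * Wc * max 1 C * s ^ j * S j"
      unfolding S_def using B Wc_pos s_gt_1 \<eta>_bounds g
      by (intro mult_left_mono sum_le_suminf S_facts(1)) auto
    finally show "(\<Sum>k<n. B * Wc * max 1 C * s ^ j * (\<eta> ^ (j - k + (k - j)) * (g k / s ^ k))) \<le> B * Wc * max 1 C * (s ^ j * S j)"
      by (simp only: mult.assoc)
  qed (use B Wc_pos s_gt_1 \<eta>_bounds g in auto)
  finally show ?thesis .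
qed

lemma \<phi>_int: "set_integrable lebesgue {0..<1} \<phi>"
  unfolding set_integrable_def
proof (rule integrableI_bounded[OF \<phi>_meas])
  have "(\<integral>\<^sup>+t. ennreal (norm (indicator {0..<1} t *\<^sub>R \<phi> t)) \<partial>lebesgue) = (\<integral>\<^sup>+t\<in>{0..<1}. ennreal (norm (\<phi> t) * 1) \<partial>lebesgue)"
    by (intro nn_integral_cong) (auto simp: indicator_def)
  \<comment> \<open>The case j = 0 with B = mom 1, for which B / mom (2 ^ min j k) is identically
    1.\<close>
  also have "\<dots> \<le> ennreal (mom 1 * Wc * max 1 C * (s ^ 0 * S 0))"
    using mom_pos[of 1] by (intro weighted_integral_le) auto
  also have "\<dots> < \<infinity>" by simp
  finally show "(\<integral>\<^sup>+t. ennreal (norm (indicator {0..<1} t *\<^sub>R \<phi> t)) \<partial>lebesgue) < \<infinity>" .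
qed

lemma norm_integral_le:
  assumes h: "0 \<le> B" "\<And>k t. t \<in> dyadic_interval k \<Longrightarrow> h t \<le> B / mom (2 ^ min j k)"
    and \<psi>: "\<And>t. t \<in> {0..<1} \<Longrightarrow> norm (\<psi> t :: complex) \<le> norm (\<phi> t) * h t" "set_integrable lebesgue {0..<1} \<psi>"
  shows "norm (LINT t:{0..<1}|lebesgue. \<psi> t) \<le> B * Wc * max 1 C * (s ^ j * S j)"
proof -
  have "ennreal (norm (LINT t:{0..<1}|lebesgue. \<psi> t)) \<le> (\<integral>\<^sup>+t. ennreal (norm (indicator {0..<1} t *\<^sub>R \<psi> t)) \<partial>lebesgue)"
    unfolding set_lebesgue_integral_def using \<psi>(2) by (intro integral_norm_bound_ennreal) (simp add: set_integrable_def)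
  also have "\<dots> \<le> (\<integral>\<^sup>+t\<in>{0..<1}. ennreal (norm (\<phi> t) * h t) \<partial>lebesgue)"
    using \<psi>(1) by (intro nn_integral_mono) (auto simp: indicator_def intro!: ennreal_leI)
  also have "\<dots> \<le> ennreal (B * Wc * max 1 C * (s ^ j * S j))" by (rule weighted_integral_le[OF h])
  finally show ?thesis
    by (rule iffD1[OF ennreal_le_iff, rotated]) (use h(1) Wc_pos s_gt_1 S_facts(2)[of j] in auto)
qed

context
  fixes F :: "complex \<Rightarrow> complex"
  assumes F: "\<And>z. norm z < 1 \<Longrightarrow> F z = hilb \<phi> z"
begin

lemma F_series: "norm z < 1 \<Longrightarrow> (\<lambda>n. (of_real (kc n) * (LINT t:{0..<1}|lebesgue. \<phi> t * of_real t ^ n)) * z ^ n) sums F z"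
  using hilb_series[OF \<phi>_int, of z] F by simp

lemma \<phi>_power_int: "set_integrable lebesgue {0..<1} (\<lambda>t. \<phi> t * of_real t ^ n)"
proof -
  have "set_integrable lebesgue {0..<1} (\<lambda>t. of_real t ^ n * \<phi> t)"
    by (rule set_integrable_continuous_mult[OF \<phi>_int, where B = 1])
       (auto intro!: continuous_intros simp: norm_power power_le_one)
  then show ?thesis by (simp add: mult.commute)
qed

text \<open>F' is the integral of t \<phi>(t) against the \<open>kb\<close> series at t z. The
  factor |1 - z| is moved under the integral and replaced by 2 |1 - t z|, the weight that
  \<open>kernel_deriv_bound\<close> can handle.\<close>

lemma F_deriv_bound:
  assumes z: "norm z \<le> 1 - 1 / 2 ^ Suc j"
  shows "norm (deriv F z) * norm (1 - z) \<le> Bc * Wc * max 1 C * (s ^ j * S j)"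
proof -
  have z1: "norm z < 1" using z by (rule le_less_trans) simp
  let ?\<phi> = "\<lambda>t. \<phi> t * of_real t ^ 1"
  have sm: "summable (\<lambda>n. norm (complex_of_real (kb n)) * norm z ^ n)"
    using summable_kb[of "norm z"] z1 kb_pos by (simp add: less_imp_le)
  note swap = integral_power_series_swap[OF \<phi>_power_int[of 1] sm]
  have "(\<lambda>n. of_nat (Suc n) * (of_real (kc (Suc n)) * (LINT t:{0..<1}|lebesgue. \<phi> t * of_real t ^ Suc n)) * z ^ n) sums deriv F z"
    by (rule power_series_on_disc(3)[OF F_series z1])
  moreover have "of_nat (Suc n) * (of_real (kc (Suc n)) * (LINT t:{0..<1}|lebesgue. \<phi> t * of_real t ^ Suc n)) * z ^ n
      = of_real (kb n) * (LINT t:{0..<1}|lebesgue. ?\<phi> t * of_real t ^ n) * z ^ n" for n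
    by (simp add: kb_def mult.assoc add.commute)
  ultimately have "(\<lambda>n. of_real (kb n) * (LINT t:{0..<1}|lebesgue. ?\<phi> t * of_real t ^ n) * z ^ n) sums deriv F z"
    by (simp only:)
  from sums_unique2[OF this swap(2)]
  have "deriv F z = (LINT t:{0..<1}|lebesgue. ?\<phi> t * (\<Sum>n. of_real (kb n) * (of_real t * z) ^ n))" .
  then have eq: "norm (deriv F z) * norm (1 - z) = norm (LINT t:{0..<1}|lebesgue. (?\<phi> t * (\<Sum>n. of_real (kb n) * (of_real t * z) ^ n)) * (1 - z))"
    by (simp add: norm_mult)
  show ?thesis unfolding eq
  proof (rule norm_integral_le[where h = "\<lambda>t. 2 * kD (t * norm z)"])
    fix k t assume t: "t \<in> dyadic_interval k"
    have "2 * kD (t * norm z) \<le> 2 * (Dc * K / mom (2 ^ min j k))"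
      using kD_dyadic_le[OF t, of "norm z" j] z z1 by simp
    also have "\<dots> \<le> Bc / mom (2 ^ min j k)"
      using Bc_bounds(2) mom2_pos[of "min j k"] divide_right_mono[of "2 * (Dc * K)" Bc "mom (2 ^ min j k)"] by simp
    finally show "2 * kD (t * norm z) \<le> Bc / mom (2 ^ min j k)" .
  next
    fix t :: real assume "t \<in> {0..<1}"
    then have t: "0 \<le> t" "t < 1" by auto
    let ?A = "\<Sum>n. complex_of_real (kb n) * (of_real t * z) ^ n"
    have n: "norm (of_real t * z) = t * norm z" using t by (simp add: norm_mult)
    have tz: "t * norm z \<le> 1 * norm z" using t by (intro mult_right_mono) auto
    \<comment> \<open>The difference of 1 - z and 1 - t z has modulus (1 - t) |z| \<le> 1 - t |z|,
      hence at most |1 - t z|.\<close>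
    have "norm (1 - z) \<le> 2 * norm (1 - of_real t * z)"
    proof -
      have "1 - z = (1 - of_real t * z) - of_real (1 - t) * z" by (simp add: algebra_simps)
      then have "norm (1 - z) \<le> norm (1 - of_real t * z) + norm (of_real (1 - t) * z)"
        by (metis norm_triangle_ineq4)
      also have "norm (of_real (1 - t) * z) = (1 - t) * norm z" using t by (simp add: norm_mult flip: of_real_diff)
      also have "(1 - t) * norm z \<le> norm (1 - of_real t * z)"
      proof -
        have "(1 - t) * norm z \<le> (1 - t) * 1" using t z1 by (intro mult_left_mono) auto
        also have "\<dots> \<le> 1 - t * norm z" using t z1 mult_left_le[of "norm z" t] by simp
        also have "\<dots> \<le> norm (1 - of_real t * z)" using norm_one_minus_ge[of "of_real t * z"] n by simp
        finally show ?thesis .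
      qed
      finally show ?thesis by simp
    qed
    then have "norm ?A * norm (1 - z) \<le> norm ?A * (2 * norm (1 - of_real t * z))" by (rule mult_left_mono) simp
    also have "\<dots> = 2 * (norm ?A * norm (1 - of_real t * z))" by simp
    also have "\<dots> \<le> 2 * kD (t * norm z)"
      using kernel_deriv_bound[of "of_real t * z"] n tz z1 by (intro mult_left_mono) auto
    finally have A: "norm ?A * norm (1 - z) \<le> 2 * kD (t * norm z)" .
    have "norm (?\<phi> t) \<le> norm (\<phi> t)" using t by (simp add: norm_mult mult_left_le)
    then have "norm (?\<phi> t) * (norm ?A * norm (1 - z)) \<le> norm (\<phi> t) * (2 * kD (t * norm z))"
      by (rule mult_mono[OF _ A]) simp_all
    then show "norm (?\<phi> t * ?A * (1 - z)) \<le> norm (\<phi> t) * (2 * kD (t * norm z))"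
      by (simp only: norm_mult mult.assoc)
  next
    show "set_integrable lebesgue {0..<1} (\<lambda>t. ?\<phi> t * (\<Sum>n. of_real (kb n) * (of_real t * z) ^ n) * (1 - z))"
      using swap(1) by simp
  qed (rule Bc_bounds(1))
qed

text \<open>For intervals k \<le> j the power t^n is essential and a single term of the
  \<open>kb\<close> series is dominated by \<open>kD t\<close>. For k > j it is dropped: n + 1 < 2 ^
  Suc j gives 2 n + 3 \<le> 2^(j+2), and two doublings compare this with 2^j.\<close>

lemma F_coeff_bound:
  assumes n: "n + 1 < 2 ^ Suc j"
  shows "(real n + 1) * norm (taylor_coeff F (Suc n)) \<le> Bc * Wc * max 1 C * (s ^ j * S j)"
proof -
  have "taylor_coeff F (Suc n) = of_real (kc (Suc n)) * (LINT t:{0..<1}|lebesgue. \<phi> t * of_real t ^ Suc n)"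
    by (rule power_series_on_disc(2)[OF F_series])
  then have "(real n + 1) * norm (taylor_coeff F (Suc n)) = norm (LINT t:{0..<1}|lebesgue. \<phi> t * of_real t ^ Suc n * of_real (kb n))"
    unfolding set_integral_mult_left norm_mult norm_of_real
    using kb_pos[of n] kc_pos[of "Suc n"] by (simp add: norm_mult kb_def)
  also have "\<dots> \<le> Bc * Wc * max 1 C * (s ^ j * S j)"
  proof (rule norm_integral_le[where h = "\<lambda>t. kb n * t ^ n"])
    fix k t assume t: "t \<in> dyadic_interval k"
    then have t01: "0 \<le> t" "t < 1" using subsetD[OF dyadic_interval_subset t] by auto
    show "kb n * t ^ n \<le> Bc / mom (2 ^ min j k)"
    proof (cases "k \<le> j")
      case True
      have "kb n * t ^ n \<le> kD (t * 1)" using kb_power_le[OF t01] by simp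
      also have "\<dots> \<le> Dc * K / mom (2 ^ min j k)" using True by (intro kD_dyadic_le[OF t]) auto
      also have "\<dots> \<le> Bc / mom (2 ^ min j k)" using mom2_pos[of "min j k"] by (intro divide_right_mono Bc_bounds) auto
      finally show ?thesis .
    next
      case False
      have m: "0 < mom (2 * n + 3)" by (rule mom_pos) simp
      have "2 * n + 3 \<le> 2 ^ (j + 2)" using n by simp
      then have "mom (2 ^ (j + 2)) \<le> mom (2 * n + 3)" by (intro mom_antimono) auto
      then have "K ^ 2 * mom (2 ^ (j + 2)) \<le> K ^ 2 * mom (2 * n + 3)" by (intro mult_left_mono) auto
      then have mm: "mom (2 ^ j) \<le> K * K * mom (2 * n + 3)"
        using mom_doubling_iterated[of j 2] by (simp add: power2_eq_square)
      have "kb n * t ^ n \<le> kb n * 1" using t01 kb_pos[of n] by (intro mult_left_mono power_le_one) auto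
      also have "kb n \<le> 1 / mom (2 * n + 3)" by (rule kb_le_inverse_mom)
      also have "\<dots> \<le> K * K / mom (2 ^ j)"
      proof -
        have "1 / b \<le> A / a" if "a \<le> A * b" "0 < a" "0 < b" for a b A :: real
          using that by (simp add: field_simps)
        from this[OF mm mom2_pos m] show ?thesis .
      qed
      also have "\<dots> \<le> Bc / mom (2 ^ j)" using mom2_pos[of j] by (intro divide_right_mono Bc_bounds) auto
      finally show ?thesis using False by (simp add: min_def)
    qed
  next
    fix t :: real assume "t \<in> {0..<1}"
    then have t: "0 \<le> t" "t < 1" by auto
    have "t ^ Suc n \<le> t ^ n" using t by (intro power_decreasing) auto
    then have "norm (\<phi> t) * (kb n * t ^ Suc n) \<le> norm (\<phi> t) * (kb n * t ^ n)"
      using kb_pos[of n] by (intro mult_left_mono) auto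
    then show "norm (\<phi> t * of_real t ^ Suc n * of_real (kb n)) \<le> norm (\<phi> t) * (kb n * t ^ n)"
      using t kb_pos[of n] by (simp add: norm_mult norm_power mult_ac)
  next
    show "set_integrable lebesgue {0..<1} (\<lambda>t. \<phi> t * of_real t ^ Suc n * of_real (kb n))"
      using \<phi>_power_int[of "Suc n"] by simp
  qed (rule Bc_bounds(1))
  finally show ?thesis .
qed

lemma F_admissible:
  "derivative_bound.admissible p (kc 0 * (mom 1 * Wc * max 1 C * ((2 / (1 - \<eta>)) powr p * L) powr (1 / p)))
    ((Bc * Wc * max 1 C) powr p * ((2 / (1 - \<eta>)) powr p * L)) F (\<lambda>j. Bc * Wc * max 1 C * (s ^ j * S j))"
proof -
  let ?A = "Bc * Wc * max 1 C"
  let ?Q = "(2 / (1 - \<eta>)) powr p * L"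
  have p0: "0 < p" using p_gt_1 by simp
  have L0: "0 \<le> L" using gL[of 0] by simp
  have A0: "0 \<le> ?A" using Bc_bounds(1) Wc_pos by simp
  have db: "derivative_bound p (kc 0 * (mom 1 * Wc * max 1 C * ?Q powr (1 / p))) (?A powr p * ?Q)"
    using p_gt_1 L0 kc_pos[of 0] mom_pos[of 1] Wc_pos by unfold_locales auto
  have F0: "norm (F 0) \<le> kc 0 * (mom 1 * Wc * max 1 C * ?Q powr (1 / p))"
  proof -
    have "F 0 = of_real (kc 0) * (LINT t:{0..<1}|lebesgue. \<phi> t * of_real t ^ 0)"
      using power_series_on_disc(2)[OF F_series, of 0] by (simp add: taylor_coeff_def)
    then have "norm (F 0) = kc 0 * norm (LINT t:{0..<1}|lebesgue. \<phi> t)"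
      using kc_pos[of 0] by (simp add: norm_mult)
    also have "norm (LINT t:{0..<1}|lebesgue. \<phi> t) \<le> mom 1 * Wc * max 1 C * (s ^ 0 * S 0)"
      using mom_pos[of 1] by (intro norm_integral_le[where h = "\<lambda>_. 1"] \<phi>_int) auto
    also have "s ^ 0 * S 0 \<le> ?Q powr (1 / p)"
    proof -
      have "S 0 powr p \<le> ?Q" using S_facts(3)[of 1] by simp
      then have "(S 0 powr p) powr (1 / p) \<le> ?Q powr (1 / p)" using p0 by (intro powr_mono2) auto
      then show ?thesis using S_facts(2)[of 0] p0 by (simp add: powr_powr)
    qed
    finally show ?thesis using kc_pos[of 0] mom_pos[of 1] Wc_pos by (simp add: mult_left_mono)
  qed
  have sum: "(\<Sum>j<n. (?A * (s ^ j * S j)) powr p / 2 ^ j) \<le> ?A powr p * ?Q" for n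
  proof -
    have "(?A * (s ^ j * S j)) powr p / 2 ^ j = ?A powr p * S j powr p" for j
      using A0 S_facts(2)[of j] s_gt_1 root2_powr[OF p0, of j] by (simp add: powr_mult s_def)
    then have "(\<Sum>j<n. (?A * (s ^ j * S j)) powr p / 2 ^ j) = ?A powr p * (\<Sum>j<n. S j powr p)"
      by (simp add: sum_distrib_left)
    also have "\<dots> \<le> ?A powr p * ?Q" by (intro mult_left_mono S_facts(3)) auto
    finally show ?thesis .
  qed
  show ?thesis
    unfolding derivative_bound.admissible_def[OF db]
    using power_series_on_disc(1)[OF F_series] F0 sum A0 S_facts(2) s_gt_1 F_deriv_bound F_coeff_bound
    by (intro conjI allI impI) auto
qed

end

end

end

section \<open>Necessity and sufficiency joined\<close>

lemma (in radial) moment_conditions_necessary: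
  assumes T: "T \<in> {hilbert_op \<omega>, sublinear_hilbert_op \<omega>}" and q: "1 \<le> q" "q < p"
    and X: "X \<in> space_norms q" and Y: "Y \<in> space_norms q" and bdd: "bounded_operator T X Y"
  shows "\<exists>K C. moment_conditions \<omega> K C q p"
proof (rule necessary_moment_conditions[OF T q(1) X Y bdd])
  fix K C :: real
  assume K: "1 \<le> K" "\<And>k. mom (2 ^ k) \<le> K * mom (2 ^ Suc k)" and C: "0 \<le> C"
    "\<And>j k. j \<le> k \<Longrightarrow> mom (2 ^ k) \<le> C * (1 / 2 powr (1 / q)) ^ (k - j) * mom (2 ^ j)"
  have "moment_conditions \<omega> K C q p"
  proof (rule moment_conditions.intro[OF radial_axioms], rule moment_conditions_axioms.intro)
    show "1 \<le> K" by (rule K(1))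
    show "mom (2 ^ k) \<le> K * mom (2 ^ Suc k)" for k by (rule K(2))
    show "0 \<le> C" by (rule C(1))
    show "mom (2 ^ k) \<le> C * (1 / 2 powr (1 / q)) ^ (k - j) * mom (2 ^ j)" if "j \<le> k" for j k
      using that by (rule C(2))
  qed (rule q)+
  then show ?thesis by blast
qed

lemma (in moment_conditions) bounded_operator_space_norms:
  assumes T: "T \<in> {hilbert_op \<omega>, sublinear_hilbert_op \<omega>}"
    and X: "X \<in> space_norms p" and Y: "Y \<in> space_norms p"
  shows "bounded_operator T X Y"
proof -
  obtain u where u1: "\<And>f t. norm (u f t) = norm (f (of_real t))"
    and u2: "\<And>f t. f (of_real t) = of_real (norm (f (of_real t))) \<Longrightarrow> u f t = f (of_real t)"
    and u3: "\<And>f. f holomorphic_on ball 0 1 \<Longrightarrow> continuous_on {0..<1} (u f)"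
    and u4: "\<And>f. set_integrable lebesgue {0..<1} (\<lambda>t. u f t * of_real (\<omega> t)) \<Longrightarrow>
      \<exists>F. T f = Some F \<and> (\<forall>z. norm z < 1 \<longrightarrow> F z = hilb (\<lambda>t. u f t * of_real (\<omega> t)) z)"
    using operator_cases[OF T] by blast
  \<comment> \<open>An arbitrary R instead of 1 gives well-definedness on the whole space without a
    scaling argument; R = 1 then yields the supremum.\<close>
  have bound: "\<exists>c. \<forall>f. f holomorphic_on ball 0 1 \<and> X f \<le> ennreal R \<longrightarrow>
      (\<exists>F. T f = Some F \<and> F holomorphic_on ball 0 1 \<and> Y F \<le> ennreal c)" if R: "0 \<le> R" for R
  proof -
    obtain L where L: "\<And>f. f holomorphic_on ball 0 1 \<Longrightarrow> X f \<le> ennreal R \<Longrightarrow> dyadic_bounded p L f"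
      using space_norm_dyadic_bounded[OF X p_gt_1 R] by blast
    \<comment> \<open>L comes without a sign, while \<open>derivative_bound\<close> requires
      nonnegative constants.\<close>
    define L0 where "L0 = max L 0"
    define M where "M = kc 0 * (mom 1 * Wc * max 1 C * ((2 / (1 - \<eta>)) powr p * L0) powr (1 / p))"
    define L' where "L' = (Bc * Wc * max 1 C) powr p * ((2 / (1 - \<eta>)) powr p * L0)"
    have db: "derivative_bound p M L'"
      using p_gt_1 kc_pos[of 0] mom_pos[of 1] Wc_pos
      by (intro derivative_bound.intro) (auto simp: M_def L'_def L0_def)
    obtain c where "0 \<le> c" and c: "\<And>F \<Phi>. derivative_bound.admissible p M L' F \<Phi> \<Longrightarrow> Y F \<le> ennreal c"
      using derivative_bound.space_norm_admissible_bound[OF db Y] by blast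
    have "\<exists>F. T f = Some F \<and> F holomorphic_on ball 0 1 \<and> Y F \<le> ennreal c"
      if f: "f holomorphic_on ball 0 1" "X f \<le> ennreal R" for f
    proof -
      obtain g where g: "\<And>k. 0 \<le> g k" "\<And>k t. t \<in> dyadic_interval k \<Longrightarrow> norm (u f t) \<le> g k"
        and "\<And>n. (\<Sum>k<n. g k powr p / 2 ^ k) \<le> L"
        using L[OF f] unfolding dyadic_bounded_def u1 by blast
      then have gL: "(\<Sum>k<n. g k powr p / 2 ^ k) \<le> L0" for n by (simp add: L0_def le_max_iff_disj)
      note hyps = g(1) gL u3[OF f(1)] g(2) refl[of "u f _ * of_real (\<omega> _)"]
      obtain F where F: "T f = Some F" "\<And>z. norm z < 1 \<Longrightarrow> F z = hilb (\<lambda>t. u f t * of_real (\<omega> t)) z"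
        using u4[OF \<phi>_int[OF hyps]] by blast
      have adm: "derivative_bound.admissible p M L' F (\<lambda>j. Bc * Wc * max 1 C * (s ^ j * S g j))"
        using F_admissible[OF hyps F(2)] unfolding M_def L'_def by simp
      show ?thesis using c[OF adm] F(1) derivative_bound.F_hol[OF db adm] by blast
    qed
    then show ?thesis by blast
  qed
  have ball: "\<exists>F\<in>analytic_space Y. T f = Some F" if "f \<in> analytic_space X" for f
  proof -
    have "f holomorphic_on ball 0 1" "X f < \<infinity>" using that by (auto simp: analytic_space_def)
    moreover from this(2) obtain R where "0 \<le> R" "X f = ennreal R" by (cases "X f") auto
    ultimately obtain F c where "T f = Some F" "F holomorphic_on ball 0 1" "Y F \<le> ennreal c"
      using bound[of R] by (metis order_refl)
    then show ?thesis by (auto simp: analytic_space_def intro: le_less_trans)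
  qed
  obtain c where c: "\<And>f. f holomorphic_on ball 0 1 \<Longrightarrow> X f \<le> ennreal 1 \<Longrightarrow>
      \<exists>F. T f = Some F \<and> F holomorphic_on ball 0 1 \<and> Y F \<le> ennreal c"
    using bound[of 1] by auto
  have "(SUP f\<in>{f \<in> analytic_space X. X f \<le> 1}. Y (the (T f))) \<le> ennreal c"
  proof (rule SUP_least)
    fix f assume "f \<in> {f \<in> analytic_space X. X f \<le> 1}"
    then show "Y (the (T f)) \<le> ennreal c" using c[of f] by (auto simp: analytic_space_def)
  qed
  also have "\<dots> < \<infinity>" by simp
  finally show ?thesis using ball by (auto simp: bounded_operator_def)
qed


theorem theorem5:
  fixes \<omega> :: "real \<Rightarrow> real" and p q :: real
    and T :: "(complex \<Rightarrow> complex) \<rightharpoonup> (complex \<Rightarrow> complex)"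
    and Xq Yq Xp Yp :: "(complex \<Rightarrow> complex) \<Rightarrow> ennreal"
  assumes "radial_weight \<omega>"
    and "T \<in> {hilbert_op \<omega>, sublinear_hilbert_op \<omega>}"
    and "1 \<le> q" and "q < p"
    and "Xq \<in> space_norms q" and "Yq \<in> space_norms q"
    and "Xp \<in> space_norms p" and "Yp \<in> space_norms p"
    and "bounded_operator T Xq Yq"
  shows "bounded_operator T Xp Yp"
proof -
  have r: "radial \<omega>" by (rule radial.intro) fact
  obtain K C where "moment_conditions \<omega> K C q p"
    using radial.moment_conditions_necessary[OF r assms(2-6,9)] by blast
  then show ?thesis using assms(2,7,8) by (rule moment_conditions.bounded_operator_space_norms)
qed

end
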